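(* Let $\mathcal{V}$ and $\mathcal{W}$ be symmetric monoidal model categories, and let $F\colon\mathcal{W}\rightleftarrows\mathcal{V}\colon G$ (with $F$ left adjoint) be a weak monoidal Quillen adjunction such that the oplax counit $\varepsilon\colon F(\mathbb{1}_{\mathcal{W}})\to\mathbb{1}_{\mathcal{V}}$ is an isomorphism. Then the change of enrichment $G_*$ along $G$ preserves the weak tensoring and the weak cotensoring: if $\mathcal{C}$ is a $\mathcal{V}$-enriched model category satisfying SM7 with a weak tensoring (respectively, a weak cotensoring) over $\mathcal{V}$, then the induced structure on $G_*\mathcal{C}$ is a weak tensoring (respectively, a weak cotensoring) over $\mathcal{W}$. If moreover the weak tensoring on $\mathcal{C}$ is set-compatible (respectively, unital), then so is the induced weak tensoring on $G_*\mathcal{C}$; likewise for the weak cotensoring.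
   Context: Monoidal model categories. A monoidal model category is a model category with a closed monoidal structure $(\otimes,\mathbb{1})$ satisfying the pushout-product axiom (for cofibrations $i\colon a\to b$, $k\colon x\to y$, the map $(a\otimes y)\amalg_{a\otimes x}(b\otimes x)\to b\otimes y$ is a cofibration, acyclic if $i$ or $k$ is) and the unit axiom (for $x$ cofibrant and every cofibrant replacement $q\colon Q\mathbb{1}\to\mathbb{1}$, the map $x\otimes Q\mathbb{1}\to x\otimes\mathbb{1}\cong x$ is a weak equivalence). It is symmetric if the structure is closed symmetric monoidal. Internal homs are written $\underline{\mathcal{V}}(-,-)$. Weak monoidal Quillen adjunction. A Quillen adjunction $F\colon\mathcal{W}\rightleftarrows\mathcal{V}\colon G$ between monoidal model categories with a lax monoidal structure on $G$ such that for the corresponding oplax structure $\delta_{x,y}\colon F(x\otimes y)\to F(x)\otimes F(y)$, $\varepsilon\colon F(\mathbb{1}_{\mathcal{W}})\to\mathbb{1}_{\mathcal{V}}$ on $F$: (i) $\delta_{x,y}$ is a weak equivalence for all cofibrant $x,y\in\mathcal{W}$; (ii) for some (hence any) cofibrant replacement $q\colon Q\mathbb{1}_{\mathcal{W}}\to\mathbb{1}_{\mathcal{W}}$, the composite $\varepsilon\circ F(q)\colon F(Q\mathbb{1}_{\mathcal{W}})\to\mathbb{1}_{\mathcal{V}}$ is a weak equivalence. Enriched model categories. For a $\mathcal{V}$-category $\mathcal{C}$ with hom-objects $\underline{\mathcal{C}}(x,y)$, the underlying category $\mathcal{C}_0$ has hom-sets $\mathcal{V}(\mathbb{1},\underline{\mathcal{C}}(x,y))$;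 write $U=\mathcal{V}(\mathbb{1},-)\colon\mathcal{V}\to\mathrm{Set}$. A $\mathcal{V}$-enriched model category is a $\mathcal{V}$-category with a model structure on $\mathcal{C}_0$. It satisfies SM7 if for each cofibration $i\colon a\to b$ and fibration $p\colon x\to y$ in $\mathcal{C}_0$, the map $\underline{\mathcal{C}}(b,x)\to\underline{\mathcal{C}}(a,x)\times_{\underline{\mathcal{C}}(a,y)}\underline{\mathcal{C}}(b,y)$ is a fibration in $\mathcal{V}$, acyclic if $i$ or $p$ is. $G_*\mathcal{C}$ is the $\mathcal{W}$-category with the same objects and hom-objects $G(\underline{\mathcal{C}}(x,y))$. When $\varepsilon$ is an isomorphism, the underlying category of $G_*\mathcal{C}$ is identified with $\mathcal{C}_0$ and given the same model structure. Weak (co)tensoring. Let $\mathcal{C}$ be a $\mathcal{V}$-enriched model category satisfying SM7. A weak tensoring of $\mathcal{C}$ over $\mathcal{V}$ is a bifunctor $\otimes\colon\mathcal{C}\times\mathcal{V}\to\mathcal{C}$ (on underlying categories) satisfying the external pushout-product axiom (for cofibrations $i\colon x\to y$ in $\mathcal{C}_0$ and $k\colon a\to b$ in $\mathcal{V}$, $(x\otimes b)\amalg_{x\otimes a}(y\otimes a)\to y\otimes b$ is a cofibration, acyclic if $i$ or $k$ is), with a natural map $\varphi_{v,x,y}\colon\underline{\mathcal{C}}(x\otimes v,y)\to\underline{\mathcal{V}}(v,\underline{\mathcal{C}}(x,y))$ in $\mathcal{V}$ that is a weak equivalence for $v,x$ cofibrant and $y$ fibrant, and a natural map $\rho_x\colon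 x\otimes\mathbb{1}\to x$ such that $\varphi_{\mathbb{1},x,y}\circ\rho_x^*$ is the canonical isomorphism $\underline{\mathcal{C}}(x,y)\cong\underline{\mathcal{V}}(\mathbb{1},\underline{\mathcal{C}}(x,y))$. A weak cotensoring is a bifunctor $(x,v)\mapsto x^v$, $\mathcal{C}\times\mathcal{V}^{\mathrm{op}}\to\mathcal{C}$, satisfying the external pullback-power axiom (for a cofibration $i\colon a\to b$ in $\mathcal{V}$ and a fibration $p\colon x\to y$ in $\mathcal{C}_0$, $x^b\to x^a\times_{y^a}y^b$ is a fibration, acyclic if $i$ or $p$ is), with a natural map $\psi_{v,x,y}\colon\underline{\mathcal{C}}(x,y^v)\to\underline{\mathcal{V}}(v,\underline{\mathcal{C}}(x,y))$ that is a weak equivalence for $v,x$ cofibrant and $y$ fibrant, and a natural map $\eta_y\colon y\to y^{\mathbb{1}}$ such that $\psi_{\mathbb{1},x,y}\circ(\eta_y)_*$ is the canonical isomorphism. The weak tensoring (cotensoring) is set-compatible if $U\varphi_{v,x,y}$ (resp. $U\psi_{v,x,y}$) is a bijection for all $v,x,y$, and unital if $\rho_x$ (resp. $\eta_y$) is an isomorphism for all objects. Induced structure on $G_*\mathcal{C}$. For $w\in\mathcal{W}$, $v\in\mathcal{V}$, let $\theta_{w,v}\colon G\underline{\mathcal{V}}(Fw,v)\to\underline{\mathcal{W}}(w,Gv)$ be the map corresponding by the tensor-hom adjunction and $F\dashv G$ to the composite $F(A\otimes w)\xrightarrow{\delta}FA\otimes Fw\to\underline{\mathcal{V}}(Fw,v)\otimes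 Fw\xrightarrow{\mathrm{ev}}v$, where $A=G\underline{\mathcal{V}}(Fw,v)$. The induced weak tensoring is $x\otimes w:=x\otimes Fw$ with structure maps $\theta_{w,\underline{\mathcal{C}}(x,y)}\circ G\varphi_{Fw,x,y}$ and $x\otimes F(\mathbb{1}_{\mathcal{W}})\xrightarrow{x\otimes\varepsilon}x\otimes\mathbb{1}_{\mathcal{V}}\xrightarrow{\rho_x}x$; the induced weak cotensoring is $y^w:=y^{Fw}$ with structure maps $\theta_{w,\underline{\mathcal{C}}(x,y)}\circ G\psi_{Fw,x,y}$ and $y\xrightarrow{\eta_y}y^{\mathbb{1}_{\mathcal{V}}}\xrightarrow{y^{\varepsilon}}y^{F(\mathbb{1}_{\mathcal{W}})}$.
   Formalization: The bare axioms allow counterexamples, so SM7 also requires C(x,y) fibrant for x cofibrant, y fibrant; a weak tensoring requires x⊗v cofibrant for x,v cofibrant; a weak cotensoring requires y^v fibrant for y fibrant, v cofibrant. These are both assumed for C and proved for G_*C. *)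

theory Defs
  imports Main
begin

section \<open>Categories, functors, limits\<close>

text \<open>
  Categories have a carrier of objects and a carrier of arrows; every arrow determines its
  domain and codomain, so hom-sets are disjoint. Composition is written in the usual order.
\<close>

record ('o, 'm) cat =
  Obj :: "'o set"
  Arr :: "'m set"
  Dom :: "'m \<Rightarrow> 'o"
  Cod :: "'m \<Rightarrow> 'o"
  Ide :: "'o \<Rightarrow> 'm"
  Cmp :: "'m \<Rightarrow> 'm \<Rightarrow> 'm"  (infixr "\<cdot>\<index>" 65)

definition Hom :: "('o, 'm, 'z) cat_scheme \<Rightarrow> 'o \<Rightarrow> 'o \<Rightarrow> 'm set" where
  "Hom C x y = {f \<in> Arr C. Dom C f = x \<and> Cod C f = y}"

locale category =
  fixes C :: "('o, 'm, 'z) cat_scheme" (structure)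
  assumes dom_obj: "f \<in> Arr C \<Longrightarrow> Dom C f \<in> Obj C"
    and cod_obj: "f \<in> Arr C \<Longrightarrow> Cod C f \<in> Obj C"
    and ide_hom: "x \<in> Obj C \<Longrightarrow> Ide C x \<in> Hom C x x"
    and cmp_hom: "f \<in> Hom C x y \<Longrightarrow> g \<in> Hom C y z \<Longrightarrow> g \<cdot> f \<in> Hom C x z"
    and ide_left: "f \<in> Hom C x y \<Longrightarrow> Ide C y \<cdot> f = f"
    and ide_right: "f \<in> Hom C x y \<Longrightarrow> f \<cdot> Ide C x = f"
    and cmp_assoc: "f \<in> Hom C w x \<Longrightarrow> g \<in> Hom C x y \<Longrightarrow> h \<in> Hom C y z \<Longrightarrow>
                    (h \<cdot> g) \<cdot> f = h \<cdot> (g \<cdot> f)"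

definition inverse_of :: "('o, 'm, 'z) cat_scheme \<Rightarrow> 'm \<Rightarrow> 'm \<Rightarrow> bool" where
  "inverse_of C f g \<longleftrightarrow> g \<in> Hom C (Cod C f) (Dom C f)
     \<and> g \<cdot>\<^bsub>C\<^esub> f = Ide C (Dom C f) \<and> f \<cdot>\<^bsub>C\<^esub> g = Ide C (Cod C f)"

definition is_iso :: "('o, 'm, 'z) cat_scheme \<Rightarrow> 'm \<Rightarrow> bool" where
  "is_iso C f \<longleftrightarrow> f \<in> Arr C \<and> (\<exists>g. inverse_of C f g)"

definition inv_arr :: "('o, 'm, 'z) cat_scheme \<Rightarrow> 'm \<Rightarrow> 'm" where
  "inv_arr C f = (THE g. inverse_of C f g)"

definition op_cat :: "('o, 'm, 'z) cat_scheme \<Rightarrow> ('o, 'm) cat" where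
  "op_cat C = \<lparr>Obj = Obj C, Arr = Arr C, Dom = Cod C, Cod = Dom C, Ide = Ide C,
               Cmp = (\<lambda>g f. f \<cdot>\<^bsub>C\<^esub> g)\<rparr>"

definition prod_cat ::
    "('a, 'k, 'y) cat_scheme \<Rightarrow> ('b, 'l, 'z) cat_scheme \<Rightarrow> ('a \<times> 'b, 'k \<times> 'l) cat" where
  "prod_cat A B = \<lparr>Obj = Obj A \<times> Obj B, Arr = Arr A \<times> Arr B,
     Dom = map_prod (Dom A) (Dom B), Cod = map_prod (Cod A) (Cod B),
     Ide = map_prod (Ide A) (Ide B),
     Cmp = (\<lambda>g f. (fst g \<cdot>\<^bsub>A\<^esub> fst f, snd g \<cdot>\<^bsub>B\<^esub> snd f))\<rparr>"

record ('a, 'k, 'b, 'l) func =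
  FObj :: "'a \<Rightarrow> 'b"
  FArr :: "'k \<Rightarrow> 'l"

locale is_functor =
  A: category A + B: category B
  for A :: "('a, 'k, 'y) cat_scheme" and B :: "('b, 'l, 'z) cat_scheme" +
  fixes F :: "('a, 'k, 'b, 'l) func"
  assumes F_obj: "x \<in> Obj A \<Longrightarrow> FObj F x \<in> Obj B"
    and F_hom: "f \<in> Hom A x y \<Longrightarrow> FArr F f \<in> Hom B (FObj F x) (FObj F y)"
    and F_ide: "x \<in> Obj A \<Longrightarrow> FArr F (Ide A x) = Ide B (FObj F x)"
    and F_cmp: "f \<in> Hom A x y \<Longrightarrow> g \<in> Hom A y z \<Longrightarrow>
                FArr F (g \<cdot>\<^bsub>A\<^esub> f) = FArr F g \<cdot>\<^bsub>B\<^esub> FArr F f"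

definition cone ::
    "('i, 'j, 'y) cat_scheme \<Rightarrow> ('o, 'm, 'z) cat_scheme \<Rightarrow> ('i, 'j, 'o, 'm) func
     \<Rightarrow> 'o \<Rightarrow> ('i \<Rightarrow> 'm) \<Rightarrow> bool" where
  "cone J C D L p \<longleftrightarrow> L \<in> Obj C \<and> (\<forall>j\<in>Obj J. p j \<in> Hom C L (FObj D j))
     \<and> (\<forall>u\<in>Arr J. FArr D u \<cdot>\<^bsub>C\<^esub> p (Dom J u) = p (Cod J u))"

definition is_limit ::
    "('i, 'j, 'y) cat_scheme \<Rightarrow> ('o, 'm, 'z) cat_scheme \<Rightarrow> ('i, 'j, 'o, 'm) func
     \<Rightarrow> 'o \<Rightarrow> ('i \<Rightarrow> 'm) \<Rightarrow> bool" where
  "is_limit J C D L p \<longleftrightarrow> cone J C D L p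
     \<and> (\<forall>X q. cone J C D X q \<longrightarrow> (\<exists>!h. h \<in> Hom C X L \<and> (\<forall>j\<in>Obj J. p j \<cdot>\<^bsub>C\<^esub> h = q j)))"

definition cocone ::
    "('i, 'j, 'y) cat_scheme \<Rightarrow> ('o, 'm, 'z) cat_scheme \<Rightarrow> ('i, 'j, 'o, 'm) func
     \<Rightarrow> 'o \<Rightarrow> ('i \<Rightarrow> 'm) \<Rightarrow> bool" where
  "cocone J C D L p \<longleftrightarrow> L \<in> Obj C \<and> (\<forall>j\<in>Obj J. p j \<in> Hom C (FObj D j) L)
     \<and> (\<forall>u\<in>Arr J. p (Cod J u) \<cdot>\<^bsub>C\<^esub> FArr D u = p (Dom J u))"

definition is_colimit ::
    "('i, 'j, 'y) cat_scheme \<Rightarrow> ('o, 'm, 'z) cat_scheme \<Rightarrow> ('i, 'j, 'o, 'm) func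
     \<Rightarrow> 'o \<Rightarrow> ('i \<Rightarrow> 'm) \<Rightarrow> bool" where
  "is_colimit J C D L p \<longleftrightarrow> cocone J C D L p
     \<and> (\<forall>X q. cocone J C D X q \<longrightarrow> (\<exists>!h. h \<in> Hom C L X \<and> (\<forall>j\<in>Obj J. h \<cdot>\<^bsub>C\<^esub> p j = q j)))"

text \<open>
  A formula cannot quantify over all types, so smallness is measured by a type parameter:
  a diagram is small if its shape is a category whose objects and arrows are taken from the
  type \<open>'s\<close>, which is arbitrary and unrelated to the types of \<open>C\<close>.
\<close>

definition small_complete :: "'s itself \<Rightarrow> ('o, 'm, 'z) cat_scheme \<Rightarrow> bool" where
  "small_complete s C \<longleftrightarrow> (\<forall>(J :: ('s, 's) cat) D. category J \<longrightarrow> is_functor J C D \<longrightarrow>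
      (\<exists>L p. is_limit J C D L p))"

definition small_cocomplete :: "'s itself \<Rightarrow> ('o, 'm, 'z) cat_scheme \<Rightarrow> bool" where
  "small_cocomplete s C \<longleftrightarrow> (\<forall>(J :: ('s, 's) cat) D. category J \<longrightarrow> is_functor J C D \<longrightarrow>
      (\<exists>L p. is_colimit J C D L p))"

definition initial_obj :: "('o, 'm, 'z) cat_scheme \<Rightarrow> 'o \<Rightarrow> bool" where
  "initial_obj C i \<longleftrightarrow> i \<in> Obj C \<and> (\<forall>x\<in>Obj C. \<exists>!f. f \<in> Hom C i x)"

definition terminal_obj :: "('o, 'm, 'z) cat_scheme \<Rightarrow> 'o \<Rightarrow> bool" where
  "terminal_obj C t \<longleftrightarrow> t \<in> Obj C \<and> (\<forall>x\<in>Obj C. \<exists>!f. f \<in> Hom C x t)"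

definition is_pullback ::
    "('o, 'm, 'z) cat_scheme \<Rightarrow> 'm \<Rightarrow> 'm \<Rightarrow> 'o \<Rightarrow> 'm \<Rightarrow> 'm \<Rightarrow> bool" where
  "is_pullback C f g P p q \<longleftrightarrow> f \<in> Arr C \<and> g \<in> Arr C \<and> Cod C f = Cod C g
     \<and> p \<in> Hom C P (Dom C f) \<and> q \<in> Hom C P (Dom C g) \<and> f \<cdot>\<^bsub>C\<^esub> p = g \<cdot>\<^bsub>C\<^esub> q
     \<and> (\<forall>X r t. r \<in> Hom C X (Dom C f) \<longrightarrow> t \<in> Hom C X (Dom C g) \<longrightarrow> f \<cdot>\<^bsub>C\<^esub> r = g \<cdot>\<^bsub>C\<^esub> t \<longrightarrow>
          (\<exists>!h. h \<in> Hom C X P \<and> p \<cdot>\<^bsub>C\<^esub> h = r \<and> q \<cdot>\<^bsub>C\<^esub> h = t))"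

definition is_pushout ::
    "('o, 'm, 'z) cat_scheme \<Rightarrow> 'm \<Rightarrow> 'm \<Rightarrow> 'o \<Rightarrow> 'm \<Rightarrow> 'm \<Rightarrow> bool" where
  "is_pushout C f g P p q \<longleftrightarrow> f \<in> Arr C \<and> g \<in> Arr C \<and> Dom C f = Dom C g
     \<and> p \<in> Hom C (Cod C f) P \<and> q \<in> Hom C (Cod C g) P \<and> p \<cdot>\<^bsub>C\<^esub> f = q \<cdot>\<^bsub>C\<^esub> g
     \<and> (\<forall>X r t. r \<in> Hom C (Cod C f) X \<longrightarrow> t \<in> Hom C (Cod C g) X \<longrightarrow> r \<cdot>\<^bsub>C\<^esub> f = t \<cdot>\<^bsub>C\<^esub> g \<longrightarrow>
          (\<exists>!h. h \<in> Hom C P X \<and> h \<cdot>\<^bsub>C\<^esub> p = r \<and> h \<cdot>\<^bsub>C\<^esub> q = t))"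


section \<open>Model categories\<close>

record 'm model_str =
  Weq :: "'m set"
  Cof :: "'m set"
  Fib :: "'m set"

definition retract_of :: "('o, 'm, 'z) cat_scheme \<Rightarrow> 'm \<Rightarrow> 'm \<Rightarrow> bool" where
  "retract_of C f g \<longleftrightarrow> f \<in> Arr C \<and> g \<in> Arr C \<and> (\<exists>s r s' r'.
      s \<in> Hom C (Dom C f) (Dom C g) \<and> r \<in> Hom C (Dom C g) (Dom C f) \<and> r \<cdot>\<^bsub>C\<^esub> s = Ide C (Dom C f)
    \<and> s' \<in> Hom C (Cod C f) (Cod C g) \<and> r' \<in> Hom C (Cod C g) (Cod C f) \<and> r' \<cdot>\<^bsub>C\<^esub> s' = Ide C (Cod C f)
    \<and> g \<cdot>\<^bsub>C\<^esub> s = s' \<cdot>\<^bsub>C\<^esub> f \<and> f \<cdot>\<^bsub>C\<^esub> r = r' \<cdot>\<^bsub>C\<^esub> g)"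

definition has_lifting :: "('o, 'm, 'z) cat_scheme \<Rightarrow> 'm \<Rightarrow> 'm \<Rightarrow> bool" where
  "has_lifting C i p \<longleftrightarrow> (\<forall>u v. u \<in> Hom C (Dom C i) (Dom C p) \<longrightarrow> v \<in> Hom C (Cod C i) (Cod C p) \<longrightarrow>
      p \<cdot>\<^bsub>C\<^esub> u = v \<cdot>\<^bsub>C\<^esub> i \<longrightarrow>
      (\<exists>h. h \<in> Hom C (Cod C i) (Dom C p) \<and> h \<cdot>\<^bsub>C\<^esub> i = u \<and> p \<cdot>\<^bsub>C\<^esub> h = v))"

locale model_category = category C
  for s :: "'s itself" and C :: "('o, 'm, 'z) cat_scheme" +
  fixes M :: "'m model_str"
  assumes complete: "small_complete s C"
    and cocomplete: "small_cocomplete s C"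
    and weq_arr: "Weq M \<subseteq> Arr C" and cof_arr: "Cof M \<subseteq> Arr C" and fib_arr: "Fib M \<subseteq> Arr C"
    and two_of_three:
      "f \<in> Hom C x y \<Longrightarrow> g \<in> Hom C y z \<Longrightarrow> f \<in> Weq M \<Longrightarrow> g \<in> Weq M \<Longrightarrow> g \<cdot>\<^bsub>C\<^esub> f \<in> Weq M"
      "f \<in> Hom C x y \<Longrightarrow> g \<in> Hom C y z \<Longrightarrow> f \<in> Weq M \<Longrightarrow> g \<cdot>\<^bsub>C\<^esub> f \<in> Weq M \<Longrightarrow> g \<in> Weq M"
      "f \<in> Hom C x y \<Longrightarrow> g \<in> Hom C y z \<Longrightarrow> g \<in> Weq M \<Longrightarrow> g \<cdot>\<^bsub>C\<^esub> f \<in> Weq M \<Longrightarrow> f \<in> Weq M"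
    and retracts:
      "retract_of C f g \<Longrightarrow> g \<in> Weq M \<Longrightarrow> f \<in> Weq M"
      "retract_of C f g \<Longrightarrow> g \<in> Cof M \<Longrightarrow> f \<in> Cof M"
      "retract_of C f g \<Longrightarrow> g \<in> Fib M \<Longrightarrow> f \<in> Fib M"
    and lifting:
      "i \<in> Cof M \<Longrightarrow> p \<in> Fib M \<Longrightarrow> i \<in> Weq M \<or> p \<in> Weq M \<Longrightarrow> has_lifting C i p"
    and factorization:
      "f \<in> Hom C x y \<Longrightarrow> \<exists>z i p. i \<in> Hom C x z \<and> p \<in> Hom C z y \<and> p \<cdot>\<^bsub>C\<^esub> i = f
         \<and> i \<in> Cof M \<and> p \<in> Fib M \<inter> Weq M"
      "f \<in> Hom C x y \<Longrightarrow> \<exists>z i p. i \<in> Hom C x z \<and> p \<in> Hom C z y \<and> p \<cdot>\<^bsub>C\<^esub> i = f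
         \<and> i \<in> Cof M \<inter> Weq M \<and> p \<in> Fib M"

definition cofibrant :: "('o, 'm, 'z) cat_scheme \<Rightarrow> 'm model_str \<Rightarrow> 'o \<Rightarrow> bool" where
  "cofibrant C M x \<longleftrightarrow> (\<exists>i f. initial_obj C i \<and> f \<in> Hom C i x \<and> f \<in> Cof M)"

definition fibrant :: "('o, 'm, 'z) cat_scheme \<Rightarrow> 'm model_str \<Rightarrow> 'o \<Rightarrow> bool" where
  "fibrant C M x \<longleftrightarrow> (\<exists>t f. terminal_obj C t \<and> f \<in> Hom C x t \<and> f \<in> Fib M)"

definition cofibrant_replacement ::
    "('o, 'm, 'z) cat_scheme \<Rightarrow> 'm model_str \<Rightarrow> 'o \<Rightarrow> 'o \<Rightarrow> 'm \<Rightarrow> bool" where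
  "cofibrant_replacement C M x Q q \<longleftrightarrow> cofibrant C M Q \<and> q \<in> Hom C Q x \<and> q \<in> Weq M"

text \<open>
  For a functor \<open>T : A \<times> B \<rightarrow> D\<close>, the axiom is stated for every pushout \<open>P\<close> of
  \<open>T(b, x) \<leftarrow> T(a, x) \<rightarrow> T(a, y)\<close>; it does not depend on the choice of \<open>P\<close>.
\<close>

definition pushout_product_axiom ::
    "('a, 'k, 'x) cat_scheme \<Rightarrow> 'k model_str \<Rightarrow> ('b, 'l, 'y) cat_scheme \<Rightarrow> 'l model_str
     \<Rightarrow> ('o, 'm, 'z) cat_scheme \<Rightarrow> 'm model_str \<Rightarrow> ('a \<times> 'b, 'k \<times> 'l, 'o, 'm) func \<Rightarrow> bool" where
  "pushout_product_axiom A MA B MB D MD T \<longleftrightarrow>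
     (\<forall>a b i x y k P p q u. i \<in> Hom A a b \<longrightarrow> i \<in> Cof MA \<longrightarrow> k \<in> Hom B x y \<longrightarrow> k \<in> Cof MB \<longrightarrow>
        is_pushout D (FArr T (Ide A a, k)) (FArr T (i, Ide B x)) P p q \<longrightarrow>
        u \<in> Hom D P (FObj T (b, y)) \<longrightarrow>
        u \<cdot>\<^bsub>D\<^esub> p = FArr T (i, Ide B y) \<longrightarrow> u \<cdot>\<^bsub>D\<^esub> q = FArr T (Ide A b, k) \<longrightarrow>
        u \<in> Cof MD \<and> (i \<in> Weq MA \<or> k \<in> Weq MB \<longrightarrow> u \<in> Weq MD))"

text \<open>
  The dual form, for a functor \<open>H : A \<times> B\<^sup>o\<^sup>p \<rightarrow> D\<close>, covariant in its first argument: for a cofibration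
  \<open>i : a \<rightarrow> b\<close> of \<open>B\<close> and a fibration \<open>f : x \<rightarrow> y\<close> of \<open>A\<close> it concerns the map from \<open>H(x, b)\<close> to the
  pullback of \<open>H(x, a) \<rightarrow> H(y, a) \<leftarrow> H(y, b)\<close>.
\<close>

definition pullback_power_axiom ::
    "('a, 'k, 'x) cat_scheme \<Rightarrow> 'k model_str \<Rightarrow> ('b, 'l, 'y) cat_scheme \<Rightarrow> 'l model_str
     \<Rightarrow> ('o, 'm, 'z) cat_scheme \<Rightarrow> 'm model_str \<Rightarrow> ('a \<times> 'b, 'k \<times> 'l, 'o, 'm) func \<Rightarrow> bool" where
  "pullback_power_axiom A MA B MB D MD H \<longleftrightarrow>
     (\<forall>a b i x y f P p q u. i \<in> Hom B a b \<longrightarrow> i \<in> Cof MB \<longrightarrow> f \<in> Hom A x y \<longrightarrow> f \<in> Fib MA \<longrightarrow>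
        is_pullback D (FArr H (f, Ide B a)) (FArr H (Ide A y, i)) P p q \<longrightarrow>
        u \<in> Hom D (FObj H (x, b)) P \<longrightarrow>
        p \<cdot>\<^bsub>D\<^esub> u = FArr H (Ide A x, i) \<longrightarrow> q \<cdot>\<^bsub>D\<^esub> u = FArr H (f, Ide B b) \<longrightarrow>
        u \<in> Fib MD \<and> (i \<in> Weq MB \<or> f \<in> Weq MA \<longrightarrow> u \<in> Weq MD))"


section \<open>Closed symmetric monoidal categories and monoidal model categories\<close>

record ('o, 'm) mon_cat = "('o, 'm) cat" +
  Tens :: "('o \<times> 'o, 'm \<times> 'm, 'o, 'm) func"
  Unit :: "'o"  ("\<one>\<index>")
  Assoc :: "'o \<Rightarrow> 'o \<Rightarrow> 'o \<Rightarrow> 'm"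
  LUnit :: "'o \<Rightarrow> 'm"
  RUnit :: "'o \<Rightarrow> 'm"
  Symm :: "'o \<Rightarrow> 'o \<Rightarrow> 'm"
  IHom :: "'o \<Rightarrow> 'o \<Rightarrow> 'o"
  Eval :: "'o \<Rightarrow> 'o \<Rightarrow> 'm"

abbreviation tens_obj :: "('o, 'm, 'z) mon_cat_scheme \<Rightarrow> 'o \<Rightarrow> 'o \<Rightarrow> 'o" (infixr "\<otimes>\<index>" 70) where
  "tens_obj V x y \<equiv> FObj (Tens V) (x, y)"

abbreviation tens_arr :: "('o, 'm, 'z) mon_cat_scheme \<Rightarrow> 'm \<Rightarrow> 'm \<Rightarrow> 'm" (infixr "\<boxtimes>\<index>" 70) where
  "tens_arr V f g \<equiv> FArr (Tens V) (f, g)"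

text \<open>
  \<open>IHom V x y\<close> is the internal hom from \<open>x\<close> to \<open>y\<close>, with evaluation
  \<open>Eval V x y : IHom V x y \<otimes> x \<rightarrow> y\<close>.
\<close>

locale closed_symmetric_monoidal_category = category V
  for V :: "('o, 'm) mon_cat" (structure) +
  assumes tens_functor: "is_functor (prod_cat V V) V (Tens V)"
    and unit_obj: "\<one> \<in> Obj V"
    and assoc_iso: "x \<in> Obj V \<Longrightarrow> y \<in> Obj V \<Longrightarrow> z \<in> Obj V \<Longrightarrow>
      Assoc V x y z \<in> Hom V ((x \<otimes> y) \<otimes> z) (x \<otimes> (y \<otimes> z)) \<and> is_iso V (Assoc V x y z)"
    and assoc_natural:
      "f \<in> Hom V x x' \<Longrightarrow> g \<in> Hom V y y' \<Longrightarrow> h \<in> Hom V z z' \<Longrightarrow>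
       Assoc V x' y' z' \<cdot> ((f \<boxtimes> g) \<boxtimes> h) = (f \<boxtimes> (g \<boxtimes> h)) \<cdot> Assoc V x y z"
    and lunit_iso: "x \<in> Obj V \<Longrightarrow> LUnit V x \<in> Hom V (\<one> \<otimes> x) x \<and> is_iso V (LUnit V x)"
    and lunit_natural: "f \<in> Hom V x y \<Longrightarrow> LUnit V y \<cdot> (Ide V \<one> \<boxtimes> f) = f \<cdot> LUnit V x"
    and runit_iso: "x \<in> Obj V \<Longrightarrow> RUnit V x \<in> Hom V (x \<otimes> \<one>) x \<and> is_iso V (RUnit V x)"
    and runit_natural: "f \<in> Hom V x y \<Longrightarrow> RUnit V y \<cdot> (f \<boxtimes> Ide V \<one>) = f \<cdot> RUnit V x"
    and pentagon:
      "w \<in> Obj V \<Longrightarrow> x \<in> Obj V \<Longrightarrow> y \<in> Obj V \<Longrightarrow> z \<in> Obj V \<Longrightarrow>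
       (Ide V w \<boxtimes> Assoc V x y z) \<cdot> Assoc V w (x \<otimes> y) z \<cdot> (Assoc V w x y \<boxtimes> Ide V z)
         = Assoc V w x (y \<otimes> z) \<cdot> Assoc V (w \<otimes> x) y z"
    and triangle:
      "x \<in> Obj V \<Longrightarrow> y \<in> Obj V \<Longrightarrow>
       (Ide V x \<boxtimes> LUnit V y) \<cdot> Assoc V x \<one> y = RUnit V x \<boxtimes> Ide V y"
    and symm_hom: "x \<in> Obj V \<Longrightarrow> y \<in> Obj V \<Longrightarrow> Symm V x y \<in> Hom V (x \<otimes> y) (y \<otimes> x)"
    and symm_natural:
      "f \<in> Hom V x x' \<Longrightarrow> g \<in> Hom V y y' \<Longrightarrow> Symm V x' y' \<cdot> (f \<boxtimes> g) = (g \<boxtimes> f) \<cdot> Symm V x y"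
    and symm_inverse:
      "x \<in> Obj V \<Longrightarrow> y \<in> Obj V \<Longrightarrow> Symm V y x \<cdot> Symm V x y = Ide V (x \<otimes> y)"
    and hexagon:
      "x \<in> Obj V \<Longrightarrow> y \<in> Obj V \<Longrightarrow> z \<in> Obj V \<Longrightarrow>
       Assoc V y z x \<cdot> Symm V x (y \<otimes> z) \<cdot> Assoc V x y z
         = (Ide V y \<boxtimes> Symm V x z) \<cdot> Assoc V y x z \<cdot> (Symm V x y \<boxtimes> Ide V z)"
    and ihom_obj: "x \<in> Obj V \<Longrightarrow> y \<in> Obj V \<Longrightarrow> IHom V x y \<in> Obj V"
    and eval_hom: "x \<in> Obj V \<Longrightarrow> y \<in> Obj V \<Longrightarrow> Eval V x y \<in> Hom V (IHom V x y \<otimes> x) y"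
    and closed:
      "a \<in> Obj V \<Longrightarrow> x \<in> Obj V \<Longrightarrow> y \<in> Obj V \<Longrightarrow> f \<in> Hom V (a \<otimes> x) y \<Longrightarrow>
       \<exists>!g. g \<in> Hom V a (IHom V x y) \<and> Eval V x y \<cdot> (g \<boxtimes> Ide V x) = f"

definition curry_arr :: "('o, 'm) mon_cat \<Rightarrow> 'o \<Rightarrow> 'o \<Rightarrow> 'o \<Rightarrow> 'm \<Rightarrow> 'm" where
  "curry_arr V a x y f =
     (THE g. g \<in> Hom V a (IHom V x y) \<and> Eval V x y \<cdot>\<^bsub>V\<^esub> (g \<boxtimes>\<^bsub>V\<^esub> Ide V x) = f)"

text \<open>
  Functoriality of the internal hom: for \<open>k : v \<rightarrow> v'\<close> and \<open>h : z \<rightarrow> z'\<close> the induced map from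
  \<open>IHom V v' z\<close> to \<open>IHom V v z'\<close>.
\<close>

definition ihom_arr :: "('o, 'm) mon_cat \<Rightarrow> 'm \<Rightarrow> 'm \<Rightarrow> 'm" where
  "ihom_arr V k h =
     (let v = Dom V k; v' = Cod V k; z = Dom V h; z' = Cod V h in
      curry_arr V (IHom V v' z) v z'
        (h \<cdot>\<^bsub>V\<^esub> Eval V v' z \<cdot>\<^bsub>V\<^esub> (Ide V (IHom V v' z) \<boxtimes>\<^bsub>V\<^esub> k)))"

locale symmetric_monoidal_model_category =
  closed_symmetric_monoidal_category V + model_category s V M
  for s :: "'s itself" and V :: "('o, 'm) mon_cat" and M :: "'m model_str" +
  assumes pushout_product: "pushout_product_axiom V M V M V M (Tens V)"
    and unit_axiom:
      "cofibrant V M x \<Longrightarrow> cofibrant_replacement V M (Unit V) Q q \<Longrightarrow>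
       RUnit V x \<cdot>\<^bsub>V\<^esub> (Ide V x \<boxtimes>\<^bsub>V\<^esub> q) \<in> Weq M"


section \<open>Weak monoidal Quillen adjunctions\<close>

locale adjunction =
  F: is_functor W V F + G: is_functor V W G
  for W :: "('w, 'n, 'y) cat_scheme" and V :: "('v, 'm, 'z) cat_scheme"
    and F :: "('w, 'n, 'v, 'm) func" and G :: "('v, 'm, 'w, 'n) func" +
  fixes eta :: "'w \<Rightarrow> 'n" and kappa :: "'v \<Rightarrow> 'm"
  assumes unit_hom: "x \<in> Obj W \<Longrightarrow> eta x \<in> Hom W x (FObj G (FObj F x))"
    and unit_natural: "f \<in> Hom W x y \<Longrightarrow> eta y \<cdot>\<^bsub>W\<^esub> f = FArr G (FArr F f) \<cdot>\<^bsub>W\<^esub> eta x"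
    and counit_hom: "v \<in> Obj V \<Longrightarrow> kappa v \<in> Hom V (FObj F (FObj G v)) v"
    and counit_natural: "h \<in> Hom V u v \<Longrightarrow> kappa v \<cdot>\<^bsub>V\<^esub> FArr F (FArr G h) = h \<cdot>\<^bsub>V\<^esub> kappa u"
    and triangle_left:
      "x \<in> Obj W \<Longrightarrow> kappa (FObj F x) \<cdot>\<^bsub>V\<^esub> FArr F (eta x) = Ide V (FObj F x)"
    and triangle_right:
      "v \<in> Obj V \<Longrightarrow> FArr G (kappa v) \<cdot>\<^bsub>W\<^esub> eta (FObj G v) = Ide W (FObj G v)"

locale lax_monoidal_functor = is_functor V W G
  for V :: "('v, 'm) mon_cat" and W :: "('w, 'n) mon_cat" and G :: "('v, 'm, 'w, 'n) func" +
  fixes mu :: "'v \<Rightarrow> 'v \<Rightarrow> 'n" and iota :: "'n"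
  assumes mu_hom: "x \<in> Obj V \<Longrightarrow> y \<in> Obj V \<Longrightarrow>
      mu x y \<in> Hom W (FObj G x \<otimes>\<^bsub>W\<^esub> FObj G y) (FObj G (x \<otimes>\<^bsub>V\<^esub> y))"
    and mu_natural: "f \<in> Hom V x x' \<Longrightarrow> g \<in> Hom V y y' \<Longrightarrow>
      mu x' y' \<cdot>\<^bsub>W\<^esub> (FArr G f \<boxtimes>\<^bsub>W\<^esub> FArr G g) = FArr G (f \<boxtimes>\<^bsub>V\<^esub> g) \<cdot>\<^bsub>W\<^esub> mu x y"
    and iota_hom: "iota \<in> Hom W (Unit W) (FObj G (Unit V))"
    and lax_assoc: "x \<in> Obj V \<Longrightarrow> y \<in> Obj V \<Longrightarrow> z \<in> Obj V \<Longrightarrow>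
      FArr G (Assoc V x y z) \<cdot>\<^bsub>W\<^esub> mu (x \<otimes>\<^bsub>V\<^esub> y) z \<cdot>\<^bsub>W\<^esub> (mu x y \<boxtimes>\<^bsub>W\<^esub> Ide W (FObj G z))
        = mu x (y \<otimes>\<^bsub>V\<^esub> z) \<cdot>\<^bsub>W\<^esub> (Ide W (FObj G x) \<boxtimes>\<^bsub>W\<^esub> mu y z)
            \<cdot>\<^bsub>W\<^esub> Assoc W (FObj G x) (FObj G y) (FObj G z)"
    and lax_lunit: "x \<in> Obj V \<Longrightarrow>
      FArr G (LUnit V x) \<cdot>\<^bsub>W\<^esub> mu (Unit V) x \<cdot>\<^bsub>W\<^esub> (iota \<boxtimes>\<^bsub>W\<^esub> Ide W (FObj G x)) = LUnit W (FObj G x)"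
    and lax_runit: "x \<in> Obj V \<Longrightarrow>
      FArr G (RUnit V x) \<cdot>\<^bsub>W\<^esub> mu x (Unit V) \<cdot>\<^bsub>W\<^esub> (Ide W (FObj G x) \<boxtimes>\<^bsub>W\<^esub> iota) = RUnit W (FObj G x)"

record ('w, 'n, 'v, 'm) lax_adj =
  LeftF :: "('w, 'n, 'v, 'm) func"
  RightF :: "('v, 'm, 'w, 'n) func"
  AUnit :: "'w \<Rightarrow> 'n"
  ACounit :: "'v \<Rightarrow> 'm"
  LaxMult :: "'v \<Rightarrow> 'v \<Rightarrow> 'n"
  LaxUnit :: "'n"

text \<open>The oplax structure on the left adjoint: the mates of the lax structure maps.\<close>

definition oplax_mult ::
    "('w, 'n) mon_cat \<Rightarrow> ('v, 'm) mon_cat \<Rightarrow> ('w, 'n, 'v, 'm) lax_adj \<Rightarrow> 'w \<Rightarrow> 'w \<Rightarrow> 'm" where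
  "oplax_mult W V A x y =
     ACounit A (FObj (LeftF A) x \<otimes>\<^bsub>V\<^esub> FObj (LeftF A) y)
       \<cdot>\<^bsub>V\<^esub> FArr (LeftF A) (LaxMult A (FObj (LeftF A) x) (FObj (LeftF A) y)
                            \<cdot>\<^bsub>W\<^esub> (AUnit A x \<boxtimes>\<^bsub>W\<^esub> AUnit A y))"

definition oplax_unit :: "('v, 'm) mon_cat \<Rightarrow> ('w, 'n, 'v, 'm) lax_adj \<Rightarrow> 'm" where
  "oplax_unit V A = ACounit A (Unit V) \<cdot>\<^bsub>V\<^esub> FArr (LeftF A) (LaxUnit A)"

locale weak_monoidal_Quillen_adjunction =
  adjunction W V "LeftF A" "RightF A" "AUnit A" "ACounit A" +
  lax_monoidal_functor V W "RightF A" "LaxMult A" "LaxUnit A"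
  for W :: "('w, 'n) mon_cat" and MW :: "'n model_str"
    and V :: "('v, 'm) mon_cat" and MV :: "'m model_str"
    and A :: "('w, 'n, 'v, 'm) lax_adj" +
  assumes preserves_cof: "f \<in> Cof MW \<Longrightarrow> FArr (LeftF A) f \<in> Cof MV"
    and preserves_acyclic_cof:
      "f \<in> Cof MW \<Longrightarrow> f \<in> Weq MW \<Longrightarrow> FArr (LeftF A) f \<in> Cof MV \<inter> Weq MV"
    and oplax_mult_weq:
      "cofibrant W MW x \<Longrightarrow> cofibrant W MW y \<Longrightarrow> oplax_mult W V A x y \<in> Weq MV"
    and oplax_unit_weq:
      "\<exists>Q q. cofibrant_replacement W MW (Unit W) Q q
             \<and> oplax_unit V A \<cdot>\<^bsub>V\<^esub> FArr (LeftF A) q \<in> Weq MV"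


section \<open>Enriched categories and enriched model categories\<close>

record ('c, 'v, 'm) ecat =
  EObj :: "'c set"
  EHom :: "'c \<Rightarrow> 'c \<Rightarrow> 'v"
  EIde :: "'c \<Rightarrow> 'm"
  ECmp :: "'c \<Rightarrow> 'c \<Rightarrow> 'c \<Rightarrow> 'm"

locale enriched_category = closed_symmetric_monoidal_category V
  for V :: "('v, 'm) mon_cat" (structure) +
  fixes C :: "('c, 'v, 'm) ecat"
  assumes ehom_obj: "x \<in> EObj C \<Longrightarrow> y \<in> EObj C \<Longrightarrow> EHom C x y \<in> Obj V"
    and eide_hom: "x \<in> EObj C \<Longrightarrow> EIde C x \<in> Hom V \<one> (EHom C x x)"
    and ecmp_hom: "x \<in> EObj C \<Longrightarrow> y \<in> EObj C \<Longrightarrow> z \<in> EObj C \<Longrightarrow>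
      ECmp C x y z \<in> Hom V (EHom C y z \<otimes> EHom C x y) (EHom C x z)"
    and ecmp_assoc: "w \<in> EObj C \<Longrightarrow> x \<in> EObj C \<Longrightarrow> y \<in> EObj C \<Longrightarrow> z \<in> EObj C \<Longrightarrow>
      ECmp C w x z \<cdot> (ECmp C x y z \<boxtimes> Ide V (EHom C w x))
        = ECmp C w y z \<cdot> (Ide V (EHom C y z) \<boxtimes> ECmp C w x y)
            \<cdot> Assoc V (EHom C y z) (EHom C x y) (EHom C w x)"
    and eide_left: "x \<in> EObj C \<Longrightarrow> y \<in> EObj C \<Longrightarrow>
      ECmp C x y y \<cdot> (EIde C y \<boxtimes> Ide V (EHom C x y)) = LUnit V (EHom C x y)"
    and eide_right: "x \<in> EObj C \<Longrightarrow> y \<in> EObj C \<Longrightarrow>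
      ECmp C x x y \<cdot> (Ide V (EHom C x y) \<boxtimes> EIde C x) = RUnit V (EHom C x y)"

text \<open>
  The underlying category. Its arrows are tagged with their domain and codomain because the
  hom-objects of different pairs of objects may coincide.
\<close>

definition underlying ::
    "('v, 'm) mon_cat \<Rightarrow> ('c, 'v, 'm) ecat \<Rightarrow> ('c, 'c \<times> 'm \<times> 'c) cat" where
  "underlying V C = \<lparr>Obj = EObj C,
     Arr = {(x, f, y). x \<in> EObj C \<and> y \<in> EObj C \<and> f \<in> Hom V (Unit V) (EHom C x y)},
     Dom = fst, Cod = snd \<circ> snd, Ide = (\<lambda>x. (x, EIde C x, x)),
     Cmp = (\<lambda>(y', g, z) (x, f, y).
       (x, ECmp C x y z \<cdot>\<^bsub>V\<^esub> (g \<boxtimes>\<^bsub>V\<^esub> f) \<cdot>\<^bsub>V\<^esub> inv_arr V (LUnit V (Unit V)), z))\<rparr>"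

text \<open>
  For arrows \<open>f : x \<rightarrow> x'\<close> and \<open>g : y \<rightarrow> y'\<close> of the underlying category, precomposition with \<open>f\<close>
  is a map from \<open>EHom C x' y\<close> to \<open>EHom C x y\<close>, and postcomposition with \<open>g\<close> is a map from
  \<open>EHom C x y\<close> to \<open>EHom C x y'\<close>. The functor \<open>ehom_functor\<close> takes the covariant argument first:
  it is defined on the product of the underlying category with its opposite.
\<close>

definition precomp ::
    "('v, 'm) mon_cat \<Rightarrow> ('c, 'v, 'm) ecat \<Rightarrow> 'c \<times> 'm \<times> 'c \<Rightarrow> 'c \<Rightarrow> 'm" where
  "precomp V C = (\<lambda>(x, f, x') y.
     ECmp C x x' y \<cdot>\<^bsub>V\<^esub> (Ide V (EHom C x' y) \<boxtimes>\<^bsub>V\<^esub> f) \<cdot>\<^bsub>V\<^esub> inv_arr V (RUnit V (EHom C x' y)))"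

definition postcomp ::
    "('v, 'm) mon_cat \<Rightarrow> ('c, 'v, 'm) ecat \<Rightarrow> 'c \<Rightarrow> 'c \<times> 'm \<times> 'c \<Rightarrow> 'm" where
  "postcomp V C = (\<lambda>x (y, g, y').
     ECmp C x y y' \<cdot>\<^bsub>V\<^esub> (g \<boxtimes>\<^bsub>V\<^esub> Ide V (EHom C x y)) \<cdot>\<^bsub>V\<^esub> inv_arr V (LUnit V (EHom C x y)))"

definition ehom_arr ::
    "('v, 'm) mon_cat \<Rightarrow> ('c, 'v, 'm) ecat \<Rightarrow> 'c \<times> 'm \<times> 'c \<Rightarrow> 'c \<times> 'm \<times> 'c \<Rightarrow> 'm" where
  "ehom_arr V C f g =
     postcomp V C (Dom (underlying V C) f) g \<cdot>\<^bsub>V\<^esub> precomp V C f (Dom (underlying V C) g)"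

definition ehom_functor ::
    "('v, 'm) mon_cat \<Rightarrow> ('c, 'v, 'm) ecat
     \<Rightarrow> ('c \<times> 'c, ('c \<times> 'm \<times> 'c) \<times> ('c \<times> 'm \<times> 'c), 'v, 'm) func" where
  "ehom_functor V C = \<lparr>FObj = (\<lambda>(y, x). EHom C x y), FArr = (\<lambda>(g, f). ehom_arr V C f g)\<rparr>"

locale enriched_model_category =
  enriched_category V C + underlying: model_category s "underlying V C" M
  for s :: "'s itself" and V :: "('v, 'm) mon_cat" and C :: "('c, 'v, 'm) ecat"
    and M :: "('c \<times> 'm \<times> 'c) model_str"

text \<open>
  The clause \<open>sm7_fibrant\<close> is the instance \<open>\<emptyset> \<rightarrow> x\<close>, \<open>y \<rightarrow> *\<close> of SM7 in its usual reading, in which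
  the hom-objects out of \<open>\<emptyset>\<close> and into \<open>*\<close> are terminal. It has to be listed, because \<open>C\<close> is not
  assumed to be tensored or cotensored and so those hom-objects need not be terminal: if the
  underlying category has a single arrow, \<open>C\<close> is a monoid \<open>m\<close> in \<open>V\<close>, and \<open>sm7\<close> alone says nothing
  about \<open>m\<close>. Base change would then fail: let \<open>m\<close> be the nerve of the multiplicative monoid
  \<open>{0, 1}\<close>, weakly tensored over simplicial sets by the constant maps from \<open>m\<close> to \<open>m\<^sup>v\<close>, and let \<open>F\<close>
  be the identity from the Joyal to the Kan--Quillen model structure.
\<close>

locale sm7_model_category = enriched_model_category s V C M
  for s :: "'s itself" and V :: "('v, 'm) mon_cat" and MV :: "'m model_str"
    and C :: "('c, 'v, 'm) ecat" and M :: "('c \<times> 'm \<times> 'c) model_str" +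
  assumes sm7: "pullback_power_axiom (underlying V C) M (underlying V C) M V MV (ehom_functor V C)"
    and sm7_fibrant:
      "cofibrant (underlying V C) M x \<Longrightarrow> fibrant (underlying V C) M y \<Longrightarrow> fibrant V MV (EHom C x y)"


section \<open>Weak tensorings and weak cotensorings\<close>

definition canonical_map ::
    "('v, 'm) mon_cat \<Rightarrow> ('c, 'v, 'm) ecat \<Rightarrow> 'c \<Rightarrow> 'c \<Rightarrow> 'm" where
  "canonical_map V C x y =
     curry_arr V (EHom C x y) (Unit V) (EHom C x y) (RUnit V (EHom C x y))"

text \<open>
  \<open>TPhi T v x y\<close> and \<open>TRho T x\<close> are \<open>\<phi>\<close> and \<open>\<rho>\<close>; \<open>PPsi P v x y\<close> and \<open>PEta P y\<close> are \<open>\<psi>\<close> and \<open>\<eta>\<close>.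
  The cotensor \<open>y\<^sup>v\<close> is \<open>FObj (PFun P) (y, v)\<close>.
\<close>

record ('c, 'k, 'v, 'm) tensoring =
  TFun :: "('c \<times> 'v, 'k \<times> 'm, 'c, 'k) func"
  TPhi :: "'v \<Rightarrow> 'c \<Rightarrow> 'c \<Rightarrow> 'm"
  TRho :: "'c \<Rightarrow> 'k"

record ('c, 'k, 'v, 'm) cotensoring =
  PFun :: "('c \<times> 'v, 'k \<times> 'm, 'c, 'k) func"
  PPsi :: "'v \<Rightarrow> 'c \<Rightarrow> 'c \<Rightarrow> 'm"
  PEta :: "'c \<Rightarrow> 'k"

text \<open>
  As for SM7, \<open>tensor_cofibrant\<close> and (below) \<open>cotensor_fibrant\<close> are the instances
  \<open>\<emptyset> \<rightarrow> x\<close>, \<open>\<emptyset> \<rightarrow> v\<close> of the pushout-product axiom and \<open>\<emptyset> \<rightarrow> v\<close>, \<open>y \<rightarrow> *\<close> of the pullback-power axiom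
  in their usual reading. They have to be listed because the bifunctors need not preserve
  initial or terminal objects in each variable.
\<close>

locale weak_tensoring = sm7_model_category s V MV C M
  for s :: "'s itself" and V :: "('v, 'm) mon_cat" and MV :: "'m model_str"
    and C :: "('c, 'v, 'm) ecat" and M :: "('c \<times> 'm \<times> 'c) model_str" +
  fixes T :: "('c, 'c \<times> 'm \<times> 'c, 'v, 'm) tensoring"
  assumes tensor_functor: "is_functor (prod_cat (underlying V C) V) (underlying V C) (TFun T)"
    and external_pushout_product:
      "pushout_product_axiom (underlying V C) M V MV (underlying V C) M (TFun T)"
    and tensor_cofibrant:
      "cofibrant (underlying V C) M x \<Longrightarrow> cofibrant V MV v \<Longrightarrow>
       cofibrant (underlying V C) M (FObj (TFun T) (x, v))"
    and phi_hom:
      "v \<in> Obj V \<Longrightarrow> x \<in> EObj C \<Longrightarrow> y \<in> EObj C \<Longrightarrow>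
       TPhi T v x y \<in> Hom V (EHom C (FObj (TFun T) (x, v)) y) (IHom V v (EHom C x y))"
    and phi_natural:
      "k \<in> Hom V v v' \<Longrightarrow> f \<in> Hom (underlying V C) x x' \<Longrightarrow> g \<in> Hom (underlying V C) y y' \<Longrightarrow>
       TPhi T v x y' \<cdot>\<^bsub>V\<^esub> ehom_arr V C (FArr (TFun T) (f, k)) g
         = ihom_arr V k (ehom_arr V C f g) \<cdot>\<^bsub>V\<^esub> TPhi T v' x' y"
    and phi_weq:
      "cofibrant V MV v \<Longrightarrow> cofibrant (underlying V C) M x \<Longrightarrow> fibrant (underlying V C) M y \<Longrightarrow>
       TPhi T v x y \<in> Weq MV"
    and rho_hom:
      "x \<in> EObj C \<Longrightarrow> TRho T x \<in> Hom (underlying V C) (FObj (TFun T) (x, Unit V)) x"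
    and rho_natural:
      "f \<in> Hom (underlying V C) x x' \<Longrightarrow>
       TRho T x' \<cdot>\<^bsub>underlying V C\<^esub> FArr (TFun T) (f, Ide V (Unit V)) = f \<cdot>\<^bsub>underlying V C\<^esub> TRho T x"
    and phi_rho:
      "x \<in> EObj C \<Longrightarrow> y \<in> EObj C \<Longrightarrow>
       TPhi T (Unit V) x y \<cdot>\<^bsub>V\<^esub> precomp V C (TRho T x) y = canonical_map V C x y"

definition set_compatible_tensoring ::
    "('v, 'm) mon_cat \<Rightarrow> ('c, 'v, 'm) ecat \<Rightarrow> ('c, 'c \<times> 'm \<times> 'c, 'v, 'm) tensoring \<Rightarrow> bool" where
  "set_compatible_tensoring V C T \<longleftrightarrow> (\<forall>v\<in>Obj V. \<forall>x\<in>EObj C. \<forall>y\<in>EObj C.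
     bij_betw (\<lambda>f. TPhi T v x y \<cdot>\<^bsub>V\<^esub> f)
       (Hom V (Unit V) (EHom C (FObj (TFun T) (x, v)) y)) (Hom V (Unit V) (IHom V v (EHom C x y))))"

definition unital_tensoring ::
    "('v, 'm) mon_cat \<Rightarrow> ('c, 'v, 'm) ecat \<Rightarrow> ('c, 'c \<times> 'm \<times> 'c, 'v, 'm) tensoring \<Rightarrow> bool" where
  "unital_tensoring V C T \<longleftrightarrow> (\<forall>x\<in>EObj C. is_iso (underlying V C) (TRho T x))"

locale weak_cotensoring = sm7_model_category s V MV C M
  for s :: "'s itself" and V :: "('v, 'm) mon_cat" and MV :: "'m model_str"
    and C :: "('c, 'v, 'm) ecat" and M :: "('c \<times> 'm \<times> 'c) model_str" +
  fixes P :: "('c, 'c \<times> 'm \<times> 'c, 'v, 'm) cotensoring"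
  assumes cotensor_functor:
      "is_functor (prod_cat (underlying V C) (op_cat V)) (underlying V C) (PFun P)"
    and external_pullback_power:
      "pullback_power_axiom (underlying V C) M V MV (underlying V C) M (PFun P)"
    and cotensor_fibrant:
      "fibrant (underlying V C) M y \<Longrightarrow> cofibrant V MV v \<Longrightarrow>
       fibrant (underlying V C) M (FObj (PFun P) (y, v))"
    and psi_hom:
      "v \<in> Obj V \<Longrightarrow> x \<in> EObj C \<Longrightarrow> y \<in> EObj C \<Longrightarrow>
       PPsi P v x y \<in> Hom V (EHom C x (FObj (PFun P) (y, v))) (IHom V v (EHom C x y))"
    and psi_natural:
      "k \<in> Hom V v v' \<Longrightarrow> f \<in> Hom (underlying V C) x x' \<Longrightarrow> g \<in> Hom (underlying V C) y y' \<Longrightarrow>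
       PPsi P v x y' \<cdot>\<^bsub>V\<^esub> ehom_arr V C f (FArr (PFun P) (g, k))
         = ihom_arr V k (ehom_arr V C f g) \<cdot>\<^bsub>V\<^esub> PPsi P v' x' y"
    and psi_weq:
      "cofibrant V MV v \<Longrightarrow> cofibrant (underlying V C) M x \<Longrightarrow> fibrant (underlying V C) M y \<Longrightarrow>
       PPsi P v x y \<in> Weq MV"
    and eta_hom:
      "y \<in> EObj C \<Longrightarrow> PEta P y \<in> Hom (underlying V C) y (FObj (PFun P) (y, Unit V))"
    and eta_natural:
      "g \<in> Hom (underlying V C) y y' \<Longrightarrow>
       PEta P y' \<cdot>\<^bsub>underlying V C\<^esub> g = FArr (PFun P) (g, Ide V (Unit V)) \<cdot>\<^bsub>underlying V C\<^esub> PEta P y"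
    and psi_eta:
      "x \<in> EObj C \<Longrightarrow> y \<in> EObj C \<Longrightarrow>
       PPsi P (Unit V) x y \<cdot>\<^bsub>V\<^esub> postcomp V C x (PEta P y) = canonical_map V C x y"

definition set_compatible_cotensoring ::
    "('v, 'm) mon_cat \<Rightarrow> ('c, 'v, 'm) ecat \<Rightarrow> ('c, 'c \<times> 'm \<times> 'c, 'v, 'm) cotensoring \<Rightarrow> bool" where
  "set_compatible_cotensoring V C P \<longleftrightarrow> (\<forall>v\<in>Obj V. \<forall>x\<in>EObj C. \<forall>y\<in>EObj C.
     bij_betw (\<lambda>f. PPsi P v x y \<cdot>\<^bsub>V\<^esub> f)
       (Hom V (Unit V) (EHom C x (FObj (PFun P) (y, v)))) (Hom V (Unit V) (IHom V v (EHom C x y))))"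

definition unital_cotensoring ::
    "('v, 'm) mon_cat \<Rightarrow> ('c, 'v, 'm) ecat \<Rightarrow> ('c, 'c \<times> 'm \<times> 'c, 'v, 'm) cotensoring \<Rightarrow> bool" where
  "unital_cotensoring V C P \<longleftrightarrow> (\<forall>y\<in>EObj C. is_iso (underlying V C) (PEta P y))"


section \<open>Change of enrichment\<close>

definition base_change ::
    "('w, 'n) mon_cat \<Rightarrow> ('w, 'n, 'v, 'm) lax_adj \<Rightarrow> ('c, 'v, 'm) ecat \<Rightarrow> ('c, 'w, 'n) ecat" where
  "base_change W A C = \<lparr>EObj = EObj C,
     EHom = (\<lambda>x y. FObj (RightF A) (EHom C x y)),
     EIde = (\<lambda>x. FArr (RightF A) (EIde C x) \<cdot>\<^bsub>W\<^esub> LaxUnit A),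
     ECmp = (\<lambda>x y z. FArr (RightF A) (ECmp C x y z) \<cdot>\<^bsub>W\<^esub> LaxMult A (EHom C y z) (EHom C x y))\<rparr>"

text \<open>
  The canonical functor from the underlying category of \<open>C\<close> to that of \<open>base_change W A C\<close> is the
  identity on objects and is given on arrows by \<open>base_arr\<close>. On hom-sets it is
  \<open>V(\<one>, EHom C x y) \<cong> V(F \<one>, EHom C x y) \<cong> W(\<one>, G (EHom C x y))\<close>, the first map being
  precomposition with the oplax unit; so it is bijective if the oplax unit is an isomorphism, and
  then \<open>unbase_arr\<close> is its inverse.
\<close>

definition base_arr ::
    "('w, 'n) mon_cat \<Rightarrow> ('w, 'n, 'v, 'm) lax_adj \<Rightarrow> 'c \<times> 'm \<times> 'c \<Rightarrow> 'c \<times> 'n \<times> 'c" where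
  "base_arr W A = (\<lambda>(x, f, y). (x, FArr (RightF A) f \<cdot>\<^bsub>W\<^esub> LaxUnit A, y))"

definition unbase_arr ::
    "('w, 'n) mon_cat \<Rightarrow> ('v, 'm) mon_cat \<Rightarrow> ('w, 'n, 'v, 'm) lax_adj \<Rightarrow> ('c, 'v, 'm) ecat
     \<Rightarrow> 'c \<times> 'n \<times> 'c \<Rightarrow> 'c \<times> 'm \<times> 'c" where
  "unbase_arr W V A C = inv_into (Arr (underlying V C)) (base_arr W A)"

definition base_model ::
    "('w, 'n) mon_cat \<Rightarrow> ('w, 'n, 'v, 'm) lax_adj
     \<Rightarrow> ('c \<times> 'm \<times> 'c) model_str \<Rightarrow> ('c \<times> 'n \<times> 'c) model_str" where
  "base_model W A M = \<lparr>Weq = base_arr W A ` Weq M, Cof = base_arr W A ` Cof M,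
                       Fib = base_arr W A ` Fib M\<rparr>"

text \<open>
  \<open>theta W V A w v\<close> is the map \<open>\<theta>\<close> from \<open>G (IHom V (F w) v)\<close> to \<open>IHom W w (G v)\<close>; in its definition
  \<open>a = G (IHom V (F w) v)\<close>.
\<close>

definition adjunct ::
    "('w, 'n) mon_cat \<Rightarrow> ('w, 'n, 'v, 'm) lax_adj \<Rightarrow> 'w \<Rightarrow> 'm \<Rightarrow> 'n" where
  "adjunct W A x h = FArr (RightF A) h \<cdot>\<^bsub>W\<^esub> AUnit A x"

definition theta ::
    "('w, 'n) mon_cat \<Rightarrow> ('v, 'm) mon_cat \<Rightarrow> ('w, 'n, 'v, 'm) lax_adj \<Rightarrow> 'w \<Rightarrow> 'v \<Rightarrow> 'n" where
  "theta W V A w v =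
     (let Fw = FObj (LeftF A) w; a = FObj (RightF A) (IHom V Fw v) in
      curry_arr W a w (FObj (RightF A) v)
        (adjunct W A (a \<otimes>\<^bsub>W\<^esub> w)
          (Eval V Fw v \<cdot>\<^bsub>V\<^esub> (ACounit A (IHom V Fw v) \<boxtimes>\<^bsub>V\<^esub> Ide V Fw) \<cdot>\<^bsub>V\<^esub> oplax_mult W V A a w)))"

definition induced_tensoring ::
    "('w, 'n) mon_cat \<Rightarrow> ('v, 'm) mon_cat \<Rightarrow> ('w, 'n, 'v, 'm) lax_adj \<Rightarrow> ('c, 'v, 'm) ecat
     \<Rightarrow> ('c, 'c \<times> 'm \<times> 'c, 'v, 'm) tensoring \<Rightarrow> ('c, 'c \<times> 'n \<times> 'c, 'w, 'n) tensoring" where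
  "induced_tensoring W V A C T = \<lparr>
     TFun = \<lparr>FObj = (\<lambda>(x, w). FObj (TFun T) (x, FObj (LeftF A) w)),
             FArr = (\<lambda>(f, k). base_arr W A
                       (FArr (TFun T) (unbase_arr W V A C f, FArr (LeftF A) k)))\<rparr>,
     TPhi = (\<lambda>w x y. theta W V A w (EHom C x y)
                       \<cdot>\<^bsub>W\<^esub> FArr (RightF A) (TPhi T (FObj (LeftF A) w) x y)),
     TRho = (\<lambda>x. base_arr W A
                   (TRho T x \<cdot>\<^bsub>underlying V C\<^esub>
                    FArr (TFun T) (Ide (underlying V C) x, oplax_unit V A)))\<rparr>"

definition induced_cotensoring ::
    "('w, 'n) mon_cat \<Rightarrow> ('v, 'm) mon_cat \<Rightarrow> ('w, 'n, 'v, 'm) lax_adj \<Rightarrow> ('c, 'v, 'm) ecat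
     \<Rightarrow> ('c, 'c \<times> 'm \<times> 'c, 'v, 'm) cotensoring \<Rightarrow> ('c, 'c \<times> 'n \<times> 'c, 'w, 'n) cotensoring" where
  "induced_cotensoring W V A C P = \<lparr>
     PFun = \<lparr>FObj = (\<lambda>(y, w). FObj (PFun P) (y, FObj (LeftF A) w)),
             FArr = (\<lambda>(g, k). base_arr W A
                       (FArr (PFun P) (unbase_arr W V A C g, FArr (LeftF A) k)))\<rparr>,
     PPsi = (\<lambda>w x y. theta W V A w (EHom C x y)
                       \<cdot>\<^bsub>W\<^esub> FArr (RightF A) (PPsi P (FObj (LeftF A) w) x y)),
     PEta = (\<lambda>y. base_arr W A
                   (FArr (PFun P) (Ide (underlying V C) y, oplax_unit V A)
                    \<cdot>\<^bsub>underlying V C\<^esub> PEta P y))\<rparr>"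

end

theory Submission
  imports Defs
begin

text \<open>
  Write \<open>D\<close> for \<open>base_change W A C\<close>. Elements of an object \<open>G d\<close> of \<open>W\<close> are maps \<open>F \<one> \<rightarrow> d\<close>, and hence
  elements of \<open>d\<close>, because the oplax unit is invertible. So \<open>C\<close> and \<open>D\<close> have isomorphic underlying
  categories (\<open>base_iso\<close>). Everything that concerns only these, namely the model structure, the
  (co)tensor bifunctors, their pushout-product or pullback-power axioms and unitality, is transported
  along this isomorphism and restricted along the left Quillen functor \<open>F\<close>. What remains are
  statements about the hom-objects \<open>G (EHom C x y)\<close> and about the comparison \<open>\<theta>\<close> of internal homs.

  SM7 for \<open>D\<close> holds because \<open>G\<close> preserves pullbacks, fibrations and acyclic fibrations.

  The algebra of \<open>\<theta>\<close> rests on one formula (\<open>eval_theta\<close>): followed by evaluation, \<open>\<theta>\<close> is the lax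
  structure map of \<open>G\<close> followed by \<open>G\<close> of the evaluation of \<open>V\<close>. It yields naturality, compatibility
  with the canonical maps out of the unit, and the fact that on elements \<open>\<theta>\<close> is the adjunction
  bijection between maps \<open>F w \<rightarrow> d\<close> and maps \<open>w \<rightarrow> G d\<close>, which is set-compatibility.

  The homotopical content is that \<open>\<theta> \<cdot> G \<phi>\<close> is a weak equivalence. The map \<open>\<phi>\<close> is a weak equivalence
  between fibrant objects, so \<open>G\<close> preserves it by Ken Brown's lemma (\<open>right_weq\<close>). For cofibrant \<open>w\<close>
  the map \<open>\<theta>\<close> is the mate of the oplax comparison \<open>F (- \<otimes> w) \<rightarrow> F - \<otimes> F w\<close>, a transformation between
  left Quillen functors that is a weak equivalence on cofibrant objects. The mate of such a
  transformation is a weak equivalence on fibrant objects (\<open>quillen_mates.theta_weq\<close>): composition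
  with it is bijective on homotopy classes of maps out of cofibrant objects. The homotopy category is
  not constructed. Surjectivity and injectivity are stated for homotopies in path objects, which the
  right adjoints carry from \<open>V\<close> to \<open>W\<close>, and a retract argument on a mapping path object deduces the
  weak equivalence (\<open>weq_if_homotopy_inverse\<close>).
\<close>



section \<open>Categories and their isomorphisms\<close>

lemma in_Hom: "f \<in> Hom C x y \<longleftrightarrow> f \<in> Arr C \<and> Dom C f = x \<and> Cod C f = y"
  by (auto simp: Hom_def)

lemma HomD:
  assumes "f \<in> Hom C x y"
  shows "f \<in> Arr C" "Dom C f = x" "Cod C f = y"
  using assms by (auto simp: Hom_def)

context category
begin

lemma dom_obj' [simp]: "f \<in> Arr C \<Longrightarrow> Dom C f \<in> Obj C"
  by (rule dom_obj)

lemma cod_obj' [simp]: "f \<in> Arr C \<Longrightarrow> Cod C f \<in> Obj C"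
  by (rule cod_obj)

lemma ide_simps [simp]:
  assumes "x \<in> Obj C"
  shows "Ide C x \<in> Arr C" "Dom C (Ide C x) = x" "Cod C (Ide C x) = x"
  using ide_hom[OF assms] by (auto simp: in_Hom)

lemma cmp_simps [simp]:
  assumes "f \<in> Arr C" "g \<in> Arr C" "Dom C g = Cod C f"
  shows "g \<cdot> f \<in> Arr C" "Dom C (g \<cdot> f) = Dom C f" "Cod C (g \<cdot> f) = Cod C g"
  using cmp_hom[of f "Dom C f" "Cod C f" g "Cod C g"] assms by (auto simp: in_Hom)

lemma ide_left' [simp]: "f \<in> Arr C \<Longrightarrow> Cod C f = y \<Longrightarrow> Ide C y \<cdot> f = f"
  using ide_left[of f "Dom C f" "Cod C f"] by (auto simp: in_Hom)

lemma ide_right' [simp]: "f \<in> Arr C \<Longrightarrow> Dom C f = x \<Longrightarrow> f \<cdot> Ide C x = f"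
  using ide_right[of f "Dom C f" "Cod C f"] by (auto simp: in_Hom)

lemma assoc [simp]:
  "f \<in> Arr C \<Longrightarrow> g \<in> Arr C \<Longrightarrow> h \<in> Arr C \<Longrightarrow> Dom C g = Cod C f \<Longrightarrow> Dom C h = Cod C g \<Longrightarrow>
   (h \<cdot> g) \<cdot> f = h \<cdot> (g \<cdot> f)"
  using cmp_assoc[of f "Dom C f" "Cod C f" g "Cod C g" h "Cod C h"] by (auto simp: in_Hom)

text \<open>
  Composites are kept associated to the right; this rule makes a known equation between two
  composites usable in front of a further factor.
\<close>

lemma pull:
  "g \<cdot> f = k \<Longrightarrow> f \<in> Arr C \<Longrightarrow> g \<in> Arr C \<Longrightarrow> h \<in> Arr C \<Longrightarrow> Dom C g = Cod C f \<Longrightarrow> Dom C f = Cod C h \<Longrightarrow>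
   g \<cdot> (f \<cdot> h) = k \<cdot> h"
  by (metis assoc)

lemma inverse_of_unique:
  assumes "f \<in> Arr C" "inverse_of C f g" "inverse_of C f g'"
  shows "g = g'"
proof -
  have *: "g \<cdot> f = Ide C (Dom C f)" "f \<cdot> g' = Ide C (Cod C f)" "g \<in> Arr C" "g' \<in> Arr C"
    "Dom C g = Cod C f" "Cod C g = Dom C f" "Dom C g' = Cod C f" "Cod C g' = Dom C f"
    using assms by (auto simp: inverse_of_def in_Hom)
  have "g = g \<cdot> (f \<cdot> g')" by (simp add: *)
  also have "\<dots> = g'" using assms(1) by (subst pull[OF *(1)]) (simp_all add: *)
  finally show ?thesis .
qed

lemma inv_arr_eq:
  assumes "f \<in> Arr C" "inverse_of C f g"
  shows "inv_arr C f = g"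
  unfolding inv_arr_def using inverse_of_unique assms by blast

lemma is_isoD: "is_iso C f \<Longrightarrow> f \<in> Arr C \<and> inverse_of C f (inv_arr C f)"
  using inv_arr_eq by (auto simp: is_iso_def)

lemma inv_arr_simps [simp]:
  assumes "is_iso C f"
  shows "inv_arr C f \<in> Arr C" "Dom C (inv_arr C f) = Cod C f" "Cod C (inv_arr C f) = Dom C f"
    "inv_arr C f \<cdot> f = Ide C (Dom C f)" "f \<cdot> inv_arr C f = Ide C (Cod C f)"
  using is_isoD[OF assms] by (auto simp: inverse_of_def in_Hom)

lemma inv_arr_pull [simp]:
  assumes "is_iso C f" "h \<in> Arr C"
  shows "Cod C h = Dom C f \<Longrightarrow> inv_arr C f \<cdot> f \<cdot> h = h"
    "Cod C h = Cod C f \<Longrightarrow> f \<cdot> inv_arr C f \<cdot> h = h"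
  using is_isoD[OF assms(1)] assms by (simp_all add: inverse_of_def in_Hom flip: assoc)

lemma is_isoI:
  assumes "f \<in> Hom C x y" "g \<in> Hom C y x" "g \<cdot> f = Ide C x" "f \<cdot> g = Ide C y"
  shows "is_iso C f" and "inv_arr C f = g"
  using assms inv_arr_eq[of f g] by (auto simp: is_iso_def inverse_of_def in_Hom)

lemma iso_cancel_left:
  assumes "is_iso C f" "f \<cdot> g = f \<cdot> h" "g \<in> Arr C" "h \<in> Arr C" "Cod C g = Dom C f" "Cod C h = Dom C f"
  shows "g = h"
proof -
  have "inv_arr C f \<cdot> (f \<cdot> g) = inv_arr C f \<cdot> (f \<cdot> h)" by (simp only: assms)
  then show ?thesis using assms(1,3-) by simp
qed

lemma iso_cancel_right:
  assumes "is_iso C f" "g \<cdot> f = h \<cdot> f" "g \<in> Arr C" "h \<in> Arr C" "Dom C g = Cod C f" "Dom C h = Cod C f"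
  shows "g = h"
proof -
  have "(g \<cdot> f) \<cdot> inv_arr C f = (h \<cdot> f) \<cdot> inv_arr C f" by (simp only: assms)
  then show ?thesis using assms(1,3-) is_isoD[OF assms(1)] by simp
qed

lemma is_iso_arr [simp]: "is_iso C f \<Longrightarrow> f \<in> Arr C"
  by (simp add: is_iso_def)

lemma is_iso_cmp:
  assumes "is_iso C f" "is_iso C g" "Dom C g = Cod C f"
  shows "is_iso C (g \<cdot> f)"
  by (rule is_isoI(1)[of _ "Dom C f" "Cod C g" "inv_arr C f \<cdot> inv_arr C g"])
     (use assms in \<open>simp_all add: in_Hom\<close>)

end

lemma op_cat_simps [simp]:
  "Obj (op_cat C) = Obj C" "Arr (op_cat C) = Arr C" "Dom (op_cat C) = Cod C" "Cod (op_cat C) = Dom C"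
  "Ide (op_cat C) = Ide C" "Cmp (op_cat C) g f = f \<cdot>\<^bsub>C\<^esub> g"
  by (simp_all add: op_cat_def)

lemma Hom_op [simp]: "Hom (op_cat C) x y = Hom C y x"
  by (auto simp: Hom_def)

lemma (in category) category_op: "category (op_cat C)"
  by unfold_locales (auto simp: in_Hom)

lemma prod_cat_simps [simp]:
  "Obj (prod_cat A B) = Obj A \<times> Obj B" "Arr (prod_cat A B) = Arr A \<times> Arr B"
  "Dom (prod_cat A B) (f, g) = (Dom A f, Dom B g)" "Cod (prod_cat A B) (f, g) = (Cod A f, Cod B g)"
  "Ide (prod_cat A B) (x, y) = (Ide A x, Ide B y)"
  "Cmp (prod_cat A B) (f', g') (f, g) = (f' \<cdot>\<^bsub>A\<^esub> f, g' \<cdot>\<^bsub>B\<^esub> g)"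
  by (simp_all add: prod_cat_def)

lemma category_prod:
  assumes "category A" "category B"
  shows "category (prod_cat A B)"
proof -
  interpret A: category A by fact
  interpret B: category B by fact
  show ?thesis
    by unfold_locales (auto simp: in_Hom)
qed

context is_functor
begin

lemma F_simps [simp]:
  "x \<in> Obj A \<Longrightarrow> FObj F x \<in> Obj B"
  "f \<in> Arr A \<Longrightarrow> FArr F f \<in> Arr B"
  "f \<in> Arr A \<Longrightarrow> Dom B (FArr F f) = FObj F (Dom A f)"
  "f \<in> Arr A \<Longrightarrow> Cod B (FArr F f) = FObj F (Cod A f)"
  "x \<in> Obj A \<Longrightarrow> FArr F (Ide A x) = Ide B (FObj F x)"
  using F_obj F_hom[of f "Dom A f" "Cod A f"] F_ide by (auto simp: in_Hom)

lemma F_cmp' [simp]: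
  "f \<in> Arr A \<Longrightarrow> g \<in> Arr A \<Longrightarrow> Dom A g = Cod A f \<Longrightarrow> FArr F (g \<cdot>\<^bsub>A\<^esub> f) = FArr F g \<cdot>\<^bsub>B\<^esub> FArr F f"
  using F_cmp[of f "Dom A f" "Cod A f" g "Cod A g"] by (auto simp: in_Hom)

lemma F_iso:
  assumes "is_iso A f"
  shows "is_iso B (FArr F f)" "inv_arr B (FArr F f) = FArr F (inv_arr A f)"
proof -
  have "FArr F (inv_arr A f) \<cdot>\<^bsub>B\<^esub> FArr F f = Ide B (FObj F (Dom A f))"
    "FArr F f \<cdot>\<^bsub>B\<^esub> FArr F (inv_arr A f) = Ide B (FObj F (Cod A f))"
    using assms by (simp_all flip: F_cmp')
  then show "is_iso B (FArr F f)" "inv_arr B (FArr F f) = FArr F (inv_arr A f)"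
    using B.is_isoI[of "FArr F f" "FObj F (Dom A f)" "FObj F (Cod A f)" "FArr F (inv_arr A f)"] assms
    by (auto simp: in_Hom)
qed

end

lemma is_functorI:
  assumes "category A" "category B"
    and "\<And>x. x \<in> Obj A \<Longrightarrow> FObj F x \<in> Obj B"
    and "\<And>f. f \<in> Arr A \<Longrightarrow> FArr F f \<in> Hom B (FObj F (Dom A f)) (FObj F (Cod A f))"
    and "\<And>x. x \<in> Obj A \<Longrightarrow> FArr F (Ide A x) = Ide B (FObj F x)"
    and "\<And>f g. f \<in> Arr A \<Longrightarrow> g \<in> Arr A \<Longrightarrow> Dom A g = Cod A f \<Longrightarrow>
           FArr F (g \<cdot>\<^bsub>A\<^esub> f) = FArr F g \<cdot>\<^bsub>B\<^esub> FArr F f"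
  shows "is_functor A B F"
proof -
  interpret A: category A by fact
  interpret B: category B by fact
  show ?thesis
    by unfold_locales (use assms(3-6) in \<open>auto simp: in_Hom\<close>)
qed


text \<open>
  An isomorphism of categories that is the identity on objects. Associativity and the unit laws pass
  from \<open>C\<close> to \<open>D\<close> along the bijection on arrows; for the underlying category of an enriched category
  this replaces a verification from the coherence axioms.
\<close>

locale cat_iso = C: category C
  for C :: "('o, 'k, 'y) cat_scheme" and D :: "('o, 'l, 'z) cat_scheme" and \<phi> :: "'k \<Rightarrow> 'l" +
  assumes obj_eq: "Obj D = Obj C"
    and bij: "bij_betw \<phi> (Arr C) (Arr D)"
    and dom_eq: "f \<in> Arr C \<Longrightarrow> Dom D (\<phi> f) = Dom C f"
    and cod_eq: "f \<in> Arr C \<Longrightarrow> Cod D (\<phi> f) = Cod C f"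
    and ide_eq: "x \<in> Obj C \<Longrightarrow> Ide D x = \<phi> (Ide C x)"
    and cmp_eq: "f \<in> Arr C \<Longrightarrow> g \<in> Arr C \<Longrightarrow> Dom C g = Cod C f \<Longrightarrow> \<phi> g \<cdot>\<^bsub>D\<^esub> \<phi> f = \<phi> (g \<cdot>\<^bsub>C\<^esub> f)"
begin

abbreviation \<psi> where "\<psi> \<equiv> inv_into (Arr C) \<phi>"

lemma phi_simps [simp]:
  "f \<in> Arr C \<Longrightarrow> \<phi> f \<in> Arr D" "f \<in> Arr C \<Longrightarrow> Dom D (\<phi> f) = Dom C f" "f \<in> Arr C \<Longrightarrow> Cod D (\<phi> f) = Cod C f"
  "f \<in> Arr C \<Longrightarrow> \<psi> (\<phi> f) = f"
  using bij dom_eq cod_eq by (auto simp: bij_betw_def)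

lemma psi_simps [simp]:
  assumes "f \<in> Arr D"
  shows "\<psi> f \<in> Arr C" "\<phi> (\<psi> f) = f" "Dom C (\<psi> f) = Dom D f" "Cod C (\<psi> f) = Cod D f"
proof -
  show *: "\<psi> f \<in> Arr C" "\<phi> (\<psi> f) = f"
    using bij assms by (auto simp: bij_betw_def inv_into_into f_inv_into_f)
  show "Dom C (\<psi> f) = Dom D f" "Cod C (\<psi> f) = Cod D f"
    using dom_eq[OF *(1)] cod_eq[OF *(1)] * by auto
qed

lemma phi_eq_iff: "f \<in> Arr C \<Longrightarrow> g \<in> Arr C \<Longrightarrow> \<phi> f = \<phi> g \<longleftrightarrow> f = g"
  by (metis phi_simps(4))

lemma arr_cases:
  assumes "g \<in> Arr D"
  obtains f where "f \<in> Arr C" "g = \<phi> f"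
  using assms psi_simps(1,2) by metis

lemma phi_hom: "f \<in> Hom C x y \<Longrightarrow> \<phi> f \<in> Hom D x y"
  by (simp add: in_Hom)

lemma psi_hom: "f \<in> Hom D x y \<Longrightarrow> \<psi> f \<in> Hom C x y"
  by (simp add: in_Hom)

lemma hom_cases:
  assumes "g \<in> Hom D x y"
  obtains f where "f \<in> Hom C x y" "g = \<phi> f"
  using assms psi_hom psi_simps(2) by (metis HomD(1))

sublocale D: category D
proof
  fix f x y assume "f \<in> Hom D x y"
  then obtain f' where f: "f' \<in> Hom C x y" "f = \<phi> f'" by (rule hom_cases)
  have x: "x \<in> Obj C" "y \<in> Obj C" using f(1) by (auto simp: in_Hom)
  show "Ide D y \<cdot>\<^bsub>D\<^esub> f = f" "f \<cdot>\<^bsub>D\<^esub> Ide D x = f"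
    using f(1) x by (simp_all add: f(2) in_Hom ide_eq cmp_eq)
  fix g z assume "g \<in> Hom D y z"
  then obtain g' where g: "g' \<in> Hom C y z" "g = \<phi> g'" by (rule hom_cases)
  show "g \<cdot>\<^bsub>D\<^esub> f \<in> Hom D x z"
    using f(1) g(1) by (simp add: f(2) g(2) in_Hom cmp_eq)
  fix h z' assume "h \<in> Hom D z z'"
  then obtain h' where h: "h' \<in> Hom C z z'" "h = \<phi> h'" by (rule hom_cases)
  show "(h \<cdot>\<^bsub>D\<^esub> g) \<cdot>\<^bsub>D\<^esub> f = h \<cdot>\<^bsub>D\<^esub> (g \<cdot>\<^bsub>D\<^esub> f)"
    using f(1) g(1) h(1) by (simp add: f(2) g(2) h(2) in_Hom cmp_eq)
qed (auto simp: obj_eq ide_eq in_Hom elim: arr_cases)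

lemma phi_ide [simp]: "x \<in> Obj C \<Longrightarrow> \<phi> (Ide C x) = Ide D x"
  by (simp add: ide_eq)

lemma phi_cmp:
  "f \<in> Arr C \<Longrightarrow> g \<in> Arr C \<Longrightarrow> Dom C g = Cod C f \<Longrightarrow> \<phi> (g \<cdot>\<^bsub>C\<^esub> f) = \<phi> g \<cdot>\<^bsub>D\<^esub> \<phi> f"
  by (simp add: cmp_eq)

lemma inverse: "cat_iso D C \<psi>"
proof
  show "bij_betw \<psi> (Arr D) (Arr C)" using bij by (rule bij_betw_inv_into)
  show "Ide C x = \<psi> (Ide D x)" if "x \<in> Obj D" for x
    using that by (simp add: obj_eq flip: phi_ide)
  fix f g assume *: "f \<in> Arr D" "g \<in> Arr D" "Dom D g = Cod D f"
  obtain f' where f: "f' \<in> Arr C" "f = \<phi> f'" using *(1) by (rule arr_cases)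
  obtain g' where g: "g' \<in> Arr C" "g = \<phi> g'" using *(2) by (rule arr_cases)
  show "\<psi> g \<cdot>\<^bsub>C\<^esub> \<psi> f = \<psi> (g \<cdot>\<^bsub>D\<^esub> f)"
    using * f(1) g(1) by (simp add: f(2) g(2) cmp_eq)
qed (simp_all add: obj_eq)

lemma psi_cmp:
  "f \<in> Arr D \<Longrightarrow> g \<in> Arr D \<Longrightarrow> Dom D g = Cod D f \<Longrightarrow> \<psi> (g \<cdot>\<^bsub>D\<^esub> f) = \<psi> g \<cdot>\<^bsub>C\<^esub> \<psi> f"
  by (rule cat_iso.phi_cmp[OF inverse])

lemma psi_ide [simp]: "x \<in> Obj C \<Longrightarrow> \<psi> (Ide D x) = Ide C x"
  using cat_iso.phi_ide[OF inverse, of x] by (simp add: obj_eq)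

lemma is_iso_phi: "is_iso C f \<Longrightarrow> is_iso D (\<phi> f)"
  by (rule D.is_isoI(1)[of _ "Dom C f" "Cod C f" "\<phi> (inv_arr C f)"])
     (simp_all add: in_Hom flip: phi_cmp)

lemma ex1_hom: "(\<exists>!f. f \<in> Hom C x y) \<longleftrightarrow> (\<exists>!f. f \<in> Hom D x y)"
proof
  assume "\<exists>!f. f \<in> Hom C x y"
  then obtain f where f: "f \<in> Hom C x y" "\<And>g. g \<in> Hom C x y \<Longrightarrow> g = f" by blast
  show "\<exists>!f. f \<in> Hom D x y"
  proof (rule ex1I[of _ "\<phi> f"])
    show "g = \<phi> f" if g: "g \<in> Hom D x y" for g
      using f(2)[OF psi_hom[OF g]] psi_simps(2)[OF HomD(1)[OF g]] by simp
  qed (rule phi_hom[OF f(1)])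
next
  assume "\<exists>!f. f \<in> Hom D x y"
  then obtain f where f: "f \<in> Hom D x y" "\<And>g. g \<in> Hom D x y \<Longrightarrow> g = f" by blast
  show "\<exists>!f. f \<in> Hom C x y"
  proof (rule ex1I[of _ "\<psi> f"])
    show "g = \<psi> f" if "g \<in> Hom C x y" for g
      using f(2)[OF phi_hom[OF that]] phi_simps(4)[OF HomD(1)[OF that]] by simp
  qed (rule psi_hom[OF f(1)])
qed

lemma initial_obj_phi: "initial_obj C x \<longleftrightarrow> initial_obj D x"
  by (simp add: initial_obj_def obj_eq ex1_hom)

lemma terminal_obj_phi: "terminal_obj C x \<longleftrightarrow> terminal_obj D x"
  by (simp add: terminal_obj_def obj_eq ex1_hom)

lemma op: "cat_iso (op_cat C) (op_cat D) \<phi>"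
proof -
  interpret op: category "op_cat C" by (rule C.category_op)
  show ?thesis
    by unfold_locales (simp_all add: obj_eq bij phi_cmp)
qed

lemma compose_functor:
  assumes "is_functor J D K"
  shows "is_functor J C \<lparr>FObj = FObj K, FArr = \<psi> \<circ> FArr K\<rparr>"
proof -
  interpret K: is_functor J D K by fact
  show ?thesis
    by (rule is_functorI)
      (simp_all add: K.A.category_axioms C.category_axioms in_Hom psi_cmp K.F_obj[unfolded obj_eq])
qed

lemma is_limit_phi:
  assumes K: "is_functor J D K"
    and lim: "is_limit J C \<lparr>FObj = FObj K, FArr = \<psi> \<circ> FArr K\<rparr> L p"
  shows "is_limit J D K L (\<phi> \<circ> p)"
proof -
  interpret K: is_functor J D K by fact
  let ?K = "\<lparr>FObj = FObj K, FArr = \<psi> \<circ> FArr K\<rparr>"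
  have c: "cone J C ?K L p" using lim by (simp add: is_limit_def)
  then have p: "p j \<in> Hom C L (FObj K j)" if "j \<in> Obj J" for j
    using that by (simp add: cone_def)
  have "FArr K u \<cdot>\<^bsub>D\<^esub> \<phi> (p (Dom J u)) = \<phi> (p (Cod J u))" if u: "u \<in> Arr J" for u
  proof -
    have "\<psi> (FArr K u) \<cdot>\<^bsub>C\<^esub> p (Dom J u) = p (Cod J u)" using c u by (simp add: cone_def)
    then have "\<phi> (p (Cod J u)) = \<phi> (\<psi> (FArr K u) \<cdot>\<^bsub>C\<^esub> p (Dom J u))" by simp
    also have "\<dots> = FArr K u \<cdot>\<^bsub>D\<^esub> \<phi> (p (Dom J u))"
      using u p[of "Dom J u"] by (simp add: phi_cmp in_Hom)
    finally show ?thesis by simp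
  qed
  with c have "cone J D K L (\<phi> \<circ> p)"
    by (auto simp: cone_def obj_eq in_Hom)
  moreover have "\<exists>!h. h \<in> Hom D X L \<and> (\<forall>j\<in>Obj J. (\<phi> \<circ> p) j \<cdot>\<^bsub>D\<^esub> h = q j)" if q: "cone J D K X q" for X q
  proof -
    have qh: "q j \<in> Hom D X (FObj K j)" if "j \<in> Obj J" for j using q that by (simp add: cone_def)
    have "\<psi> (FArr K u) \<cdot>\<^bsub>C\<^esub> \<psi> (q (Dom J u)) = \<psi> (q (Cod J u))" if u: "u \<in> Arr J" for u
    proof -
      have "FArr K u \<cdot>\<^bsub>D\<^esub> q (Dom J u) = q (Cod J u)" using q u by (simp add: cone_def)
      then show ?thesis using u qh[of "Dom J u"] by (simp add: in_Hom flip: psi_cmp)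
    qed
    then have "cone J C ?K X (\<psi> \<circ> q)"
      using q by (auto simp: cone_def obj_eq in_Hom)
    then have ex1: "\<exists>!h. h \<in> Hom C X L \<and> (\<forall>j\<in>Obj J. p j \<cdot>\<^bsub>C\<^esub> h = \<psi> (q j))"
      using lim unfolding is_limit_def comp_def by blast
    have iff: "p j \<cdot>\<^bsub>C\<^esub> h = \<psi> (q j) \<longleftrightarrow> \<phi> (p j) \<cdot>\<^bsub>D\<^esub> \<phi> h = q j" if "h \<in> Hom C X L" "j \<in> Obj J" for h j
    proof -
      have "\<phi> (p j \<cdot>\<^bsub>C\<^esub> h) = \<phi> (\<psi> (q j)) \<longleftrightarrow> p j \<cdot>\<^bsub>C\<^esub> h = \<psi> (q j)"
        using p[of j] qh[of j] that by (intro phi_eq_iff) (auto simp: in_Hom)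
      then show ?thesis
        using p[of j] qh[of j] that by (simp add: phi_cmp in_Hom)
    qed
    from ex1 obtain h where h: "h \<in> Hom C X L" "\<forall>j\<in>Obj J. p j \<cdot>\<^bsub>C\<^esub> h = \<psi> (q j)" by blast
    show ?thesis
    proof (rule ex1I[of _ "\<phi> h"])
      show "\<phi> h \<in> Hom D X L \<and> (\<forall>j\<in>Obj J. (\<phi> \<circ> p) j \<cdot>\<^bsub>D\<^esub> \<phi> h = q j)"
        using h iff by (simp add: phi_hom)
      fix k assume k: "k \<in> Hom D X L \<and> (\<forall>j\<in>Obj J. (\<phi> \<circ> p) j \<cdot>\<^bsub>D\<^esub> k = q j)"
      then obtain k' where k': "k' \<in> Hom C X L" "k = \<phi> k'" using hom_cases by blast
      then have "\<forall>j\<in>Obj J. p j \<cdot>\<^bsub>C\<^esub> k' = \<psi> (q j)" using k iff by simp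
      then show "k = \<phi> h" using ex1 h k' by blast
    qed
  qed
  ultimately show ?thesis by (simp add: is_limit_def)
qed

lemma small_complete_phi:
  fixes s :: "'s itself"
  assumes "small_complete s C"
  shows "small_complete s D"
  unfolding small_complete_def
proof (intro allI impI)
  fix J :: "('s, 's) cat" and K assume "category J" "is_functor J D K"
  then obtain L p where "is_limit J C \<lparr>FObj = FObj K, FArr = \<psi> \<circ> FArr K\<rparr> L p"
    using assms compose_functor unfolding small_complete_def by meson
  with \<open>is_functor J D K\<close> show "\<exists>L p. is_limit J D K L p"
    using is_limit_phi by meson
qed

lemma is_pullback_phi:
  assumes "is_pullback C f g P p q"
  shows "is_pullback D (\<phi> f) (\<phi> g) P (\<phi> p) (\<phi> q)"
proof -
  have *: "f \<in> Arr C" "g \<in> Arr C" "Cod C f = Cod C g" "p \<in> Hom C P (Dom C f)" "q \<in> Hom C P (Dom C g)"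
    "f \<cdot>\<^bsub>C\<^esub> p = g \<cdot>\<^bsub>C\<^esub> q"
    using assms by (auto simp: is_pullback_def)
  have "\<exists>!h. h \<in> Hom D X P \<and> \<phi> p \<cdot>\<^bsub>D\<^esub> h = r \<and> \<phi> q \<cdot>\<^bsub>D\<^esub> h = t"
    if r: "r \<in> Hom D X (Dom C f)" and t: "t \<in> Hom D X (Dom C g)" and rt: "\<phi> f \<cdot>\<^bsub>D\<^esub> r = \<phi> g \<cdot>\<^bsub>D\<^esub> t" for X r t
  proof -
    obtain r' where r': "r' \<in> Hom C X (Dom C f)" "r = \<phi> r'" using r by (rule hom_cases)
    obtain t' where t': "t' \<in> Hom C X (Dom C g)" "t = \<phi> t'" using t by (rule hom_cases)
    have "\<phi> (f \<cdot>\<^bsub>C\<^esub> r') = \<phi> (g \<cdot>\<^bsub>C\<^esub> t')"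
      using rt r' t' * by (simp add: phi_cmp in_Hom)
    then have "f \<cdot>\<^bsub>C\<^esub> r' = g \<cdot>\<^bsub>C\<^esub> t'"
      using r' t' * by (subst (asm) phi_eq_iff) (auto simp: in_Hom)
    then have ex1: "\<exists>!h. h \<in> Hom C X P \<and> p \<cdot>\<^bsub>C\<^esub> h = r' \<and> q \<cdot>\<^bsub>C\<^esub> h = t'"
      using assms r' t' by (simp add: is_pullback_def)
    then obtain h where h: "h \<in> Hom C X P" "p \<cdot>\<^bsub>C\<^esub> h = r'" "q \<cdot>\<^bsub>C\<^esub> h = t'" by blast
    show ?thesis
    proof (rule ex1I[of _ "\<phi> h"])
      show "\<phi> h \<in> Hom D X P \<and> \<phi> p \<cdot>\<^bsub>D\<^esub> \<phi> h = r \<and> \<phi> q \<cdot>\<^bsub>D\<^esub> \<phi> h = t"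
        using h * r' t' by (auto simp: in_Hom simp flip: phi_cmp)
      fix k assume k: "k \<in> Hom D X P \<and> \<phi> p \<cdot>\<^bsub>D\<^esub> k = r \<and> \<phi> q \<cdot>\<^bsub>D\<^esub> k = t"
      then obtain k' where k': "k' \<in> Hom C X P" "k = \<phi> k'" using hom_cases by blast
      have "\<phi> (p \<cdot>\<^bsub>C\<^esub> k') = \<phi> r'" "\<phi> (q \<cdot>\<^bsub>C\<^esub> k') = \<phi> t'"
        using k k' r' t' * by (simp_all add: phi_cmp in_Hom)
      then have "p \<cdot>\<^bsub>C\<^esub> k' = r'" "q \<cdot>\<^bsub>C\<^esub> k' = t'"
        using k' r' t' * by (auto simp: phi_eq_iff in_Hom)
      then show "k = \<phi> h" using ex1 h k' by blast
    qed
  qed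
  then show ?thesis using * by (simp add: is_pullback_def phi_hom flip: phi_cmp) (auto simp: in_Hom simp flip: phi_cmp)
qed

end


section \<open>Limits and duality in model categories\<close>

lemma is_pullback_hom:
  assumes "is_pullback C f g P p q"
  shows "f \<in> Arr C" "g \<in> Arr C" "Cod C f = Cod C g" "p \<in> Arr C" "q \<in> Arr C"
    "Dom C p = P" "Dom C q = P" "Cod C p = Dom C f" "Cod C q = Dom C g" "f \<cdot>\<^bsub>C\<^esub> p = g \<cdot>\<^bsub>C\<^esub> q"
  using assms by (auto simp: is_pullback_def in_Hom)

lemma is_pullback_lift:
  assumes "is_pullback C f g P p q"
    and "r \<in> Hom C X (Dom C f)" "t \<in> Hom C X (Dom C g)" "f \<cdot>\<^bsub>C\<^esub> r = g \<cdot>\<^bsub>C\<^esub> t"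
  obtains h where "h \<in> Arr C" "Dom C h = X" "Cod C h = P" "p \<cdot>\<^bsub>C\<^esub> h = r" "q \<cdot>\<^bsub>C\<^esub> h = t"
proof -
  have "\<exists>!h. h \<in> Hom C X P \<and> p \<cdot>\<^bsub>C\<^esub> h = r \<and> q \<cdot>\<^bsub>C\<^esub> h = t"
    using assms(1-4) unfolding is_pullback_def by blast
  then show ?thesis using that by (auto simp: in_Hom)
qed

lemma (in category) is_pullback_unique:
  assumes pb: "is_pullback C f g P p q" and h: "h \<in> Arr C" "Cod C h = P" and h': "h' \<in> Arr C" "Cod C h' = P"
    and eq: "p \<cdot> h = p \<cdot> h'" "q \<cdot> h = q \<cdot> h'"
  shows "h = h'"
proof -
  note * = is_pullback_hom[OF pb]
  have P: "Dom C h' = Dom C h"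
    using eq(1) h h' * by (metis cmp_simps(2))
  have "f \<cdot> (p \<cdot> h) = g \<cdot> (q \<cdot> h)"
    using pull[OF *(10)] * h by simp
  moreover have "p \<cdot> h \<in> Hom C (Dom C h) (Dom C f)" "q \<cdot> h \<in> Hom C (Dom C h) (Dom C g)"
    using * h by (simp_all add: in_Hom)
  ultimately have "\<exists>!k. k \<in> Hom C (Dom C h) P \<and> p \<cdot> k = p \<cdot> h \<and> q \<cdot> k = q \<cdot> h"
    using pb by (simp add: is_pullback_def)
  moreover have "h \<in> Hom C (Dom C h) P" "h' \<in> Hom C (Dom C h) P"
    using h h' P by (simp_all add: in_Hom)
  ultimately show ?thesis
    using eq by metis
qed

lemma is_pullback_sym:
  assumes "is_pullback C f g P p q" shows "is_pullback C g f P q p"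
proof -
  note * = is_pullback_hom[OF assms]
  have "\<exists>!h. h \<in> Hom C X P \<and> q \<cdot>\<^bsub>C\<^esub> h = r \<and> p \<cdot>\<^bsub>C\<^esub> h = t"
    if "r \<in> Hom C X (Dom C g)" "t \<in> Hom C X (Dom C f)" "g \<cdot>\<^bsub>C\<^esub> r = f \<cdot>\<^bsub>C\<^esub> t" for X r t
  proof -
    have "\<exists>!h. h \<in> Hom C X P \<and> p \<cdot>\<^bsub>C\<^esub> h = t \<and> q \<cdot>\<^bsub>C\<^esub> h = r"
      using assms that(2,1) that(3)[symmetric] unfolding is_pullback_def by blast
    then show ?thesis by (simp add: conj_commute)
  qed
  then show ?thesis
    using * by (simp add: is_pullback_def in_Hom)
qed

lemma terminal_arr:
  assumes "terminal_obj C t" "x \<in> Obj C"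
  obtains f where "f \<in> Arr C" "Dom C f = x" "Cod C f = t"
proof -
  have "\<exists>!f. f \<in> Hom C x t" using assms(1,2) unfolding terminal_obj_def by blast
  then show ?thesis using that by (auto simp: in_Hom)
qed

lemma terminal_unique:
  assumes "terminal_obj C t" "x \<in> Obj C" "f \<in> Hom C x t" "g \<in> Hom C x t"
  shows "f = g"
  using assms unfolding terminal_obj_def by blast

lemma op_cat_op_cat [simp]:
  fixes J :: "('a, 'b) cat"
  shows "op_cat (op_cat J) = J"
  by (simp add: op_cat_def)

lemma cone_op:
  fixes J :: "('a, 'b) cat"
  shows "cone J (op_cat C) K L p \<longleftrightarrow> cocone (op_cat J) C K L p"
    and "cocone J (op_cat C) K L p \<longleftrightarrow> cone (op_cat J) C K L p"
  by (simp_all add: cone_def cocone_def)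

lemma is_limit_op:
  fixes J :: "('a, 'b) cat"
  shows "is_limit J (op_cat C) K L p \<longleftrightarrow> is_colimit (op_cat J) C K L p"
    and "is_colimit J (op_cat C) K L p \<longleftrightarrow> is_limit (op_cat J) C K L p"
  by (simp_all add: is_limit_def is_colimit_def cone_op)

lemma functor_op:
  fixes J :: "('a, 'b) cat"
  assumes "category C" "is_functor J (op_cat C) K"
  shows "is_functor (op_cat J) C K"
proof -
  interpret K: is_functor J "op_cat C" K by fact
  show ?thesis
    by (rule is_functorI)
      (use K.F_simps K.F_cmp' in \<open>simp_all add: assms K.A.category_op in_Hom\<close>)
qed

lemma terminal_obj_op [simp]: "terminal_obj (op_cat C) x \<longleftrightarrow> initial_obj C x"
  by (simp add: initial_obj_def terminal_obj_def)

lemma is_pullback_op [simp]: "is_pullback (op_cat C) f g P p q \<longleftrightarrow> is_pushout C f g P p q"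
  by (auto simp: is_pullback_def is_pushout_def)

lemma retract_ofI:
  assumes "f \<in> Hom C a b" "g \<in> Hom C c d"
    and "s \<in> Hom C a c" "r \<in> Hom C c a" "r \<cdot>\<^bsub>C\<^esub> s = Ide C a"
    and "s' \<in> Hom C b d" "r' \<in> Hom C d b" "r' \<cdot>\<^bsub>C\<^esub> s' = Ide C b"
    and "g \<cdot>\<^bsub>C\<^esub> s = s' \<cdot>\<^bsub>C\<^esub> f" "f \<cdot>\<^bsub>C\<^esub> r = r' \<cdot>\<^bsub>C\<^esub> g"
  shows "retract_of C f g"
  unfolding retract_of_def using assms HomD[OF assms(1)] HomD[OF assms(2)] by blast

lemma has_lifting_op [simp]: "has_lifting (op_cat C) i p \<longleftrightarrow> has_lifting C p i"
  unfolding has_lifting_def op_cat_simps Hom_op by (simp only: conj_commute eq_commute) blast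

lemma retract_of_op:
  assumes "retract_of (op_cat C) f g" shows "retract_of C f g"
proof -
  obtain s r s' r' where
    "f \<in> Arr C" "g \<in> Arr C" "s \<in> Hom C (Cod C g) (Cod C f)" "r \<in> Hom C (Cod C f) (Cod C g)"
    "s \<cdot>\<^bsub>C\<^esub> r = Ide C (Cod C f)" "s' \<in> Hom C (Dom C g) (Dom C f)" "r' \<in> Hom C (Dom C f) (Dom C g)"
    "s' \<cdot>\<^bsub>C\<^esub> r' = Ide C (Dom C f)" "s \<cdot>\<^bsub>C\<^esub> g = f \<cdot>\<^bsub>C\<^esub> s'" "r \<cdot>\<^bsub>C\<^esub> f = g \<cdot>\<^bsub>C\<^esub> r'"
    using assms unfolding retract_of_def op_cat_simps Hom_op by blast
  then show ?thesis
    by (intro retract_ofI[of f C "Dom C f" "Cod C f" g "Dom C g" "Cod C g" r' s' r s]) (simp_all add: in_Hom)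
qed

definition op_model :: "'m model_str \<Rightarrow> 'm model_str" where
  "op_model M = \<lparr>Weq = Weq M, Cof = Fib M, Fib = Cof M\<rparr>"

lemma op_model_simps [simp]:
  "Weq (op_model M) = Weq M" "Cof (op_model M) = Fib M" "Fib (op_model M) = Cof M"
  by (simp_all add: op_model_def)

lemma fibrant_op [simp]: "fibrant (op_cat C) (op_model M) x \<longleftrightarrow> cofibrant C M x"
  by (simp add: cofibrant_def fibrant_def)

context model_category
begin

lemma arr_simps [simp]:
  "f \<in> Weq M \<Longrightarrow> f \<in> Arr C" "f \<in> Cof M \<Longrightarrow> f \<in> Arr C" "f \<in> Fib M \<Longrightarrow> f \<in> Arr C"
  using weq_arr cof_arr fib_arr by auto

text \<open>
  Through this duality the facts about fibrations, fibrant objects and pullbacks below yield those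
  about cofibrations, cofibrant objects and pushouts.
\<close>

lemma op_model_category: "model_category s (op_cat C) (op_model M)"
proof -
  interpret op: category "op_cat C" by (rule category_op)
  show ?thesis
  proof
    show "small_complete s (op_cat C)"
      unfolding small_complete_def
    proof (intro allI impI)
      fix J :: "('s, 's) cat" and K assume J: "category J" "is_functor J (op_cat C) K"
      have "is_functor (op_cat J) C K" using category_axioms J(2) by (rule functor_op)
      then show "\<exists>L p. is_limit J (op_cat C) K L p"
        using cocomplete category.category_op[OF J(1)] by (auto simp: small_cocomplete_def is_limit_op)
    qed
    show "small_cocomplete s (op_cat C)"
      unfolding small_cocomplete_def
    proof (intro allI impI)
      fix J :: "('s, 's) cat" and K assume J: "category J" "is_functor J (op_cat C) K"
      have "is_functor (op_cat J) C K" using category_axioms J(2) by (rule functor_op)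
      then show "\<exists>L p. is_colimit J (op_cat C) K L p"
        using complete category.category_op[OF J(1)] by (auto simp: small_complete_def is_limit_op)
    qed
    show "f \<in> Hom (op_cat C) x y \<Longrightarrow> \<exists>z i p. i \<in> Hom (op_cat C) x z \<and> p \<in> Hom (op_cat C) z y \<and>
        p \<cdot>\<^bsub>op_cat C\<^esub> i = f \<and> i \<in> Cof (op_model M) \<and> p \<in> Fib (op_model M) \<inter> Weq (op_model M)" for f x y
      using factorization(2)[of f y x] by simp blast
    show "f \<in> Hom (op_cat C) x y \<Longrightarrow> \<exists>z i p. i \<in> Hom (op_cat C) x z \<and> p \<in> Hom (op_cat C) z y \<and>
        p \<cdot>\<^bsub>op_cat C\<^esub> i = f \<and> i \<in> Cof (op_model M) \<inter> Weq (op_model M) \<and> p \<in> Fib (op_model M)" for f x y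
      using factorization(1)[of f y x] by simp blast
  next
    fix f g x y z
    assume *: "f \<in> Hom (op_cat C) x y" "g \<in> Hom (op_cat C) y z"
    show "f \<in> Weq (op_model M) \<Longrightarrow> g \<in> Weq (op_model M) \<Longrightarrow> g \<cdot>\<^bsub>op_cat C\<^esub> f \<in> Weq (op_model M)"
      "f \<in> Weq (op_model M) \<Longrightarrow> g \<cdot>\<^bsub>op_cat C\<^esub> f \<in> Weq (op_model M) \<Longrightarrow> g \<in> Weq (op_model M)"
      "g \<in> Weq (op_model M) \<Longrightarrow> g \<cdot>\<^bsub>op_cat C\<^esub> f \<in> Weq (op_model M) \<Longrightarrow> f \<in> Weq (op_model M)"
      using * two_of_three[of g z y f x] by auto
  qed (use retracts lifting in \<open>auto simp: subset_iff dest: retract_of_op\<close>)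
qed

lemma terminal_obj_exists: "\<exists>t. terminal_obj C t"
proof -
  let ?J = "\<lparr>Obj = {}, Arr = {}, Dom = id, Cod = id, Ide = id, Cmp = \<lambda>g f. f\<rparr> :: ('s, 's) cat"
  let ?K = "\<lparr>FObj = undefined, FArr = undefined\<rparr> :: ('s, 's, 'o, 'm) func"
  have "category ?J" by unfold_locales (auto simp: in_Hom)
  moreover from this have "is_functor ?J C ?K"
    by (rule is_functorI) (auto simp: category_axioms)
  ultimately obtain L p where L: "is_limit ?J C ?K L p"
    using complete unfolding small_complete_def by meson
  moreover have "cone ?J C ?K X q" if "X \<in> Obj C" for X q
    using that by (simp add: cone_def)
  ultimately show ?thesis
    unfolding is_limit_def terminal_obj_def by (auto simp: cone_def intro!: exI[of _ L])
qed

text \<open>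
  A cospan has five arrows, so its shape fits into every infinite type.
\<close>

lemma pullback_exists:
  assumes inf: "infinite (UNIV :: 's set)"
    and fg: "f \<in> Arr C" "g \<in> Arr C" "Cod C f = Cod C g"
  shows "\<exists>P p q. is_pullback C f g P p q"
proof -
  obtain n :: "nat \<Rightarrow> 's" where n: "inj n"
    using infinite_countable_subset[OF inf] by blast
  define a b c d e where abcde: "a = n 0" "b = n 1" "c = n 2" "d = n 3" "e = n 4"
  have neq [simp]: "a \<noteq> b" "a \<noteq> c" "a \<noteq> d" "a \<noteq> e" "b \<noteq> c" "b \<noteq> d" "b \<noteq> e" "c \<noteq> d" "c \<noteq> e" "d \<noteq> e"
    "b \<noteq> a" "c \<noteq> a" "d \<noteq> a" "e \<noteq> a" "c \<noteq> b" "d \<noteq> b" "e \<noteq> b" "d \<noteq> c" "e \<noteq> c" "e \<noteq> d"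
    using n by (auto simp: abcde inj_eq)
  \<comment> \<open>\<open>d : a \<rightarrow> c\<close> and \<open>e : b \<rightarrow> c\<close> form the cospan; every object is its own identity.\<close>
  define J :: "('s, 's) cat" where
    "J = \<lparr>Obj = {a, b, c}, Arr = {a, b, c, d, e},
          Dom = (\<lambda>m. if m = d then a else if m = e then b else m),
          Cod = (\<lambda>m. if m = d \<or> m = e then c else m), Ide = (\<lambda>x. x),
          Cmp = (\<lambda>g f. if f = d \<or> f = e then f else g)\<rparr>"
  define K :: "('s, 's, 'o, 'm) func" where
    "K = \<lparr>FObj = (\<lambda>x. if x = a then Dom C f else if x = b then Dom C g else Cod C f),
          FArr = (\<lambda>m. if m = d then f else if m = e then g else
             Ide C (if m = a then Dom C f else if m = b then Dom C g else Cod C f))\<rparr>"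
  have J: "category J"
    by unfold_locales (auto simp: J_def in_Hom split: if_splits)
  have "is_functor J C K"
    by (rule is_functorI[OF J category_axioms]) (use fg in \<open>auto simp: J_def K_def in_Hom split: if_splits\<close>)
  then obtain L p where L: "is_limit J C K L p"
    using complete J unfolding small_complete_def by meson
  then have "cone J C K L p" by (simp add: is_limit_def)
  then have p: "p a \<in> Hom C L (Dom C f)" "p b \<in> Hom C L (Dom C g)" "p c = f \<cdot>\<^bsub>C\<^esub> p a" "p c = g \<cdot>\<^bsub>C\<^esub> p b"
    by (auto simp: cone_def J_def K_def)
  have "\<exists>!h. h \<in> Hom C X L \<and> p a \<cdot>\<^bsub>C\<^esub> h = r \<and> p b \<cdot>\<^bsub>C\<^esub> h = t"
    if r: "r \<in> Hom C X (Dom C f)" and t: "t \<in> Hom C X (Dom C g)" and rt: "f \<cdot>\<^bsub>C\<^esub> r = g \<cdot>\<^bsub>C\<^esub> t" for X r t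
  proof -
    define q where "q = (\<lambda>j. if j = a then r else if j = b then t else f \<cdot>\<^bsub>C\<^esub> r)"
    have "cone J C K X q"
      using r t rt fg by (auto simp: cone_def J_def K_def q_def in_Hom)
    then have ex1: "\<exists>!h. h \<in> Hom C X L \<and> (\<forall>j\<in>Obj J. p j \<cdot>\<^bsub>C\<^esub> h = q j)"
      using L unfolding is_limit_def by blast
    have "(\<forall>j\<in>Obj J. p j \<cdot>\<^bsub>C\<^esub> h = q j) \<longleftrightarrow> p a \<cdot>\<^bsub>C\<^esub> h = r \<and> p b \<cdot>\<^bsub>C\<^esub> h = t" if "h \<in> Hom C X L" for h
      using that p fg r by (auto simp: J_def q_def in_Hom)
    then show ?thesis using ex1 by (simp cong: conj_cong)
  qed
  then have "is_pullback C f g L (p a) (p b)"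
    using fg p by (simp add: is_pullback_def)
  then show ?thesis by blast
qed

end


section \<open>Lifting properties and fibrant objects\<close>

lemma has_liftingD:
  assumes "has_lifting C i p" "u \<in> Hom C (Dom C i) (Dom C p)" "v \<in> Hom C (Cod C i) (Cod C p)" "p \<cdot>\<^bsub>C\<^esub> u = v \<cdot>\<^bsub>C\<^esub> i"
  obtains h where "h \<in> Arr C" "Dom C h = Cod C i" "Cod C h = Dom C p" "h \<cdot>\<^bsub>C\<^esub> i = u" "p \<cdot>\<^bsub>C\<^esub> h = v"
  using assms unfolding has_lifting_def in_Hom by metis

lemma (in category) has_lifting_cmp:
  assumes "has_lifting C i p" "has_lifting C i q" "i \<in> Arr C" "p \<in> Arr C" "q \<in> Arr C" "Dom C q = Cod C p"
  shows "has_lifting C i (q \<cdot> p)"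
  unfolding has_lifting_def
proof (intro allI impI)
  fix u v assume "u \<in> Hom C (Dom C i) (Dom C (q \<cdot> p))" "v \<in> Hom C (Cod C i) (Cod C (q \<cdot> p))" "(q \<cdot> p) \<cdot> u = v \<cdot> i"
  then have *: "u \<in> Arr C" "Dom C u = Dom C i" "Cod C u = Dom C p" "v \<in> Arr C" "Dom C v = Cod C i" "Cod C v = Cod C q"
    "q \<cdot> p \<cdot> u = v \<cdot> i"
    using assms by (auto simp: in_Hom)
  obtain k where k: "k \<in> Arr C" "Dom C k = Cod C i" "Cod C k = Dom C q" "k \<cdot> i = p \<cdot> u" "q \<cdot> k = v"
    using has_liftingD[OF assms(2), of "p \<cdot> u" v] * assms by (auto simp: in_Hom)
  obtain h where "h \<in> Arr C" "Dom C h = Cod C i" "Cod C h = Dom C p" "h \<cdot> i = u" "p \<cdot> h = k"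
    using has_liftingD[OF assms(1), of u k] k * assms by (auto simp: in_Hom)
  then show "\<exists>h. h \<in> Hom C (Cod C i) (Dom C (q \<cdot> p)) \<and> h \<cdot> i = u \<and> (q \<cdot> p) \<cdot> h = v"
    using assms k by (intro exI[of _ h]) (auto simp: in_Hom)
qed

lemma (in category) has_lifting_pullback:
  assumes "has_lifting C i f" "is_pullback C f g P p q" "i \<in> Arr C"
  shows "has_lifting C i q"
  unfolding has_lifting_def
proof (intro allI impI)
  note pb = is_pullback_hom[OF assms(2)]
  fix u v assume "u \<in> Hom C (Dom C i) (Dom C q)" "v \<in> Hom C (Cod C i) (Cod C q)" "q \<cdot> u = v \<cdot> i"
  then have *: "u \<in> Arr C" "Dom C u = Dom C i" "Cod C u = P" "v \<in> Arr C" "Dom C v = Cod C i" "Cod C v = Dom C g"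
    "q \<cdot> u = v \<cdot> i"
    using pb by (auto simp: in_Hom)
  have "f \<cdot> (p \<cdot> u) = (g \<cdot> v) \<cdot> i"
    using pull[OF pb(10)] pb * assms(3) by simp
  then obtain k where k: "k \<in> Arr C" "Dom C k = Cod C i" "Cod C k = Dom C f" "k \<cdot> i = p \<cdot> u" "f \<cdot> k = g \<cdot> v"
    using has_liftingD[OF assms(1), of "p \<cdot> u" "g \<cdot> v"] * pb by (auto simp: in_Hom)
  obtain h where h: "h \<in> Arr C" "Dom C h = Cod C i" "Cod C h = P" "p \<cdot> h = k" "q \<cdot> h = v"
    using is_pullback_lift[OF assms(2), of k "Cod C i" v] k * by (auto simp: in_Hom)
  have "h \<cdot> i = u"
    using is_pullback_unique[OF assms(2), of "h \<cdot> i" u] pull[OF h(4)] pull[OF h(5)] h(1-3) k * pb assms(3)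
    by (simp flip: assoc add: h(4,5))
  then show "\<exists>h. h \<in> Hom C (Cod C i) (Dom C q) \<and> h \<cdot> i = u \<and> q \<cdot> h = v"
    using h pb by (intro exI[of _ h]) (auto simp: in_Hom)
qed

context model_category
begin

lemma ide_model:
  assumes "x \<in> Obj C"
  shows "Ide C x \<in> Weq M" "Ide C x \<in> Cof M" "Ide C x \<in> Fib M"
proof -
  obtain z i p where 1: "i \<in> Hom C x z" "p \<in> Hom C z x" "p \<cdot>\<^bsub>C\<^esub> i = Ide C x" "i \<in> Cof M" "p \<in> Fib M \<inter> Weq M"
    using factorization(1)[of "Ide C x" x x] assms by (auto simp: in_Hom)
  have z: "z \<in> Obj C" using 1 by (auto simp: in_Hom)
  have "retract_of C (Ide C x) p"
    by (rule retract_ofI[where s = i and r = p and s' = "Ide C x" and r' = "Ide C x"])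
      (use 1 assms z in \<open>simp_all add: in_Hom\<close>)
  moreover have "retract_of C (Ide C x) i"
    by (rule retract_ofI[where s = "Ide C x" and r = "Ide C x" and s' = i and r' = p])
      (use 1 assms z in \<open>simp_all add: in_Hom\<close>)
  ultimately show "Ide C x \<in> Weq M" "Ide C x \<in> Cof M" "Ide C x \<in> Fib M"
    using retracts 1 by blast+
qed

lemma iso_model:
  assumes "is_iso C f"
  shows "f \<in> Weq M" "f \<in> Cof M" "f \<in> Fib M"
proof -
  have "f \<in> Arr C" using assms by simp
  then have "retract_of C f (Ide C (Cod C f))"
    by (intro retract_ofI[where s = f and r = "inv_arr C f" and s' = "Ide C (Cod C f)" and r' = "Ide C (Cod C f)"])
      (use assms in \<open>simp_all add: in_Hom\<close>)
  then show "f \<in> Weq M" "f \<in> Cof M" "f \<in> Fib M"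
    using retracts ide_model[of "Cod C f"] \<open>f \<in> Arr C\<close> by auto
qed

lemma weq_cmp:
  assumes "f \<in> Arr C" "g \<in> Arr C" "Dom C g = Cod C f"
  shows "f \<in> Weq M \<Longrightarrow> g \<in> Weq M \<Longrightarrow> g \<cdot>\<^bsub>C\<^esub> f \<in> Weq M"
    and "f \<in> Weq M \<Longrightarrow> g \<cdot>\<^bsub>C\<^esub> f \<in> Weq M \<Longrightarrow> g \<in> Weq M"
    and "g \<in> Weq M \<Longrightarrow> g \<cdot>\<^bsub>C\<^esub> f \<in> Weq M \<Longrightarrow> f \<in> Weq M"
  using two_of_three[of f "Dom C f" "Cod C f" g "Cod C g"] assms by (auto simp: in_Hom)

lemma lift:
  assumes "i \<in> Cof M" "p \<in> Fib M" "i \<in> Weq M \<or> p \<in> Weq M"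
    and "u \<in> Hom C (Dom C i) (Dom C p)" "v \<in> Hom C (Cod C i) (Cod C p)" "p \<cdot>\<^bsub>C\<^esub> u = v \<cdot>\<^bsub>C\<^esub> i"
  obtains h where "h \<in> Arr C" "Dom C h = Cod C i" "Cod C h = Dom C p" "h \<cdot>\<^bsub>C\<^esub> i = u" "p \<cdot>\<^bsub>C\<^esub> h = v"
  using has_liftingD[OF lifting[OF assms(1-3)] assms(4-6)] by blast

text \<open>
  The retract argument: a map with the lifting property is a retract of the fibration in its
  factorization.
\<close>

lemma fib_if_lifting:
  assumes p: "p \<in> Arr C" and lift: "\<And>i. i \<in> Cof M \<Longrightarrow> i \<in> Weq M \<Longrightarrow> has_lifting C i p"
  shows "p \<in> Fib M"
proof -
  obtain z i q where 1: "i \<in> Hom C (Dom C p) z" "q \<in> Hom C z (Cod C p)" "q \<cdot>\<^bsub>C\<^esub> i = p" "i \<in> Cof M \<inter> Weq M" "q \<in> Fib M"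
    using factorization(2)[of p "Dom C p" "Cod C p"] p by (auto simp: in_Hom)
  have "has_lifting C i p" using lift 1 by simp
  moreover have "Ide C (Dom C p) \<in> Hom C (Dom C i) (Dom C p)" "q \<in> Hom C (Cod C i) (Cod C p)"
    "p \<cdot>\<^bsub>C\<^esub> Ide C (Dom C p) = q \<cdot>\<^bsub>C\<^esub> i"
    using 1 p by (simp_all add: in_Hom)
  ultimately obtain h where "h \<in> Arr C" "Dom C h = Cod C i" "Cod C h = Dom C p"
    "h \<cdot>\<^bsub>C\<^esub> i = Ide C (Dom C p)" "p \<cdot>\<^bsub>C\<^esub> h = q"
    by (rule has_liftingD)
  then have "retract_of C p q"
    by (intro retract_ofI[where s = i and r = h and s' = "Ide C (Cod C p)" and r' = "Ide C (Cod C p)"])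
      (use 1 p in \<open>simp_all add: in_Hom\<close>)
  then show ?thesis using retracts(3) 1 by simp
qed

lemma acyclic_fib_if_lifting:
  assumes p: "p \<in> Arr C" and lift: "\<And>i. i \<in> Cof M \<Longrightarrow> has_lifting C i p"
  shows "p \<in> Fib M" "p \<in> Weq M"
proof -
  obtain z i q where 1: "i \<in> Hom C (Dom C p) z" "q \<in> Hom C z (Cod C p)" "q \<cdot>\<^bsub>C\<^esub> i = p" "i \<in> Cof M" "q \<in> Fib M \<inter> Weq M"
    using factorization(1)[of p "Dom C p" "Cod C p"] p by (auto simp: in_Hom)
  have "has_lifting C i p" using lift 1 by simp
  moreover have "Ide C (Dom C p) \<in> Hom C (Dom C i) (Dom C p)" "q \<in> Hom C (Cod C i) (Cod C p)"
    "p \<cdot>\<^bsub>C\<^esub> Ide C (Dom C p) = q \<cdot>\<^bsub>C\<^esub> i"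
    using 1 p by (simp_all add: in_Hom)
  ultimately obtain h where "h \<in> Arr C" "Dom C h = Cod C i" "Cod C h = Dom C p"
    "h \<cdot>\<^bsub>C\<^esub> i = Ide C (Dom C p)" "p \<cdot>\<^bsub>C\<^esub> h = q"
    by (rule has_liftingD)
  then have "retract_of C p q"
    by (intro retract_ofI[where s = i and r = h and s' = "Ide C (Cod C p)" and r' = "Ide C (Cod C p)"])
      (use 1 p in \<open>simp_all add: in_Hom\<close>)
  then show "p \<in> Fib M" "p \<in> Weq M" using retracts(1,3) 1 by simp_all
qed

lemma fib_cmp:
  assumes "p \<in> Fib M" "q \<in> Fib M" "Dom C q = Cod C p"
  shows "q \<cdot>\<^bsub>C\<^esub> p \<in> Fib M"
  by (rule fib_if_lifting) (use assms in \<open>auto intro: has_lifting_cmp[OF lifting lifting]\<close>)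

lemma fib_pullback:
  assumes "is_pullback C f g P p q" "f \<in> Fib M"
  shows "q \<in> Fib M" "f \<in> Weq M \<Longrightarrow> q \<in> Weq M"
proof -
  have q: "q \<in> Arr C" using is_pullback_hom[OF assms(1)] by simp
  show "q \<in> Fib M"
    by (rule fib_if_lifting[OF q], rule has_lifting_pullback[OF lifting]) (use assms in auto)
  show "q \<in> Weq M" if "f \<in> Weq M"
    by (rule acyclic_fib_if_lifting(2)[OF q], rule has_lifting_pullback[OF lifting]) (use assms that in auto)
qed

lemma fibrant_obj: "fibrant C M x \<Longrightarrow> x \<in> Obj C"
  by (auto simp: fibrant_def in_Hom)

lemma fibrant_extend:
  assumes "fibrant C M x" "i \<in> Cof M" "i \<in> Weq M" "u \<in> Hom C (Dom C i) x"
  obtains h where "h \<in> Arr C" "Dom C h = Cod C i" "Cod C h = x" "h \<cdot>\<^bsub>C\<^esub> i = u"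
proof -
  obtain t f where t: "terminal_obj C t" "f \<in> Hom C x t" "f \<in> Fib M"
    using assms(1) by (auto simp: fibrant_def)
  have i: "i \<in> Arr C" using assms by simp
  obtain v where v: "v \<in> Arr C" "Dom C v = Cod C i" "Cod C v = t"
    using terminal_arr[OF t(1), of "Cod C i"] i by auto
  note f = HomD[OF t(2)] and u = HomD[OF assms(4)]
  have "f \<cdot>\<^bsub>C\<^esub> u = v \<cdot>\<^bsub>C\<^esub> i"
    by (rule terminal_unique[OF t(1), of "Dom C i"]) (use i v f u in \<open>simp_all add: in_Hom\<close>)
  moreover have "u \<in> Hom C (Dom C i) (Dom C f)" "v \<in> Hom C (Cod C i) (Cod C f)"
    using u v f by (simp_all add: in_Hom)
  ultimately obtain h where "h \<in> Arr C" "Dom C h = Cod C i" "Cod C h = Dom C f" "h \<cdot>\<^bsub>C\<^esub> i = u"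
    using lift[OF assms(2) t(3) disjI1[OF assms(3)]] by metis
  then show ?thesis using that f by simp
qed

end

lemma (in model_category) cofibrant_lift:
  assumes a: "cofibrant C M a" and p: "p \<in> Fib M" "p \<in> Weq M" and v: "v \<in> Hom C a (Cod C p)"
  obtains h where "h \<in> Arr C" "Dom C h = a" "Cod C h = Dom C p" "p \<cdot>\<^bsub>C\<^esub> h = v"
proof -
  interpret op: model_category s "op_cat C" "op_model M" by (rule op_model_category)
  show ?thesis
    using op.fibrant_extend[of a p v] a p v that by auto
qed

lemma (in model_category) cofibrant_replacement_exists:
  assumes "x \<in> Obj C"
  obtains q where "q \<in> Fib M" "q \<in> Weq M" "cofibrant C M (Dom C q)" "Cod C q = x"
proof -
  interpret op: model_category s "op_cat C" "op_model M" by (rule op_model_category)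
  obtain i where i: "initial_obj C i" using op.terminal_obj_exists by auto
  then obtain f where "f \<in> Hom C i x" using assms by (auto simp: initial_obj_def)
  then obtain z k p where "k \<in> Hom C i z" "p \<in> Hom C z x" "k \<in> Cof M" "p \<in> Fib M \<inter> Weq M"
    using factorization(1) by metis
  moreover from this i have "cofibrant C M z"
    unfolding cofibrant_def by blast
  ultimately show ?thesis
    by (intro that[of p]) (simp_all add: in_Hom)
qed

text \<open>
  This says that acyclic cofibrations lift against the map \<open>(p, q)\<close> into the product of \<open>Cod C p\<close> and
  \<open>Cod C q\<close>. The product is left implicit, because in the applications \<open>p\<close> and \<open>q\<close> are given
  separately.
\<close>

definition lifts_jointly ::
    "('o, 'm, 'z) cat_scheme \<Rightarrow> 'm model_str \<Rightarrow> 'm \<Rightarrow> 'm \<Rightarrow> bool" where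
  "lifts_jointly C M p q \<longleftrightarrow> (\<forall>i A B a b b'. i \<in> Cof M \<longrightarrow> i \<in> Weq M \<longrightarrow> i \<in> Hom C A B \<longrightarrow>
     a \<in> Hom C A (Dom C p) \<longrightarrow> b \<in> Hom C B (Cod C p) \<longrightarrow> b' \<in> Hom C B (Cod C q) \<longrightarrow>
     p \<cdot>\<^bsub>C\<^esub> a = b \<cdot>\<^bsub>C\<^esub> i \<longrightarrow> q \<cdot>\<^bsub>C\<^esub> a = b' \<cdot>\<^bsub>C\<^esub> i \<longrightarrow>
     (\<exists>h. h \<in> Hom C B (Dom C p) \<and> h \<cdot>\<^bsub>C\<^esub> i = a \<and> p \<cdot>\<^bsub>C\<^esub> h = b \<and> q \<cdot>\<^bsub>C\<^esub> h = b'))"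

lemma lifts_jointlyD:
  assumes "lifts_jointly C M p q" "p \<in> Hom C Z X" "q \<in> Hom C Z Y"
    and "i \<in> Cof M" "i \<in> Weq M" "i \<in> Hom C A B" "a \<in> Hom C A Z" "b \<in> Hom C B X" "b' \<in> Hom C B Y"
    and "p \<cdot>\<^bsub>C\<^esub> a = b \<cdot>\<^bsub>C\<^esub> i" "q \<cdot>\<^bsub>C\<^esub> a = b' \<cdot>\<^bsub>C\<^esub> i"
  shows "\<exists>h. h \<in> Hom C B Z \<and> h \<cdot>\<^bsub>C\<^esub> i = a \<and> p \<cdot>\<^bsub>C\<^esub> h = b \<and> q \<cdot>\<^bsub>C\<^esub> h = b'"
  using assms(1)[unfolded lifts_jointly_def HomD(2,3)[OF assms(2)] HomD(2,3)[OF assms(3)], rule_format,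
      OF assms(4-11)] .

text \<open>
  The mapping path object of \<open>f\<close>, obtained by factoring the graph of \<open>f\<close> through the product.
\<close>

lemma (in model_category) path_factorization:
  assumes inf: "infinite (UNIV :: 's set)"
    and X: "fibrant C M X" and Y: "fibrant C M Y" and f: "f \<in> Hom C X Y"
  obtains Z j p q where "j \<in> Weq M" "p \<in> Fib M" "p \<in> Weq M" "q \<in> Fib M"
    "j \<in> Hom C X Z" "p \<in> Hom C Z X" "q \<in> Hom C Z Y" "p \<cdot>\<^bsub>C\<^esub> j = Ide C X" "q \<cdot>\<^bsub>C\<^esub> j = f"
    "lifts_jointly C M p q"
proof -
  have obj: "X \<in> Obj C" "Y \<in> Obj C" using X Y by (auto intro: fibrant_obj)
  obtain t x where t: "terminal_obj C t" "x \<in> Fib M" "x \<in> Hom C X t"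
    using X by (auto simp: fibrant_def)
  obtain t' y' where t': "terminal_obj C t'" "y' \<in> Fib M" "y' \<in> Hom C Y t'"
    using Y by (auto simp: fibrant_def)
  obtain c where c: "c \<in> Arr C" "Dom C c = t'" "Cod C c = t"
    using terminal_arr[OF t(1), of t'] t'(1) by (auto simp: terminal_obj_def)
  obtain d where d: "d \<in> Arr C" "Dom C d = t" "Cod C d = t'"
    using terminal_arr[OF t'(1), of t] t(1) by (auto simp: terminal_obj_def)
  have to: "t \<in> Obj C" "t' \<in> Obj C" using t(1) t'(1) by (auto simp: terminal_obj_def)
  have "is_iso C c"
    by (rule is_isoI(1)[of c t' t d])
       (use c d to terminal_unique[OF t(1)] terminal_unique[OF t'(1)] in \<open>auto simp: in_Hom\<close>)
  define y where "y = c \<cdot>\<^bsub>C\<^esub> y'"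
  have y: "y \<in> Fib M" "y \<in> Hom C Y t"
    using t' c fib_cmp[OF t'(2) iso_model(3)[OF \<open>is_iso C c\<close>]] by (auto simp: y_def in_Hom)
  obtain P p1 p2 where P: "is_pullback C x y P p1 p2"
    using pullback_exists[OF inf, of x y] t y by (auto simp: in_Hom)
  note pb = is_pullback_hom[OF P]
  have p2: "p2 \<in> Fib M" using fib_pullback(1)[OF P] t by simp
  have p1: "p1 \<in> Fib M" using fib_pullback(1)[OF is_pullback_sym[OF P]] y by simp
  have pair: "\<exists>h. h \<in> Arr C \<and> Dom C h = B \<and> Cod C h = P \<and> p1 \<cdot>\<^bsub>C\<^esub> h = b \<and> p2 \<cdot>\<^bsub>C\<^esub> h = b'"
    if "b \<in> Hom C B X" "b' \<in> Hom C B Y" for b b' B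
  proof -
    have "B \<in> Obj C" using that by (auto simp: in_Hom)
    have "x \<cdot>\<^bsub>C\<^esub> b = y \<cdot>\<^bsub>C\<^esub> b'"
      by (rule terminal_unique[OF t(1) \<open>B \<in> Obj C\<close>]) (use that t y in \<open>auto simp: in_Hom\<close>)
    then show ?thesis
      using is_pullback_lift[OF P, of b B b'] that t y unfolding in_Hom by metis
  qed
  obtain g where g: "g \<in> Arr C" "Dom C g = X" "Cod C g = P" "p1 \<cdot>\<^bsub>C\<^esub> g = Ide C X" "p2 \<cdot>\<^bsub>C\<^esub> g = f"
    using pair[of "Ide C X" X f] f obj by (auto simp: in_Hom)
  obtain Z j m where jm: "j \<in> Hom C X Z" "m \<in> Hom C Z P" "m \<cdot>\<^bsub>C\<^esub> j = g" "j \<in> Cof M \<inter> Weq M" "m \<in> Fib M"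
    using factorization(2)[of g X P] g by (auto simp: in_Hom)
  have jm': "j \<in> Arr C" "m \<in> Arr C" "Dom C j = X" "Cod C j = Z" "Dom C m = Z" "Cod C m = P"
    using jm by (auto simp: in_Hom)
  have xy: "Dom C x = X" "Dom C y = Y" using t y by (auto simp: in_Hom)
  have pm: "Dom C (p1 \<cdot>\<^bsub>C\<^esub> m) = Z" "Cod C (p1 \<cdot>\<^bsub>C\<^esub> m) = X" "Cod C (p2 \<cdot>\<^bsub>C\<^esub> m) = Y"
    using jm' pb xy by simp_all
  show ?thesis
  proof (rule that[of j "p1 \<cdot>\<^bsub>C\<^esub> m" "p2 \<cdot>\<^bsub>C\<^esub> m"])
    show "(p1 \<cdot>\<^bsub>C\<^esub> m) \<cdot>\<^bsub>C\<^esub> j = Ide C X" "(p2 \<cdot>\<^bsub>C\<^esub> m) \<cdot>\<^bsub>C\<^esub> j = f"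
      using jm jm' g pb by simp_all
    then show "p1 \<cdot>\<^bsub>C\<^esub> m \<in> Weq M"
      using weq_cmp(2)[of j "p1 \<cdot>\<^bsub>C\<^esub> m"] jm jm' pb obj ide_model(1)[of X] xy by simp
    show "p1 \<cdot>\<^bsub>C\<^esub> m \<in> Fib M" "p2 \<cdot>\<^bsub>C\<^esub> m \<in> Fib M"
      using fib_cmp[of m p1] fib_cmp[of m p2] p1 p2 jm jm' pb by auto
  next
    show "lifts_jointly C M (p1 \<cdot>\<^bsub>C\<^esub> m) (p2 \<cdot>\<^bsub>C\<^esub> m)"
      unfolding lifts_jointly_def pm
    proof (intro allI impI)
      fix i A B a b b'
      assume i: "i \<in> Cof M" "i \<in> Weq M" "i \<in> Hom C A B" and a: "a \<in> Hom C A Z"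
        and b: "b \<in> Hom C B X" "b' \<in> Hom C B Y" and eq: "(p1 \<cdot>\<^bsub>C\<^esub> m) \<cdot>\<^bsub>C\<^esub> a = b \<cdot>\<^bsub>C\<^esub> i" "(p2 \<cdot>\<^bsub>C\<^esub> m) \<cdot>\<^bsub>C\<^esub> a = b' \<cdot>\<^bsub>C\<^esub> i"
      obtain k where k: "k \<in> Arr C" "Dom C k = B" "Cod C k = P" "p1 \<cdot>\<^bsub>C\<^esub> k = b" "p2 \<cdot>\<^bsub>C\<^esub> k = b'"
        using pair[OF b] by blast
      have eq': "p1 \<cdot>\<^bsub>C\<^esub> (m \<cdot>\<^bsub>C\<^esub> a) = b \<cdot>\<^bsub>C\<^esub> i" "p2 \<cdot>\<^bsub>C\<^esub> (m \<cdot>\<^bsub>C\<^esub> a) = b' \<cdot>\<^bsub>C\<^esub> i"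
        using eq a jm' pb by (auto simp: in_Hom)
      have "m \<cdot>\<^bsub>C\<^esub> a = k \<cdot>\<^bsub>C\<^esub> i"
        by (rule is_pullback_unique[OF P])
          (use eq' i a k jm' pb pull[OF k(4)] pull[OF k(5)] in \<open>auto simp: in_Hom\<close>)
      moreover have "a \<in> Hom C (Dom C i) (Dom C m)" "k \<in> Hom C (Cod C i) (Cod C m)"
        using i a k jm' by (simp_all add: in_Hom)
      ultimately obtain h where "h \<in> Arr C" "Dom C h = Cod C i" "Cod C h = Dom C m"
        "h \<cdot>\<^bsub>C\<^esub> i = a" "m \<cdot>\<^bsub>C\<^esub> h = k"
        using lift[OF i(1) jm(5) disjI1[OF i(2)]] by metis
      then show "\<exists>h. h \<in> Hom C B Z \<and> h \<cdot>\<^bsub>C\<^esub> i = a \<and> (p1 \<cdot>\<^bsub>C\<^esub> m) \<cdot>\<^bsub>C\<^esub> h = b \<and> (p2 \<cdot>\<^bsub>C\<^esub> m) \<cdot>\<^bsub>C\<^esub> h = b'"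
        using jm' pb k HomD[OF i(3)] xy by (intro exI[of _ h]) (simp add: in_Hom)
    qed
  qed (use jm jm' pb xy in \<open>auto simp: in_Hom\<close>)
qed

text \<open>
  The mapping cylinder of a weak equivalence between cofibrant objects. The inclusion \<open>j\<close> is acyclic
  because \<open>r\<close> and \<open>d\<close> are weak equivalences.
\<close>

lemma (in model_category) cylinder_factorization:
  assumes inf: "infinite (UNIV :: 's set)"
    and A: "cofibrant C M A" and B: "cofibrant C M B" and d: "d \<in> Hom C A B" "d \<in> Weq M"
  obtains Z j k r where "j \<in> Cof M" "j \<in> Weq M" "k \<in> Cof M" "k \<in> Weq M"
    "j \<in> Hom C A Z" "k \<in> Hom C B Z" "r \<in> Hom C Z B" "r \<cdot>\<^bsub>C\<^esub> k = Ide C B" "r \<cdot>\<^bsub>C\<^esub> j = d"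
proof -
  interpret op: model_category s "op_cat C" "op_model M" by (rule op_model_category)
  obtain Z r k j where *: "r \<in> Weq M" "k \<in> Cof M" "k \<in> Weq M" "j \<in> Cof M"
    "r \<in> Hom C Z B" "k \<in> Hom C B Z" "j \<in> Hom C A Z" "r \<cdot>\<^bsub>C\<^esub> k = Ide C B" "r \<cdot>\<^bsub>C\<^esub> j = d"
    using op.path_factorization[OF inf, of B A d] A B d unfolding op_cat_simps Hom_op op_model_simps fibrant_op by metis
  moreover have "j \<in> Weq M"
    using weq_cmp(3)[of j r] * d by (auto simp: in_Hom)
  ultimately show ?thesis using that by blast
qed


section \<open>Adjunctions and Quillen adjunctions\<close>

context adjunction
begin

lemma unit_simps [simp]:
  "x \<in> Obj W \<Longrightarrow> eta x \<in> Arr W" "x \<in> Obj W \<Longrightarrow> Dom W (eta x) = x"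
  "x \<in> Obj W \<Longrightarrow> Cod W (eta x) = FObj G (FObj F x)"
  using unit_hom by (auto simp: in_Hom)

lemma counit_simps [simp]:
  "v \<in> Obj V \<Longrightarrow> kappa v \<in> Arr V" "v \<in> Obj V \<Longrightarrow> Cod V (kappa v) = v"
  "v \<in> Obj V \<Longrightarrow> Dom V (kappa v) = FObj F (FObj G v)"
  using counit_hom by (auto simp: in_Hom)

lemma unit_nat: "f \<in> Arr W \<Longrightarrow> Cod W f = y \<Longrightarrow> eta y \<cdot>\<^bsub>W\<^esub> f = FArr G (FArr F f) \<cdot>\<^bsub>W\<^esub> eta (Dom W f)"
  using unit_natural[of f "Dom W f" y] by (simp add: in_Hom)

lemma counit_nat: "f \<in> Arr V \<Longrightarrow> Cod V f = y \<Longrightarrow> kappa y \<cdot>\<^bsub>V\<^esub> FArr F (FArr G f) = f \<cdot>\<^bsub>V\<^esub> kappa (Dom V f)"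
  using counit_natural[of f "Dom V f" y] by (simp add: in_Hom)

lemma transpose_left:
  assumes "t \<in> Hom V (FObj F a) v" "a \<in> Obj W"
  shows "kappa v \<cdot>\<^bsub>V\<^esub> FArr F (FArr G t \<cdot>\<^bsub>W\<^esub> eta a) = t"
proof -
  note t = HomD[OF assms(1)]
  have v: "v \<in> Obj V" using t by auto
  have "kappa v \<cdot>\<^bsub>V\<^esub> FArr F (FArr G t \<cdot>\<^bsub>W\<^esub> eta a) = (kappa v \<cdot>\<^bsub>V\<^esub> FArr F (FArr G t)) \<cdot>\<^bsub>V\<^esub> FArr F (eta a)"
    using t v assms(2) by simp
  also have "\<dots> = t \<cdot>\<^bsub>V\<^esub> kappa (FObj F a) \<cdot>\<^bsub>V\<^esub> FArr F (eta a)"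
    using t v assms(2) by (simp add: counit_nat del: F.F_cmp' G.F_cmp')
  also have "\<dots> = t"
    using t assms(2) by (simp add: triangle_left)
  finally show ?thesis .
qed

lemma transpose_right:
  assumes "g \<in> Hom W a (FObj G v)" "v \<in> Obj V"
  shows "FArr G (kappa v \<cdot>\<^bsub>V\<^esub> FArr F g) \<cdot>\<^bsub>W\<^esub> eta a = g"
proof -
  note g = HomD[OF assms(1)]
  have a: "a \<in> Obj W" using g by auto
  have "FArr G (kappa v \<cdot>\<^bsub>V\<^esub> FArr F g) \<cdot>\<^bsub>W\<^esub> eta a = FArr G (kappa v) \<cdot>\<^bsub>W\<^esub> (FArr G (FArr F g) \<cdot>\<^bsub>W\<^esub> eta a)"
    using g a assms(2) by simp
  also have "\<dots> = FArr G (kappa v) \<cdot>\<^bsub>W\<^esub> (eta (FObj G v) \<cdot>\<^bsub>W\<^esub> g)"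
    using g a assms(2) by (simp add: unit_nat)
  also have "\<dots> = (FArr G (kappa v) \<cdot>\<^bsub>W\<^esub> eta (FObj G v)) \<cdot>\<^bsub>W\<^esub> g"
    using g a assms(2) by simp
  also have "\<dots> = g"
    using g assms(2) by (simp add: triangle_right del: F.A.assoc)
  finally show ?thesis .
qed

lemma transpose_inj:
  assumes "t \<in> Hom V (FObj F a) v" "t' \<in> Hom V (FObj F a) v" "a \<in> Obj W"
    and "FArr G t \<cdot>\<^bsub>W\<^esub> eta a = FArr G t' \<cdot>\<^bsub>W\<^esub> eta a"
  shows "t = t'"
  using transpose_left[OF assms(1,3)] transpose_left[OF assms(2,3)] unfolding assms(4) by (rule subst)

text \<open>A lifting problem for \<open>i\<close> and \<open>G p\<close> is the transpose of one for \<open>F i\<close> and \<open>p\<close>.\<close>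

lemma has_lifting_right:
  assumes "has_lifting V (FArr F i) p" "i \<in> Arr W" "p \<in> Arr V"
  shows "has_lifting W i (FArr G p)"
  unfolding has_lifting_def
proof (intro allI impI)
  fix u v
  assume "u \<in> Hom W (Dom W i) (Dom W (FArr G p))" "v \<in> Hom W (Cod W i) (Cod W (FArr G p))"
    and eq: "FArr G p \<cdot>\<^bsub>W\<^esub> u = v \<cdot>\<^bsub>W\<^esub> i"
  then have u: "u \<in> Arr W" "Dom W u = Dom W i" "Cod W u = FObj G (Dom V p)"
    and v: "v \<in> Arr W" "Dom W v = Cod W i" "Cod W v = FObj G (Cod V p)"
    using assms by (auto simp: in_Hom)
  let ?u = "kappa (Dom V p) \<cdot>\<^bsub>V\<^esub> FArr F u" and ?v = "kappa (Cod V p) \<cdot>\<^bsub>V\<^esub> FArr F v"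
  have "p \<cdot>\<^bsub>V\<^esub> ?u = (kappa (Cod V p) \<cdot>\<^bsub>V\<^esub> FArr F (FArr G p)) \<cdot>\<^bsub>V\<^esub> FArr F u"
    using assms u by (simp add: counit_nat del: F.B.assoc) simp
  also have "\<dots> = kappa (Cod V p) \<cdot>\<^bsub>V\<^esub> FArr F (FArr G p \<cdot>\<^bsub>W\<^esub> u)"
    using assms u by simp
  also have "\<dots> = ?v \<cdot>\<^bsub>V\<^esub> FArr F i"
    using assms v by (simp add: eq)
  finally have "p \<cdot>\<^bsub>V\<^esub> ?u = ?v \<cdot>\<^bsub>V\<^esub> FArr F i" .
  moreover have "?u \<in> Hom V (Dom V (FArr F i)) (Dom V p)" "?v \<in> Hom V (Cod V (FArr F i)) (Cod V p)"
    using assms u v by (simp_all add: in_Hom)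
  ultimately obtain h where h: "h \<in> Arr V" "Dom V h = Cod V (FArr F i)" "Cod V h = Dom V p"
    "h \<cdot>\<^bsub>V\<^esub> FArr F i = ?u" "p \<cdot>\<^bsub>V\<^esub> h = ?v"
    using has_liftingD[OF assms(1)] by metis
  have Dh: "Dom V h = FObj F (Cod W i)" using h assms by simp
  let ?h = "FArr G h \<cdot>\<^bsub>W\<^esub> eta (Cod W i)"
  have h': "?h \<in> Hom W (Cod W i) (Dom W (FArr G p))"
    using h Dh assms by (simp add: in_Hom)
  have "?h \<cdot>\<^bsub>W\<^esub> i = FArr G (h \<cdot>\<^bsub>V\<^esub> FArr F i) \<cdot>\<^bsub>W\<^esub> eta (Dom W i)"
    using h(1,3) Dh assms by (simp add: unit_nat)
  also have "\<dots> = u"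
    unfolding h(4) by (rule transpose_right) (use u assms in \<open>simp_all add: in_Hom\<close>)
  finally have 1: "?h \<cdot>\<^bsub>W\<^esub> i = u" .
  have "FArr G p \<cdot>\<^bsub>W\<^esub> ?h = FArr G (p \<cdot>\<^bsub>V\<^esub> h) \<cdot>\<^bsub>W\<^esub> eta (Cod W i)"
    using h(1,3) Dh assms by simp
  also have "\<dots> = v"
    unfolding h(5) by (rule transpose_right) (use v assms in \<open>simp_all add: in_Hom\<close>)
  finally show "\<exists>h. h \<in> Hom W (Cod W i) (Dom W (FArr G p)) \<and> h \<cdot>\<^bsub>W\<^esub> i = u \<and> FArr G p \<cdot>\<^bsub>W\<^esub> h = v"
    using 1 h' by blast
qed

lemma right_terminal:
  assumes "terminal_obj V t" shows "terminal_obj W (FObj G t)"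
  unfolding terminal_obj_def
proof (intro conjI ballI)
  have t: "t \<in> Obj V" using assms by (simp add: terminal_obj_def)
  then show "FObj G t \<in> Obj W" by simp
  fix x assume x: "x \<in> Obj W"
  obtain f where f: "f \<in> Arr V" "Dom V f = FObj F x" "Cod V f = t"
    using terminal_arr[OF assms, of "FObj F x"] x by auto
  show "\<exists>!f. f \<in> Hom W x (FObj G t)"
  proof (rule ex1I[of _ "FArr G f \<cdot>\<^bsub>W\<^esub> eta x"])
    show "FArr G f \<cdot>\<^bsub>W\<^esub> eta x \<in> Hom W x (FObj G t)" using f x by (simp add: in_Hom)
    fix g assume g: "g \<in> Hom W x (FObj G t)"
    have "kappa t \<cdot>\<^bsub>V\<^esub> FArr F g = f"
      by (rule terminal_unique[OF assms, of "FObj F x"]) (use f x g t in \<open>simp_all add: in_Hom\<close>)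
    then show "g = FArr G f \<cdot>\<^bsub>W\<^esub> eta x" using transpose_right[OF g t] by simp
  qed
qed

lemma left_initial:
  assumes "initial_obj W i" shows "initial_obj V (FObj F i)"
  unfolding initial_obj_def
proof (intro conjI ballI)
  have i: "i \<in> Obj W" using assms by (simp add: initial_obj_def)
  then show "FObj F i \<in> Obj V" by simp
  fix v assume v: "v \<in> Obj V"
  have ex1: "\<exists>!f. f \<in> Hom W i (FObj G v)" using assms v by (simp add: initial_obj_def)
  then obtain f where f: "f \<in> Hom W i (FObj G v)" by blast
  show "\<exists>!f. f \<in> Hom V (FObj F i) v"
  proof (rule ex1I[of _ "kappa v \<cdot>\<^bsub>V\<^esub> FArr F f"])
    show "kappa v \<cdot>\<^bsub>V\<^esub> FArr F f \<in> Hom V (FObj F i) v" using f v by (simp add: in_Hom)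
    fix g assume g: "g \<in> Hom V (FObj F i) v"
    have "FArr G g \<cdot>\<^bsub>W\<^esub> eta i \<in> Hom W i (FObj G v)" using g i by (simp add: in_Hom)
    then have "FArr G g \<cdot>\<^bsub>W\<^esub> eta i = f" using ex1 f by blast
    then show "g = kappa v \<cdot>\<^bsub>V\<^esub> FArr F f" using transpose_left[OF g i] by simp
  qed
qed

lemma right_pullback:
  assumes "is_pullback V f g P p q"
  shows "is_pullback W (FArr G f) (FArr G g) (FObj G P) (FArr G p) (FArr G q)"
proof -
  note pb = is_pullback_hom[OF assms]
  have P: "P \<in> Obj V" using pb by (metis F.B.dom_obj')
  have "\<exists>!h. h \<in> Hom W X (FObj G P) \<and> FArr G p \<cdot>\<^bsub>W\<^esub> h = r \<and> FArr G q \<cdot>\<^bsub>W\<^esub> h = t"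
    if r: "r \<in> Hom W X (FObj G (Dom V f))" and t: "t \<in> Hom W X (FObj G (Dom V g))"
      and rt: "FArr G f \<cdot>\<^bsub>W\<^esub> r = FArr G g \<cdot>\<^bsub>W\<^esub> t" for X r t
  proof -
    note r' = HomD[OF r] and t' = HomD[OF t]
    have X: "X \<in> Obj W" using r' by auto
    let ?r = "kappa (Dom V f) \<cdot>\<^bsub>V\<^esub> FArr F r" and ?t = "kappa (Dom V g) \<cdot>\<^bsub>V\<^esub> FArr F t"
    have rH: "?r \<in> Hom V (FObj F X) (Dom V f)" "?t \<in> Hom V (FObj F X) (Dom V g)"
      using r' t' pb by (simp_all add: in_Hom)
    have "f \<cdot>\<^bsub>V\<^esub> ?r = g \<cdot>\<^bsub>V\<^esub> ?t"
    proof (rule transpose_inj[of _ X "Cod V f"])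
      show "FArr G (f \<cdot>\<^bsub>V\<^esub> ?r) \<cdot>\<^bsub>W\<^esub> eta X = FArr G (g \<cdot>\<^bsub>V\<^esub> ?t) \<cdot>\<^bsub>W\<^esub> eta X"
        using transpose_right[OF r] transpose_right[OF t] r' t' pb rt X by simp
    qed (use r' t' pb X in \<open>simp_all add: in_Hom\<close>)
    then obtain k where k: "k \<in> Arr V" "Dom V k = FObj F X" "Cod V k = P" "p \<cdot>\<^bsub>V\<^esub> k = ?r" "q \<cdot>\<^bsub>V\<^esub> k = ?t"
      using is_pullback_lift[OF assms rH] by blast
    let ?k = "FArr G k \<cdot>\<^bsub>W\<^esub> eta X"
    have kk: "FArr G p \<cdot>\<^bsub>W\<^esub> ?k = r" "FArr G q \<cdot>\<^bsub>W\<^esub> ?k = t"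
    proof -
      have "FArr G p \<cdot>\<^bsub>W\<^esub> ?k = FArr G (p \<cdot>\<^bsub>V\<^esub> k) \<cdot>\<^bsub>W\<^esub> eta X"
        using k(1-3) X pb by simp
      then show "FArr G p \<cdot>\<^bsub>W\<^esub> ?k = r" unfolding k(4) using transpose_right[OF r] pb by simp
      have "FArr G q \<cdot>\<^bsub>W\<^esub> ?k = FArr G (q \<cdot>\<^bsub>V\<^esub> k) \<cdot>\<^bsub>W\<^esub> eta X"
        using k(1-3) X pb by simp
      then show "FArr G q \<cdot>\<^bsub>W\<^esub> ?k = t" unfolding k(5) using transpose_right[OF t] pb by simp
    qed
    show ?thesis
    proof (rule ex1I[of _ ?k])
      show "?k \<in> Hom W X (FObj G P) \<and> FArr G p \<cdot>\<^bsub>W\<^esub> ?k = r \<and> FArr G q \<cdot>\<^bsub>W\<^esub> ?k = t"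
        using k(1-3) X kk by (simp add: in_Hom)
      fix l assume "l \<in> Hom W X (FObj G P) \<and> FArr G p \<cdot>\<^bsub>W\<^esub> l = r \<and> FArr G q \<cdot>\<^bsub>W\<^esub> l = t"
      then have l: "l \<in> Hom W X (FObj G P)" "FArr G p \<cdot>\<^bsub>W\<^esub> l = r" "FArr G q \<cdot>\<^bsub>W\<^esub> l = t" by auto
      note l' = HomD[OF l(1)]
      let ?l = "kappa P \<cdot>\<^bsub>V\<^esub> FArr F l"
      have l1: "?l \<in> Arr V" "Dom V ?l = FObj F X" "Cod V ?l = P" using l' P by simp_all
      have nat: "z \<cdot>\<^bsub>V\<^esub> ?l = kappa (Cod V z) \<cdot>\<^bsub>V\<^esub> FArr F (FArr G z \<cdot>\<^bsub>W\<^esub> l)" if "z \<in> Arr V" "Dom V z = P" for z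
      proof -
        have "z \<cdot>\<^bsub>V\<^esub> ?l = (kappa (Cod V z) \<cdot>\<^bsub>V\<^esub> FArr F (FArr G z)) \<cdot>\<^bsub>V\<^esub> FArr F l"
          using that l' P by (simp add: counit_nat del: F.B.assoc) simp
        then show ?thesis using that l' P by simp
      qed
      have "?l = k"
        by (rule F.B.is_pullback_unique[OF assms]) (use l1 k nat[of p] nat[of q] l pb in simp_all)
      then show "l = ?k" using transpose_right[OF l(1) P] by simp
    qed
  qed
  then show ?thesis
    using pb by (simp add: is_pullback_def in_Hom flip: G.F_cmp')
qed

end

locale quillen_adjunction = adjunction W V F G eta kappa +
  W: model_category s W MW + V: model_category s V MV
  for s :: "'s itself" and W :: "('w, 'n, 'y) cat_scheme" and MW :: "'n model_str"
    and V :: "('v, 'm, 'z) cat_scheme" and MV :: "'m model_str"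
    and F :: "('w, 'n, 'v, 'm) func" and G :: "('v, 'm, 'w, 'n) func"
    and eta :: "'w \<Rightarrow> 'n" and kappa :: "'v \<Rightarrow> 'm" +
  assumes left_cof: "i \<in> Cof MW \<Longrightarrow> FArr F i \<in> Cof MV"
    and left_acyclic_cof: "i \<in> Cof MW \<Longrightarrow> i \<in> Weq MW \<Longrightarrow> FArr F i \<in> Weq MV"
begin

lemma right_fib: "p \<in> Fib MV \<Longrightarrow> FArr G p \<in> Fib MW"
  by (rule W.fib_if_lifting) (auto intro!: has_lifting_right V.lifting left_cof left_acyclic_cof)

lemma right_acyclic_fib:
  assumes "p \<in> Fib MV" "p \<in> Weq MV" shows "FArr G p \<in> Weq MW"
  by (rule W.acyclic_fib_if_lifting(2)) (use assms in \<open>auto intro!: has_lifting_right V.lifting left_cof\<close>)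

lemma right_fibrant: "fibrant V MV v \<Longrightarrow> fibrant W MW (FObj G v)"
  unfolding fibrant_def using right_terminal right_fib G.F_hom by blast

lemma left_cofibrant: "cofibrant W MW a \<Longrightarrow> cofibrant V MV (FObj F a)"
  unfolding cofibrant_def using left_initial left_cof F.F_hom by blast

text \<open>
  Ken Brown's lemma. Through the mapping path object, \<open>f\<close> is a section of an acyclic fibration
  followed by an acyclic fibration, and \<open>G\<close> preserves this shape.
\<close>

lemma right_weq:
  assumes inf: "infinite (UNIV :: 's set)"
    and f: "f \<in> Weq MV" "fibrant V MV (Dom V f)" "fibrant V MV (Cod V f)"
  shows "FArr G f \<in> Weq MW"
proof -
  have f': "f \<in> Arr V" "f \<in> Hom V (Dom V f) (Cod V f)" using f(1) by (auto simp: in_Hom)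
  obtain Z j p q where *: "j \<in> Weq MV" "p \<in> Fib MV" "p \<in> Weq MV" "q \<in> Fib MV"
    "j \<in> Hom V (Dom V f) Z" "p \<in> Hom V Z (Dom V f)" "q \<in> Hom V Z (Cod V f)"
    "p \<cdot>\<^bsub>V\<^esub> j = Ide V (Dom V f)" "q \<cdot>\<^bsub>V\<^esub> j = f"
    by (rule V.path_factorization[OF inf f(2,3) f'(2)])
  note h = HomD[OF *(5)] HomD[OF *(6)] HomD[OF *(7)]
  have "q \<in> Weq MV" using V.weq_cmp(2)[of j q] * h f(1) by simp
  then have q: "FArr G q \<in> Weq MW" using * by (simp add: right_acyclic_fib)
  have p: "FArr G p \<in> Weq MW" using * by (simp add: right_acyclic_fib)
  have "FArr G p \<cdot>\<^bsub>W\<^esub> FArr G j = Ide W (FObj G (Dom V f))"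
    using * h f' by (simp flip: G.F_cmp')
  then have "FArr G j \<in> Weq MW"
    using W.weq_cmp(3)[of "FArr G j" "FArr G p"] p h W.ide_model(1)[of "FObj G (Dom V f)"] f' by simp
  then have "FArr G q \<cdot>\<^bsub>W\<^esub> FArr G j \<in> Weq MW"
    using W.weq_cmp(1) q h by simp
  then show ?thesis using * h by (simp flip: G.F_cmp')
qed

end


section \<open>Mates of weak equivalences\<close>

text \<open>
  A form, without homotopy classes, of the principle that a map with homotopy inverses on both sides
  is a weak equivalence. The data say that \<open>\<theta> g\<close> is homotopic to the acyclic fibration \<open>e\<close> through
  the path object \<open>Y'\<close>, and that \<open>g h\<close> is a weak equivalence, where \<open>h\<close> lifts \<open>\<theta> q\<close> along \<open>e\<close>.

  Let \<open>E\<close> be the pullback along \<open>e\<close> of the mapping path object \<open>N\<close> of \<open>\<theta>\<close>. The homotopy is a section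
  \<open>s'\<close> of the projection \<open>p' : E \<rightarrow> a\<close>. The endomorphism \<open>s' p'\<close> of \<open>E\<close> is a weak equivalence because
  it becomes \<open>g h\<close> on \<open>b\<close>, and \<open>p'\<close> is a retract of it. As \<open>E\<close> is equivalent to \<open>X\<close> and \<open>a\<close> to \<open>Y\<close>,
  two-of-three carries this over to \<open>\<theta>\<close>.
\<close>

lemma (in model_category) weq_if_homotopy_inverse:
  assumes inf: "infinite (UNIV :: 's set)"
    and \<theta>: "\<theta> \<in> Hom C X Y"
    and d: "dl \<in> Hom C Y' Y" "dr \<in> Hom C Y' Y" "dl \<in> Fib M" "dl \<in> Weq M" "dr \<in> Weq M"
    and c: "c \<in> Hom C Y Y'" "dl \<cdot>\<^bsub>C\<^esub> c = Ide C Y" "dr \<cdot>\<^bsub>C\<^esub> c = Ide C Y"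
    and e: "e \<in> Hom C a Y" "e \<in> Fib M" "e \<in> Weq M"
    and q: "q \<in> Hom C b X" "q \<in> Weq M"
    and g: "g \<in> Hom C a X" and H: "H \<in> Hom C a Y'" "dl \<cdot>\<^bsub>C\<^esub> H = \<theta> \<cdot>\<^bsub>C\<^esub> g" "dr \<cdot>\<^bsub>C\<^esub> H = e"
    and h: "h \<in> Hom C b a" "e \<cdot>\<^bsub>C\<^esub> h = \<theta> \<cdot>\<^bsub>C\<^esub> q" "g \<cdot>\<^bsub>C\<^esub> h \<in> Weq M"
  shows "\<theta> \<in> Weq M"
proof -
  note hom = HomD[OF \<theta>] HomD[OF d(1)] HomD[OF d(2)] HomD[OF c(1)] HomD[OF e(1)] HomD[OF q(1)]
    HomD[OF g] HomD[OF H(1)] HomD[OF h(1)]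
  have a: "a \<in> Obj C" using hom by auto
  have Y: "Y \<in> Obj C" using hom by auto
  obtain N \<pi>X \<pi>Y where N: "is_pullback C \<theta> dl N \<pi>X \<pi>Y"
    using pullback_exists[OF inf, of \<theta> dl] hom by auto
  note N' = is_pullback_hom[OF N]
  have \<pi>X: "\<pi>X \<in> Weq M"
    using fib_pullback(2)[OF is_pullback_sym[OF N]] d by simp
  define p where "p = dr \<cdot>\<^bsub>C\<^esub> \<pi>Y"
  have p: "p \<in> Arr C" "Dom C p = N" "Cod C p = Y"
    using N' hom by (simp_all add: p_def)
  obtain E \<pi> p' where E: "is_pullback C p e E \<pi> p'"
    using pullback_exists[OF inf, of p e] hom p by auto
  note E' = is_pullback_hom[OF E]
  have Eo: "E \<in> Obj C" using E' dom_obj' by metis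
  have \<pi>: "\<pi> \<in> Weq M"
    using fib_pullback(2)[OF is_pullback_sym[OF E]] e by simp
  obtain s where s: "s \<in> Arr C" "Dom C s = a" "Cod C s = N" "\<pi>X \<cdot>\<^bsub>C\<^esub> s = g" "\<pi>Y \<cdot>\<^bsub>C\<^esub> s = H"
    using is_pullback_lift[OF N, of g a H] hom H g by (auto simp: in_Hom)
  have ps: "p \<cdot>\<^bsub>C\<^esub> s = e"
    using s N' hom by (simp add: p_def H)
  obtain s' where s': "s' \<in> Arr C" "Dom C s' = a" "Cod C s' = E" "\<pi> \<cdot>\<^bsub>C\<^esub> s' = s" "p' \<cdot>\<^bsub>C\<^esub> s' = Ide C a"
    using is_pullback_lift[OF E, of s a "Ide C a"] s p ps hom a by (auto simp: in_Hom)
  \<comment> \<open>The constant homotopy at \<open>\<theta> q\<close> lifts \<open>q\<close> to the mapping path object.\<close>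
  have "dl \<cdot>\<^bsub>C\<^esub> (c \<cdot>\<^bsub>C\<^esub> \<theta> \<cdot>\<^bsub>C\<^esub> q) = \<theta> \<cdot>\<^bsub>C\<^esub> q" "dr \<cdot>\<^bsub>C\<^esub> (c \<cdot>\<^bsub>C\<^esub> \<theta> \<cdot>\<^bsub>C\<^esub> q) = \<theta> \<cdot>\<^bsub>C\<^esub> q"
    using pull[OF c(2)] pull[OF c(3)] hom by simp_all
  moreover obtain l where l: "l \<in> Arr C" "Dom C l = b" "Cod C l = N" "\<pi>X \<cdot>\<^bsub>C\<^esub> l = q" "\<pi>Y \<cdot>\<^bsub>C\<^esub> l = c \<cdot>\<^bsub>C\<^esub> \<theta> \<cdot>\<^bsub>C\<^esub> q"
    using is_pullback_lift[OF N, of q b "c \<cdot>\<^bsub>C\<^esub> \<theta> \<cdot>\<^bsub>C\<^esub> q"] hom calculation(1) by (auto simp: in_Hom)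
  ultimately have pl: "p \<cdot>\<^bsub>C\<^esub> l = e \<cdot>\<^bsub>C\<^esub> h"
    using N' hom by (simp add: p_def h)
  obtain l' where l': "l' \<in> Arr C" "Dom C l' = b" "Cod C l' = E" "\<pi> \<cdot>\<^bsub>C\<^esub> l' = l" "p' \<cdot>\<^bsub>C\<^esub> l' = h"
    using is_pullback_lift[OF E, of l b h] pl l p hom by (auto simp: in_Hom)
  have l_weq: "l \<in> Weq M"
    using weq_cmp(3)[of l \<pi>X] l \<pi>X q N' hom by simp
  have l'_weq: "l' \<in> Weq M"
    using weq_cmp(3)[of l' \<pi>] l' \<pi> l_weq E' p by simp
  have "\<pi>X \<cdot>\<^bsub>C\<^esub> (s \<cdot>\<^bsub>C\<^esub> h) = g \<cdot>\<^bsub>C\<^esub> h"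
    using pull[OF s(4)] s(1-3) N' hom by simp
  then have "s \<cdot>\<^bsub>C\<^esub> h \<in> Weq M"
    using weq_cmp(3)[of "s \<cdot>\<^bsub>C\<^esub> h" \<pi>X] \<pi>X h(3) s(1-3) N' hom by simp
  moreover have "(\<pi> \<cdot>\<^bsub>C\<^esub> s' \<cdot>\<^bsub>C\<^esub> p') \<cdot>\<^bsub>C\<^esub> l' = s \<cdot>\<^bsub>C\<^esub> h"
    using pull[OF s'(4)] l' s' s(1-3) E' hom p by simp
  ultimately have "\<pi> \<cdot>\<^bsub>C\<^esub> s' \<cdot>\<^bsub>C\<^esub> p' \<in> Weq M"
    using weq_cmp(2)[of l' "\<pi> \<cdot>\<^bsub>C\<^esub> s' \<cdot>\<^bsub>C\<^esub> p'"] l'(1-3) l'_weq s'(1-3) E' hom p by simp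
  then have "s' \<cdot>\<^bsub>C\<^esub> p' \<in> Weq M"
    using weq_cmp(3)[of "s' \<cdot>\<^bsub>C\<^esub> p'" \<pi>] \<pi> s'(1-3) E' hom p by simp
  moreover have "retract_of C p' (s' \<cdot>\<^bsub>C\<^esub> p')"
    by (rule retract_ofI[where s = "Ide C E" and r = "Ide C E" and s' = s' and r' = p'])
      (use s' E' Eo hom p pull[OF s'(5)] in \<open>simp_all add: in_Hom\<close>)
  ultimately have "p' \<in> Weq M" by (rule retracts(1)[rotated])
  then have "e \<cdot>\<^bsub>C\<^esub> p' \<in> Weq M"
    using weq_cmp(1)[of p' e] e E' hom by simp
  then have "p \<cdot>\<^bsub>C\<^esub> \<pi> \<in> Weq M" using E' by simp
  then have "dr \<cdot>\<^bsub>C\<^esub> \<pi>Y \<in> Weq M"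
    using weq_cmp(2)[of \<pi> p] \<pi> E' p by (simp add: p_def)
  then have "\<pi>Y \<in> Weq M"
    using weq_cmp(3)[of \<pi>Y dr] d N' hom by simp
  then have "\<theta> \<cdot>\<^bsub>C\<^esub> \<pi>X \<in> Weq M"
    using weq_cmp(1)[of \<pi>Y dl] d N' hom by simp
  then show ?thesis
    using weq_cmp(2)[of \<pi>X \<theta>] \<pi>X N' hom by simp
qed

locale quillen_mates =
  Q1: quillen_adjunction s W MW V MV F1 G1 eta1 kappa1 +
  Q2: quillen_adjunction s W MW V MV F2 G2 eta2 kappa2
  for s :: "'s itself" and W :: "('w, 'n, 'y) cat_scheme" and MW :: "'n model_str"
    and V :: "('v, 'm, 'z) cat_scheme" and MV :: "'m model_str"
    and F1 :: "('w, 'n, 'v, 'm) func" and G1 :: "('v, 'm, 'w, 'n) func"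
    and eta1 :: "'w \<Rightarrow> 'n" and kappa1 :: "'v \<Rightarrow> 'm"
    and F2 :: "('w, 'n, 'v, 'm) func" and G2 :: "('v, 'm, 'w, 'n) func"
    and eta2 :: "'w \<Rightarrow> 'n" and kappa2 :: "'v \<Rightarrow> 'm" +
  fixes delta :: "'w \<Rightarrow> 'm" and theta :: "'v \<Rightarrow> 'n"
  assumes inf: "infinite (UNIV :: 's set)"
    and delta_hom: "x \<in> Obj W \<Longrightarrow> delta x \<in> Hom V (FObj F1 x) (FObj F2 x)"
    and delta_natural: "f \<in> Hom W x y \<Longrightarrow> delta y \<cdot>\<^bsub>V\<^esub> FArr F1 f = FArr F2 f \<cdot>\<^bsub>V\<^esub> delta x"
    and delta_weq: "cofibrant W MW x \<Longrightarrow> delta x \<in> Weq MV"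
    and theta_hom: "v \<in> Obj V \<Longrightarrow> theta v \<in> Hom W (FObj G2 v) (FObj G1 v)"
    and mate: "v \<in> Obj V \<Longrightarrow> kappa1 v \<cdot>\<^bsub>V\<^esub> FArr F1 (theta v) = kappa2 v \<cdot>\<^bsub>V\<^esub> delta (FObj G2 v)"
begin

lemma delta_simps [simp]:
  "x \<in> Obj W \<Longrightarrow> delta x \<in> Arr V" "x \<in> Obj W \<Longrightarrow> Dom V (delta x) = FObj F1 x"
  "x \<in> Obj W \<Longrightarrow> Cod V (delta x) = FObj F2 x"
  using delta_hom by (auto simp: in_Hom)

lemma theta_simps [simp]:
  "v \<in> Obj V \<Longrightarrow> theta v \<in> Arr W" "v \<in> Obj V \<Longrightarrow> Dom W (theta v) = FObj G2 v"
  "v \<in> Obj V \<Longrightarrow> Cod W (theta v) = FObj G1 v"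
  using theta_hom by (auto simp: in_Hom)

text \<open>On adjuncts, composition with \<open>theta\<close> is composition with \<open>delta\<close>.\<close>

lemma transpose_mate:
  assumes a: "a \<in> Obj W" and u: "u \<in> Hom V (FObj F2 a) v"
  shows "FArr G1 (u \<cdot>\<^bsub>V\<^esub> delta a) \<cdot>\<^bsub>W\<^esub> eta1 a = theta v \<cdot>\<^bsub>W\<^esub> (FArr G2 u \<cdot>\<^bsub>W\<^esub> eta2 a)"
proof -
  note u' = HomD[OF u]
  have v: "v \<in> Obj V" using u' by auto
  let ?g = "FArr G2 u \<cdot>\<^bsub>W\<^esub> eta2 a"
  have g: "?g \<in> Hom W a (FObj G2 v)" using a u' by (simp add: in_Hom)
  note g' = HomD[OF g]
  have "kappa1 v \<cdot>\<^bsub>V\<^esub> FArr F1 (theta v \<cdot>\<^bsub>W\<^esub> ?g) = (kappa1 v \<cdot>\<^bsub>V\<^esub> FArr F1 (theta v)) \<cdot>\<^bsub>V\<^esub> FArr F1 ?g"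
    using g' v by simp
  also have "\<dots> = kappa2 v \<cdot>\<^bsub>V\<^esub> (delta (FObj G2 v) \<cdot>\<^bsub>V\<^esub> FArr F1 ?g)"
    unfolding mate[OF v] using g' v by simp
  also have "\<dots> = (kappa2 v \<cdot>\<^bsub>V\<^esub> FArr F2 ?g) \<cdot>\<^bsub>V\<^esub> delta a"
    unfolding delta_natural[OF g] using g' v a by simp
  also have "\<dots> = u \<cdot>\<^bsub>V\<^esub> delta a"
    unfolding Q2.transpose_left[OF u a] ..
  finally have *: "kappa1 v \<cdot>\<^bsub>V\<^esub> FArr F1 (theta v \<cdot>\<^bsub>W\<^esub> ?g) = u \<cdot>\<^bsub>V\<^esub> delta a" .
  have "theta v \<cdot>\<^bsub>W\<^esub> ?g \<in> Hom W a (FObj G1 v)" using g' v by (simp add: in_Hom)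
  from Q1.transpose_right[OF this v] show ?thesis unfolding * .
qed

text \<open>
  In the next two lemmas \<open>P\<close> is a path object of \<open>v\<close>. They say that composition
  with \<open>theta v\<close> is surjective, respectively injective, on homotopy classes of maps out of a
  cofibrant object: the homotopy lives on the mapping cylinder \<open>Z\<close> of the weak equivalence
  \<open>delta a\<close>, in which both \<open>F1 a\<close> and \<open>F2 a\<close> are included by acyclic cofibrations.
\<close>

lemma homotopy_surj:
  assumes v: "fibrant V MV v" and a: "cofibrant W MW a" and e: "e \<in> Hom W a (FObj G1 v)"
    and p: "p0 \<in> Hom V P v" "p1 \<in> Hom V P v"
    and c: "c \<in> Hom V v P" "p0 \<cdot>\<^bsub>V\<^esub> c = Ide V v" "p1 \<cdot>\<^bsub>V\<^esub> c = Ide V v"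
    and lift: "lifts_jointly V MV p0 p1"
  obtains g H where "g \<in> Hom W a (FObj G2 v)" "H \<in> Hom W a (FObj G1 P)"
    "FArr G1 p0 \<cdot>\<^bsub>W\<^esub> H = theta v \<cdot>\<^bsub>W\<^esub> g" "FArr G1 p1 \<cdot>\<^bsub>W\<^esub> H = e"
proof -
  have obj: "a \<in> Obj W" "v \<in> Obj V" using e Q1.V.fibrant_obj[OF v] by (auto simp: in_Hom)
  note hom = HomD[OF e] HomD[OF p(1)] HomD[OF p(2)] HomD[OF c(1)]
  obtain Z j k r where Z: "j \<in> Cof MV" "j \<in> Weq MV" "k \<in> Cof MV" "k \<in> Weq MV"
    "j \<in> Hom V (FObj F1 a) Z" "k \<in> Hom V (FObj F2 a) Z" "r \<in> Hom V Z (FObj F2 a)"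
    "r \<cdot>\<^bsub>V\<^esub> k = Ide V (FObj F2 a)" "r \<cdot>\<^bsub>V\<^esub> j = delta a"
    by (rule Q1.V.cylinder_factorization[OF inf Q1.left_cofibrant[OF a] Q2.left_cofibrant[OF a]
          delta_hom[OF obj(1)] delta_weq[OF a]])
  note Z' = HomD[OF Z(5)] HomD[OF Z(6)] HomD[OF Z(7)]
  let ?t = "kappa1 v \<cdot>\<^bsub>V\<^esub> FArr F1 e"
  have t: "?t \<in> Hom V (Dom V j) v" using hom obj Z' by (simp add: in_Hom)
  obtain t' where t': "t' \<in> Arr V" "Dom V t' = Cod V j" "Cod V t' = v" "t' \<cdot>\<^bsub>V\<^esub> j = ?t"
    by (rule Q1.V.fibrant_extend[OF v Z(1,2) t])
  have "\<exists>K. K \<in> Hom V Z P \<and> K \<cdot>\<^bsub>V\<^esub> k = c \<cdot>\<^bsub>V\<^esub> t' \<cdot>\<^bsub>V\<^esub> k \<and> p0 \<cdot>\<^bsub>V\<^esub> K = t' \<cdot>\<^bsub>V\<^esub> k \<cdot>\<^bsub>V\<^esub> r \<and> p1 \<cdot>\<^bsub>V\<^esub> K = t'"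
    by (rule lifts_jointlyD[OF lift p Z(3,4,6)])
      (use hom Z' t'(1-3) obj Z(8) Q1.F.B.pull[OF c(2)] Q1.F.B.pull[OF c(3)] in \<open>simp_all add: in_Hom\<close>)
  then obtain K where K: "K \<in> Hom V Z P" "p0 \<cdot>\<^bsub>V\<^esub> K = t' \<cdot>\<^bsub>V\<^esub> k \<cdot>\<^bsub>V\<^esub> r" "p1 \<cdot>\<^bsub>V\<^esub> K = t'" by blast
  note K' = HomD[OF K(1)]
  let ?u = "t' \<cdot>\<^bsub>V\<^esub> k" and ?H = "K \<cdot>\<^bsub>V\<^esub> j"
  have u: "?u \<in> Hom V (FObj F2 a) v" using Z' t' by (simp add: in_Hom)
  have H0: "p0 \<cdot>\<^bsub>V\<^esub> ?H = ?u \<cdot>\<^bsub>V\<^esub> delta a"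
    using Q1.F.B.pull[OF K(2)] Z' K' hom t'(1-3) Z(9) obj by simp
  have H1: "p1 \<cdot>\<^bsub>V\<^esub> ?H = ?t"
    using Q1.F.B.pull[OF K(3)] Z' K' hom t' by simp
  have Hh: "?H \<in> Arr V" "Dom V ?H = FObj F1 a" "Cod V ?H = P" using Z' K' by simp_all
  have G1: "FArr G1 p \<cdot>\<^bsub>W\<^esub> (FArr G1 ?H \<cdot>\<^bsub>W\<^esub> eta1 a) = FArr G1 (p \<cdot>\<^bsub>V\<^esub> ?H) \<cdot>\<^bsub>W\<^esub> eta1 a"
    if "p \<in> Arr V" "Dom V p = P" for p
    using that Hh obj Q1.G.F_cmp'[of ?H p] by (simp del: Q1.G.F_cmp')
  show ?thesis
  proof (rule that[of "FArr G2 ?u \<cdot>\<^bsub>W\<^esub> eta2 a" "FArr G1 ?H \<cdot>\<^bsub>W\<^esub> eta1 a"])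
    show "FArr G2 ?u \<cdot>\<^bsub>W\<^esub> eta2 a \<in> Hom W a (FObj G2 v)" using HomD[OF u] obj by (simp add: in_Hom)
    show "FArr G1 ?H \<cdot>\<^bsub>W\<^esub> eta1 a \<in> Hom W a (FObj G1 P)" using Hh obj by (simp add: in_Hom)
    show "FArr G1 p0 \<cdot>\<^bsub>W\<^esub> FArr G1 ?H \<cdot>\<^bsub>W\<^esub> eta1 a = theta v \<cdot>\<^bsub>W\<^esub> FArr G2 ?u \<cdot>\<^bsub>W\<^esub> eta2 a"
      using G1[of p0] hom H0 transpose_mate[OF obj(1) u] by simp
    show "FArr G1 p1 \<cdot>\<^bsub>W\<^esub> FArr G1 ?H \<cdot>\<^bsub>W\<^esub> eta1 a = e"
      using G1[of p1] hom H1 Q1.transpose_right[OF e obj(2)] by simp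
  qed
qed

lemma homotopy_inj:
  assumes v: "v \<in> Obj V" and a: "cofibrant W MW a"
    and g: "g \<in> Hom W a (FObj G2 v)" "g' \<in> Hom W a (FObj G2 v)"
    and H: "H \<in> Hom W a (FObj G1 P)"
      "FArr G1 p0 \<cdot>\<^bsub>W\<^esub> H = theta v \<cdot>\<^bsub>W\<^esub> g" "FArr G1 p1 \<cdot>\<^bsub>W\<^esub> H = theta v \<cdot>\<^bsub>W\<^esub> g'"
    and p: "p0 \<in> Hom V P v" "p1 \<in> Hom V P v"
    and lift: "lifts_jointly V MV p0 p1"
  obtains K where "K \<in> Hom W a (FObj G2 P)" "FArr G2 p0 \<cdot>\<^bsub>W\<^esub> K = g" "FArr G2 p1 \<cdot>\<^bsub>W\<^esub> K = g'"
proof -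
  have obj: "a \<in> Obj W" "P \<in> Obj V" using g p by (auto simp: in_Hom)
  note hom = HomD[OF g(1)] HomD[OF g(2)] HomD[OF H(1)] HomD[OF p(1)] HomD[OF p(2)]
  obtain Z j k r where Z: "j \<in> Cof MV" "j \<in> Weq MV" "k \<in> Cof MV" "k \<in> Weq MV"
    "j \<in> Hom V (FObj F1 a) Z" "k \<in> Hom V (FObj F2 a) Z" "r \<in> Hom V Z (FObj F2 a)"
    "r \<cdot>\<^bsub>V\<^esub> k = Ide V (FObj F2 a)" "r \<cdot>\<^bsub>V\<^esub> j = delta a"
    by (rule Q1.V.cylinder_factorization[OF inf Q1.left_cofibrant[OF a] Q2.left_cofibrant[OF a]
          delta_hom[OF obj(1)] delta_weq[OF a]])
  note Z' = HomD[OF Z(5)] HomD[OF Z(6)] HomD[OF Z(7)]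
  let ?u = "kappa2 v \<cdot>\<^bsub>V\<^esub> FArr F2 g" and ?u' = "kappa2 v \<cdot>\<^bsub>V\<^esub> FArr F2 g'"
  let ?K = "kappa1 P \<cdot>\<^bsub>V\<^esub> FArr F1 H"
  have u: "?u \<in> Hom V (FObj F2 a) v" "?u' \<in> Hom V (FObj F2 a) v"
    using hom v by (simp_all add: in_Hom)
  note u' = HomD[OF u(1)] HomD[OF u(2)]
  have K: "?K \<in> Hom V (FObj F1 a) P" using hom obj by (simp add: in_Hom)
  note K' = HomD[OF K]
  have eq: "p \<cdot>\<^bsub>V\<^esub> ?K = u \<cdot>\<^bsub>V\<^esub> delta a"
    if ph: "p \<in> Hom V P v" and u: "u \<in> Hom V (FObj F2 a) v" and x: "FArr G2 u \<cdot>\<^bsub>W\<^esub> eta2 a = x"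
      and pH: "FArr G1 p \<cdot>\<^bsub>W\<^esub> H = theta v \<cdot>\<^bsub>W\<^esub> x" for p u x
  proof (rule Q1.transpose_inj)
    show "FArr G1 (p \<cdot>\<^bsub>V\<^esub> ?K) \<cdot>\<^bsub>W\<^esub> eta1 a = FArr G1 (u \<cdot>\<^bsub>V\<^esub> delta a) \<cdot>\<^bsub>W\<^esub> eta1 a"
    proof -
      have "FArr G1 (p \<cdot>\<^bsub>V\<^esub> ?K) \<cdot>\<^bsub>W\<^esub> eta1 a = FArr G1 p \<cdot>\<^bsub>W\<^esub> (FArr G1 ?K \<cdot>\<^bsub>W\<^esub> eta1 a)"
        using HomD[OF ph] K' obj Q1.G.F_cmp'[of ?K p] by (simp del: Q1.G.F_cmp')
      then show ?thesis
        unfolding Q1.transpose_right[OF H(1) obj(2)] pH transpose_mate[OF obj(1) u] x .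
    qed
  qed (use HomD[OF ph] HomD[OF u] K' obj in \<open>simp_all add: in_Hom\<close>)
  have e0: "p0 \<cdot>\<^bsub>V\<^esub> ?K = (?u \<cdot>\<^bsub>V\<^esub> r) \<cdot>\<^bsub>V\<^esub> j"
    using eq[OF p(1) u(1) Q2.transpose_right[OF g(1) v] H(2)] Z' u' Z(9) by (simp del: Q1.F.B.assoc add: Q1.F.B.assoc[of j r])
  have e1: "p1 \<cdot>\<^bsub>V\<^esub> ?K = (?u' \<cdot>\<^bsub>V\<^esub> r) \<cdot>\<^bsub>V\<^esub> j"
    using eq[OF p(2) u(2) Q2.transpose_right[OF g(2) v] H(3)] Z' u' Z(9) by (simp del: Q1.F.B.assoc add: Q1.F.B.assoc[of j r])
  have ur: "?u \<cdot>\<^bsub>V\<^esub> r \<in> Hom V Z v" "?u' \<cdot>\<^bsub>V\<^esub> r \<in> Hom V Z v"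
    using u' Z' by (simp_all add: in_Hom)
  obtain L where L: "L \<in> Hom V Z P" "p0 \<cdot>\<^bsub>V\<^esub> L = ?u \<cdot>\<^bsub>V\<^esub> r" "p1 \<cdot>\<^bsub>V\<^esub> L = ?u' \<cdot>\<^bsub>V\<^esub> r"
    using lifts_jointlyD[OF lift p Z(1,2,5) K ur e0 e1] by blast
  note L' = HomD[OF L(1)]
  let ?L = "L \<cdot>\<^bsub>V\<^esub> k"
  have Lk: "?L \<in> Arr V" "Dom V ?L = FObj F2 a" "Cod V ?L = P" using L' Z' by simp_all
  have L0: "p0 \<cdot>\<^bsub>V\<^esub> ?L = ?u"
  proof -
    have "p0 \<cdot>\<^bsub>V\<^esub> ?L = (p0 \<cdot>\<^bsub>V\<^esub> L) \<cdot>\<^bsub>V\<^esub> k" using L' Z' hom by simp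
    also have "\<dots> = ?u \<cdot>\<^bsub>V\<^esub> (r \<cdot>\<^bsub>V\<^esub> k)"
      unfolding L(2) using u' Z' by (simp del: Q1.F.B.assoc add: Q1.F.B.assoc[of k r])
    finally show ?thesis unfolding Z(8) using u' by (simp del: Q1.F.B.assoc)
  qed
  have L1: "p1 \<cdot>\<^bsub>V\<^esub> ?L = ?u'"
  proof -
    have "p1 \<cdot>\<^bsub>V\<^esub> ?L = (p1 \<cdot>\<^bsub>V\<^esub> L) \<cdot>\<^bsub>V\<^esub> k" using L' Z' hom by simp
    also have "\<dots> = ?u' \<cdot>\<^bsub>V\<^esub> (r \<cdot>\<^bsub>V\<^esub> k)"
      unfolding L(3) using u' Z' by (simp del: Q1.F.B.assoc add: Q1.F.B.assoc[of k r])
    finally show ?thesis unfolding Z(8) using u' by (simp del: Q1.F.B.assoc)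
  qed
  have G2: "FArr G2 p \<cdot>\<^bsub>W\<^esub> (FArr G2 ?L \<cdot>\<^bsub>W\<^esub> eta2 a) = FArr G2 (p \<cdot>\<^bsub>V\<^esub> ?L) \<cdot>\<^bsub>W\<^esub> eta2 a"
    if "p \<in> Arr V" "Dom V p = P" for p
    using that Lk obj Q2.G.F_cmp'[of ?L p] by (simp del: Q2.G.F_cmp')
  show ?thesis
  proof (rule that[of "FArr G2 ?L \<cdot>\<^bsub>W\<^esub> eta2 a"])
    show "FArr G2 ?L \<cdot>\<^bsub>W\<^esub> eta2 a \<in> Hom W a (FObj G2 P)" using Lk obj by (simp add: in_Hom)
    show "FArr G2 p0 \<cdot>\<^bsub>W\<^esub> FArr G2 ?L \<cdot>\<^bsub>W\<^esub> eta2 a = g"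
      unfolding G2[OF hom(10,11)] L0 by (rule Q2.transpose_right[OF g(1) v])
    show "FArr G2 p1 \<cdot>\<^bsub>W\<^esub> FArr G2 ?L \<cdot>\<^bsub>W\<^esub> eta2 a = g'"
      unfolding G2[OF hom(13,14)] L1 by (rule Q2.transpose_right[OF g(2) v])
  qed
qed

text \<open>
  Let \<open>e\<close> and \<open>q\<close> be cofibrant replacements of \<open>G1 v\<close> and \<open>G2 v\<close>. Surjectivity gives \<open>g\<close> with
  \<open>theta v \<cdot> g\<close> homotopic to \<open>e\<close>. If \<open>h\<close> lifts \<open>theta v \<cdot> q\<close> along \<open>e\<close>, then \<open>g \<cdot> h\<close> and \<open>q\<close> have
  homotopic images under \<open>theta v\<close>; so they are homotopic by injectivity, and \<open>g \<cdot> h\<close> is a weak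
  equivalence.
\<close>

theorem theta_weq:
  assumes v: "fibrant V MV v"
  shows "theta v \<in> Weq MW"
proof -
  have vo: "v \<in> Obj V" using v by (rule Q1.V.fibrant_obj)
  have idv: "Ide V v \<in> Hom V v v" using vo by (simp add: in_Hom)
  obtain P c p0 p1 where P: "c \<in> Weq MV" "p0 \<in> Fib MV" "p0 \<in> Weq MV" "p1 \<in> Fib MV"
    "c \<in> Hom V v P" "p0 \<in> Hom V P v" "p1 \<in> Hom V P v" "p0 \<cdot>\<^bsub>V\<^esub> c = Ide V v" "p1 \<cdot>\<^bsub>V\<^esub> c = Ide V v"
    and lift: "lifts_jointly V MV p0 p1"
    using Q1.V.path_factorization[OF inf v v idv] by metis
  note P' = HomD[OF P(5)] HomD[OF P(6)] HomD[OF P(7)]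
  have p1_weq: "p1 \<in> Weq MV"
    using Q1.V.weq_cmp(2)[of c p1] P P' vo Q1.V.ide_model(1)[of v] by simp
  obtain e where e: "e \<in> Fib MW" "e \<in> Weq MW" "cofibrant W MW (Dom W e)" "Cod W e = FObj G1 v"
    using Q1.W.cofibrant_replacement_exists[of "FObj G1 v"] vo by auto
  obtain q where q: "q \<in> Fib MW" "q \<in> Weq MW" "cofibrant W MW (Dom W q)" "Cod W q = FObj G2 v"
    using Q1.W.cofibrant_replacement_exists[of "FObj G2 v"] vo by auto
  have eq: "e \<in> Arr W" "q \<in> Arr W" using e q by simp_all
  have eh: "e \<in> Hom W (Dom W e) (FObj G1 v)" using e by (simp add: in_Hom)
  obtain g H where g: "g \<in> Hom W (Dom W e) (FObj G2 v)" and H: "H \<in> Hom W (Dom W e) (FObj G1 P)"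
    "FArr G1 p0 \<cdot>\<^bsub>W\<^esub> H = theta v \<cdot>\<^bsub>W\<^esub> g" "FArr G1 p1 \<cdot>\<^bsub>W\<^esub> H = e"
    by (rule homotopy_surj[OF v e(3) eh P(6,7,5,8,9) lift])
  note gH = HomD[OF g] HomD[OF H(1)]
  have "theta v \<cdot>\<^bsub>W\<^esub> q \<in> Hom W (Dom W q) (Cod W e)" using q e eq vo by (simp add: in_Hom)
  then obtain h where h: "h \<in> Arr W" "Dom W h = Dom W q" "Cod W h = Dom W e" "e \<cdot>\<^bsub>W\<^esub> h = theta v \<cdot>\<^bsub>W\<^esub> q"
    by (rule Q1.W.cofibrant_lift[OF q(3) e(1,2)])
  have Hh: "H \<cdot>\<^bsub>W\<^esub> h \<in> Hom W (Dom W q) (FObj G1 P)" "g \<cdot>\<^bsub>W\<^esub> h \<in> Hom W (Dom W q) (FObj G2 v)"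
    "q \<in> Hom W (Dom W q) (FObj G2 v)"
    using gH h q eq by (simp_all add: in_Hom)
  have "FArr G1 p0 \<cdot>\<^bsub>W\<^esub> (H \<cdot>\<^bsub>W\<^esub> h) = theta v \<cdot>\<^bsub>W\<^esub> (g \<cdot>\<^bsub>W\<^esub> h)"
    using Q1.F.A.pull[OF H(2)] gH h(1-3) P' vo by simp
  moreover have "FArr G1 p1 \<cdot>\<^bsub>W\<^esub> (H \<cdot>\<^bsub>W\<^esub> h) = theta v \<cdot>\<^bsub>W\<^esub> q"
    using Q1.F.A.pull[OF H(3)] gH h P' vo by simp
  ultimately obtain K where K: "K \<in> Hom W (Dom W q) (FObj G2 P)"
    "FArr G2 p0 \<cdot>\<^bsub>W\<^esub> K = g \<cdot>\<^bsub>W\<^esub> h" "FArr G2 p1 \<cdot>\<^bsub>W\<^esub> K = q"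
    by (rule homotopy_inj[OF vo q(3) Hh(2,3,1) _ _ P(6,7) lift])
  note K' = HomD[OF K(1)]
  have "K \<in> Weq MW"
    using Q1.W.weq_cmp(3)[of K "FArr G2 p1"] Q2.right_acyclic_fib[OF P(4) p1_weq] K K' q P' by simp
  then have "FArr G2 p0 \<cdot>\<^bsub>W\<^esub> K \<in> Weq MW"
    using Q1.W.weq_cmp(1)[of K "FArr G2 p0"] Q2.right_acyclic_fib[OF P(2,3)] K' P' by simp
  then have gh: "g \<cdot>\<^bsub>W\<^esub> h \<in> Weq MW" unfolding K(2) .
  show ?thesis
  proof (rule Q1.W.weq_if_homotopy_inverse[OF inf theta_hom[OF vo], where dl = "FArr G1 p0" and dr = "FArr G1 p1"
        and c = "FArr G1 c" and e = e and q = q and g = g and h = h and H = H])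
    show "FArr G1 p0 \<cdot>\<^bsub>W\<^esub> FArr G1 c = Ide W (FObj G1 v)" "FArr G1 p1 \<cdot>\<^bsub>W\<^esub> FArr G1 c = Ide W (FObj G1 v)"
      using P P' vo by (simp_all flip: Q1.G.F_cmp')
  qed (use P P' p1_weq e eq q g H h gh in \<open>simp_all add: in_Hom Q1.right_fib Q1.right_acyclic_fib\<close>)
qed

end


section \<open>Composition of adjunctions\<close>

definition comp_func :: "('b, 'l, 'o, 'm) func \<Rightarrow> ('a, 'k, 'b, 'l) func \<Rightarrow> ('a, 'k, 'o, 'm) func" where
  "comp_func G F = \<lparr>FObj = FObj G \<circ> FObj F, FArr = FArr G \<circ> FArr F\<rparr>"

lemma comp_func_simps [simp]:
  "FObj (comp_func G F) x = FObj G (FObj F x)" "FArr (comp_func G F) f = FArr G (FArr F f)"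
  by (simp_all add: comp_func_def)

lemma comp_functor:
  assumes "is_functor A B F" "is_functor B D G"
  shows "is_functor A D (comp_func G F)"
proof -
  interpret F: is_functor A B F by fact
  interpret G: is_functor B D G by fact
  show ?thesis
    by (rule is_functorI) (simp_all add: F.A.category_axioms G.B.category_axioms in_Hom)
qed

lemma comp_adjunction:
  assumes "adjunction W V F G eta kappa" "adjunction V U F' G' eta' kappa'"
  shows "adjunction W U (comp_func F' F) (comp_func G G')
    (\<lambda>x. FArr G (eta' (FObj F x)) \<cdot>\<^bsub>W\<^esub> eta x) (\<lambda>u. kappa' u \<cdot>\<^bsub>U\<^esub> FArr F' (kappa (FObj G' u)))"
proof -
  interpret I: adjunction W V F G eta kappa by fact
  interpret J: adjunction V U F' G' eta' kappa' by fact
  interpret L: is_functor W U "comp_func F' F"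
    using I.F.is_functor_axioms J.F.is_functor_axioms by (rule comp_functor)
  interpret R: is_functor U W "comp_func G G'"
    using J.G.is_functor_axioms I.G.is_functor_axioms by (rule comp_functor)
  show ?thesis
  proof
    fix x y f assume "f \<in> Hom W x y"
    note f = HomD[OF this]
    have x: "x \<in> Obj W" "y \<in> Obj W" using f by auto
    have "FArr G (eta' (FObj F y)) \<cdot>\<^bsub>W\<^esub> (eta y \<cdot>\<^bsub>W\<^esub> f)
        = FArr G (eta' (FObj F y) \<cdot>\<^bsub>V\<^esub> FArr F f) \<cdot>\<^bsub>W\<^esub> eta x"
      using f x by (simp add: I.unit_nat)
    also have "\<dots> = FArr G (FArr G' (FArr F' (FArr F f))) \<cdot>\<^bsub>W\<^esub> FArr G (eta' (FObj F x)) \<cdot>\<^bsub>W\<^esub> eta x"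
      using f x by (simp add: J.unit_nat)
    finally show "(FArr G (eta' (FObj F y)) \<cdot>\<^bsub>W\<^esub> eta y) \<cdot>\<^bsub>W\<^esub> f
        = FArr (comp_func G G') (FArr (comp_func F' F) f) \<cdot>\<^bsub>W\<^esub> FArr G (eta' (FObj F x)) \<cdot>\<^bsub>W\<^esub> eta x"
      using f x by simp
  next
    fix u v h assume "h \<in> Hom U u v"
    note h = HomD[OF this]
    have u: "u \<in> Obj U" "v \<in> Obj U" using h by auto
    have "kappa' v \<cdot>\<^bsub>U\<^esub> FArr F' (kappa (FObj G' v) \<cdot>\<^bsub>V\<^esub> FArr F (FArr G (FArr G' h)))
        = (kappa' v \<cdot>\<^bsub>U\<^esub> FArr F' (FArr G' h)) \<cdot>\<^bsub>U\<^esub> FArr F' (kappa (FObj G' u))"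
      using h u by (simp add: I.counit_nat del: J.F.B.assoc) simp
    also have "\<dots> = h \<cdot>\<^bsub>U\<^esub> kappa' u \<cdot>\<^bsub>U\<^esub> FArr F' (kappa (FObj G' u))"
      using h u by (simp add: J.counit_nat del: J.F.B.assoc) simp
    finally show "(kappa' v \<cdot>\<^bsub>U\<^esub> FArr F' (kappa (FObj G' v))) \<cdot>\<^bsub>U\<^esub>
        FArr (comp_func F' F) (FArr (comp_func G G') h) = h \<cdot>\<^bsub>U\<^esub> kappa' u \<cdot>\<^bsub>U\<^esub> FArr F' (kappa (FObj G' u))"
      using h u by simp
  next
    fix x assume x: "x \<in> Obj W"
    have "kappa (FObj G' (FObj F' (FObj F x))) \<cdot>\<^bsub>V\<^esub> FArr F (FArr G (eta' (FObj F x)) \<cdot>\<^bsub>W\<^esub> eta x)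
        = (kappa (FObj G' (FObj F' (FObj F x))) \<cdot>\<^bsub>V\<^esub> FArr F (FArr G (eta' (FObj F x)))) \<cdot>\<^bsub>V\<^esub> FArr F (eta x)"
      using x by simp
    also have "\<dots> = eta' (FObj F x) \<cdot>\<^bsub>V\<^esub> (kappa (FObj F x) \<cdot>\<^bsub>V\<^esub> FArr F (eta x))"
      using x I.counit_nat[of "eta' (FObj F x)" "FObj G' (FObj F' (FObj F x))"]
      by (simp del: I.F.B.assoc) simp
    also have "\<dots> = eta' (FObj F x)" using x by (simp add: I.triangle_left)
    finally have *: "kappa (FObj G' (FObj F' (FObj F x))) \<cdot>\<^bsub>V\<^esub> FArr F (FArr G (eta' (FObj F x)) \<cdot>\<^bsub>W\<^esub> eta x)
      = eta' (FObj F x)" .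
    have "(kappa' (FObj F' (FObj F x)) \<cdot>\<^bsub>U\<^esub> FArr F' (kappa (FObj G' (FObj F' (FObj F x))))) \<cdot>\<^bsub>U\<^esub>
        FArr F' (FArr F (FArr G (eta' (FObj F x)) \<cdot>\<^bsub>W\<^esub> eta x))
      = kappa' (FObj F' (FObj F x)) \<cdot>\<^bsub>U\<^esub> FArr F' (kappa (FObj G' (FObj F' (FObj F x))) \<cdot>\<^bsub>V\<^esub>
          FArr F (FArr G (eta' (FObj F x)) \<cdot>\<^bsub>W\<^esub> eta x))"
      using x by simp
    also have "\<dots> = Ide U (FObj F' (FObj F x))"
      unfolding * using x by (simp add: J.triangle_left)
    finally show "(kappa' (FObj (comp_func F' F) x) \<cdot>\<^bsub>U\<^esub> FArr F' (kappa (FObj G' (FObj (comp_func F' F) x)))) \<cdot>\<^bsub>U\<^esub>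
        FArr (comp_func F' F) (FArr G (eta' (FObj F x)) \<cdot>\<^bsub>W\<^esub> eta x) = Ide U (FObj (comp_func F' F) x)"
      by simp
  next
    fix v assume v: "v \<in> Obj U"
    have "FArr G' (kappa' v \<cdot>\<^bsub>U\<^esub> FArr F' (kappa (FObj G' v))) \<cdot>\<^bsub>V\<^esub> eta' (FObj F (FObj G (FObj G' v)))
        = FArr G' (kappa' v) \<cdot>\<^bsub>V\<^esub> (eta' (FObj G' v) \<cdot>\<^bsub>V\<^esub> kappa (FObj G' v))"
      using v by (simp add: J.unit_nat)
    also have "\<dots> = (FArr G' (kappa' v) \<cdot>\<^bsub>V\<^esub> eta' (FObj G' v)) \<cdot>\<^bsub>V\<^esub> kappa (FObj G' v)"
      using v by simp
    also have "\<dots> = kappa (FObj G' v)"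
      using v by (simp add: J.triangle_right del: I.F.B.assoc)
    finally have *: "FArr G' (kappa' v \<cdot>\<^bsub>U\<^esub> FArr F' (kappa (FObj G' v))) \<cdot>\<^bsub>V\<^esub> eta' (FObj F (FObj G (FObj G' v)))
      = kappa (FObj G' v)" .
    have "FArr G (FArr G' (kappa' v \<cdot>\<^bsub>U\<^esub> FArr F' (kappa (FObj G' v)))) \<cdot>\<^bsub>W\<^esub>
        FArr G (eta' (FObj F (FObj G (FObj G' v)))) \<cdot>\<^bsub>W\<^esub> eta (FObj G (FObj G' v))
      = FArr G (FArr G' (kappa' v \<cdot>\<^bsub>U\<^esub> FArr F' (kappa (FObj G' v))) \<cdot>\<^bsub>V\<^esub>
          eta' (FObj F (FObj G (FObj G' v)))) \<cdot>\<^bsub>W\<^esub> eta (FObj G (FObj G' v))"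
      using v by simp
    also have "\<dots> = Ide W (FObj G (FObj G' v))"
      unfolding * using v by (simp add: I.triangle_right)
    finally show "FArr (comp_func G G') (kappa' v \<cdot>\<^bsub>U\<^esub> FArr F' (kappa (FObj G' v))) \<cdot>\<^bsub>W\<^esub>
        FArr G (eta' (FObj F (FObj (comp_func G G') v))) \<cdot>\<^bsub>W\<^esub> eta (FObj (comp_func G G') v)
      = Ide W (FObj (comp_func G G') v)"
      by simp
  qed (simp_all add: in_Hom)
qed

lemma comp_quillen_adjunction:
  assumes "quillen_adjunction s W MW V MV F G eta kappa" "quillen_adjunction s V MV U MU F' G' eta' kappa'"
  shows "quillen_adjunction s W MW U MU (comp_func F' F) (comp_func G G')
    (\<lambda>x. FArr G (eta' (FObj F x)) \<cdot>\<^bsub>W\<^esub> eta x) (\<lambda>u. kappa' u \<cdot>\<^bsub>U\<^esub> FArr F' (kappa (FObj G' u)))"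
proof -
  interpret I: quillen_adjunction s W MW V MV F G eta kappa by fact
  interpret J: quillen_adjunction s V MV U MU F' G' eta' kappa' by fact
  interpret adjunction W U "comp_func F' F" "comp_func G G'"
    "\<lambda>x. FArr G (eta' (FObj F x)) \<cdot>\<^bsub>W\<^esub> eta x" "\<lambda>u. kappa' u \<cdot>\<^bsub>U\<^esub> FArr F' (kappa (FObj G' u))"
    using I.adjunction_axioms J.adjunction_axioms by (rule comp_adjunction)
  show ?thesis
    by unfold_locales
      (simp_all add: I.left_cof I.left_acyclic_cof J.left_cof J.left_acyclic_cof)
qed


section \<open>Closed symmetric monoidal categories\<close>

context closed_symmetric_monoidal_category
begin

sublocale T: is_functor "prod_cat V V" V "Tens V"
  by (rule tens_functor)

lemma tens_simps [simp]:
  "x \<in> Obj V \<Longrightarrow> y \<in> Obj V \<Longrightarrow> x \<otimes> y \<in> Obj V"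
  "f \<in> Arr V \<Longrightarrow> g \<in> Arr V \<Longrightarrow> f \<boxtimes> g \<in> Arr V"
  "f \<in> Arr V \<Longrightarrow> g \<in> Arr V \<Longrightarrow> Dom V (f \<boxtimes> g) = Dom V f \<otimes> Dom V g"
  "f \<in> Arr V \<Longrightarrow> g \<in> Arr V \<Longrightarrow> Cod V (f \<boxtimes> g) = Cod V f \<otimes> Cod V g"
  "x \<in> Obj V \<Longrightarrow> y \<in> Obj V \<Longrightarrow> Ide V x \<boxtimes> Ide V y = Ide V (x \<otimes> y)"
  using T.F_simps(1)[of "(x, y)"] T.F_simps(2-4)[of "(f, g)"] T.F_simps(5)[of "(x, y)"] by auto

lemma interchange [simp]:
  "f \<in> Arr V \<Longrightarrow> g \<in> Arr V \<Longrightarrow> f' \<in> Arr V \<Longrightarrow> g' \<in> Arr V \<Longrightarrow> Dom V g = Cod V f \<Longrightarrow> Dom V g' = Cod V f' \<Longrightarrow>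
   (g \<boxtimes> g') \<cdot> (f \<boxtimes> f') = (g \<cdot> f) \<boxtimes> (g' \<cdot> f')"
  using T.F_cmp'[of "(f, f')" "(g, g')"] by simp

lemma interchange_pull [simp]:
  "f \<in> Arr V \<Longrightarrow> g \<in> Arr V \<Longrightarrow> f' \<in> Arr V \<Longrightarrow> g' \<in> Arr V \<Longrightarrow> Dom V g = Cod V f \<Longrightarrow> Dom V g' = Cod V f' \<Longrightarrow>
   h \<in> Arr V \<Longrightarrow> Cod V h = Dom V f \<otimes> Dom V f' \<Longrightarrow>
   (g \<boxtimes> g') \<cdot> (f \<boxtimes> f') \<cdot> h = ((g \<cdot> f) \<boxtimes> (g' \<cdot> f')) \<cdot> h"
  by (subst pull[OF interchange]) simp_all

lemma structure_simps [simp]: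
  "\<one> \<in> Obj V"
  "x \<in> Obj V \<Longrightarrow> LUnit V x \<in> Arr V" "x \<in> Obj V \<Longrightarrow> Dom V (LUnit V x) = \<one> \<otimes> x" "x \<in> Obj V \<Longrightarrow> Cod V (LUnit V x) = x"
  "x \<in> Obj V \<Longrightarrow> RUnit V x \<in> Arr V" "x \<in> Obj V \<Longrightarrow> Dom V (RUnit V x) = x \<otimes> \<one>" "x \<in> Obj V \<Longrightarrow> Cod V (RUnit V x) = x"
  "x \<in> Obj V \<Longrightarrow> is_iso V (LUnit V x)" "x \<in> Obj V \<Longrightarrow> is_iso V (RUnit V x)"
  "x \<in> Obj V \<Longrightarrow> y \<in> Obj V \<Longrightarrow> Symm V x y \<in> Arr V" "x \<in> Obj V \<Longrightarrow> y \<in> Obj V \<Longrightarrow> Dom V (Symm V x y) = x \<otimes> y"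
  "x \<in> Obj V \<Longrightarrow> y \<in> Obj V \<Longrightarrow> Cod V (Symm V x y) = y \<otimes> x"
  "x \<in> Obj V \<Longrightarrow> y \<in> Obj V \<Longrightarrow> IHom V x y \<in> Obj V"
  "x \<in> Obj V \<Longrightarrow> y \<in> Obj V \<Longrightarrow> Eval V x y \<in> Arr V" "x \<in> Obj V \<Longrightarrow> y \<in> Obj V \<Longrightarrow> Dom V (Eval V x y) = IHom V x y \<otimes> x"
  "x \<in> Obj V \<Longrightarrow> y \<in> Obj V \<Longrightarrow> Cod V (Eval V x y) = y"
  using unit_obj lunit_iso runit_iso symm_hom ihom_obj eval_hom by (auto simp: in_Hom)

lemma assoc_simps [simp]:
  assumes "x \<in> Obj V" "y \<in> Obj V" "z \<in> Obj V"
  shows "Assoc V x y z \<in> Arr V" "Dom V (Assoc V x y z) = (x \<otimes> y) \<otimes> z" "Cod V (Assoc V x y z) = x \<otimes> y \<otimes> z"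
    "is_iso V (Assoc V x y z)"
  using assoc_iso[OF assms] by (auto simp: in_Hom)

lemma assoc_nat:
  "f \<in> Arr V \<Longrightarrow> g \<in> Arr V \<Longrightarrow> h \<in> Arr V \<Longrightarrow> Cod V f = x \<Longrightarrow> Cod V g = y \<Longrightarrow> Cod V h = z \<Longrightarrow>
   Assoc V x y z \<cdot> ((f \<boxtimes> g) \<boxtimes> h) = (f \<boxtimes> (g \<boxtimes> h)) \<cdot> Assoc V (Dom V f) (Dom V g) (Dom V h)"
  using assoc_natural[of f "Dom V f" x g "Dom V g" y h "Dom V h" z] by (simp add: in_Hom)

lemma lunit_nat: "f \<in> Arr V \<Longrightarrow> Cod V f = y \<Longrightarrow> LUnit V y \<cdot> (Ide V \<one> \<boxtimes> f) = f \<cdot> LUnit V (Dom V f)"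
  using lunit_natural[of f "Dom V f" y] by (simp add: in_Hom)

lemma runit_nat: "f \<in> Arr V \<Longrightarrow> Cod V f = y \<Longrightarrow> RUnit V y \<cdot> (f \<boxtimes> Ide V \<one>) = f \<cdot> RUnit V (Dom V f)"
  using runit_natural[of f "Dom V f" y] by (simp add: in_Hom)

lemma inv_lunit_nat:
  assumes "f \<in> Arr V" "Cod V f = y"
  shows "inv_arr V (LUnit V y) \<cdot> f = (Ide V \<one> \<boxtimes> f) \<cdot> inv_arr V (LUnit V (Dom V f))"
proof (rule iso_cancel_left[of "LUnit V y"])
  show "LUnit V y \<cdot> inv_arr V (LUnit V y) \<cdot> f = LUnit V y \<cdot> (Ide V \<one> \<boxtimes> f) \<cdot> inv_arr V (LUnit V (Dom V f))"
    using assms pull[OF lunit_nat[OF assms]] by auto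
qed (use assms in auto)

lemma inv_runit_nat:
  assumes "f \<in> Arr V" "Cod V f = y"
  shows "inv_arr V (RUnit V y) \<cdot> f = (f \<boxtimes> Ide V \<one>) \<cdot> inv_arr V (RUnit V (Dom V f))"
proof (rule iso_cancel_left[of "RUnit V y"])
  show "RUnit V y \<cdot> inv_arr V (RUnit V y) \<cdot> f = RUnit V y \<cdot> (f \<boxtimes> Ide V \<one>) \<cdot> inv_arr V (RUnit V (Dom V f))"
    using assms pull[OF runit_nat[OF assms]] by auto
qed (use assms in auto)

lemma tens_iso:
  assumes "is_iso V f" "is_iso V g"
  shows "is_iso V (f \<boxtimes> g)" "inv_arr V (f \<boxtimes> g) = inv_arr V f \<boxtimes> inv_arr V g"
  using is_isoI[of "f \<boxtimes> g" "Dom V f \<otimes> Dom V g" "Cod V f \<otimes> Cod V g" "inv_arr V f \<boxtimes> inv_arr V g"] assms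
  by (simp_all add: in_Hom)

lemma tens_unit_faithful:
  assumes "f \<boxtimes> Ide V \<one> = g \<boxtimes> Ide V \<one>" "f \<in> Arr V" "g \<in> Arr V" "Dom V f = Dom V g" "Cod V f = Cod V g"
  shows "f = g"
proof (rule iso_cancel_right[of "RUnit V (Dom V f)"])
  show "f \<cdot> RUnit V (Dom V f) = g \<cdot> RUnit V (Dom V f)"
    using runit_nat[of f "Cod V f"] runit_nat[of g "Cod V f"] assms by simp
qed (use assms in auto)

lemma unit_tens_faithful:
  assumes "Ide V \<one> \<boxtimes> f = Ide V \<one> \<boxtimes> g" "f \<in> Arr V" "g \<in> Arr V" "Dom V f = Dom V g" "Cod V f = Cod V g"
  shows "f = g"
proof (rule iso_cancel_right[of "LUnit V (Dom V f)"])
  show "f \<cdot> LUnit V (Dom V f) = g \<cdot> LUnit V (Dom V f)"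
    using lunit_nat[of f "Cod V f"] lunit_nat[of g "Cod V f"] assms by simp
qed (use assms in auto)

text \<open>
  Two coherence identities of Kelly. The first holds because it does after tensoring with
  the unit, where it is a consequence of the pentagon and the triangle.
\<close>

lemma runit_tens:
  assumes x: "x \<in> Obj V" and y: "y \<in> Obj V"
  shows "(Ide V x \<boxtimes> RUnit V y) \<cdot> Assoc V x y \<one> = RUnit V (x \<otimes> y)"
proof (rule tens_unit_faithful)
  let ?\<alpha> = "Assoc V x y \<one>"
  have nat: "?\<alpha> \<cdot> (Ide V (x \<otimes> y) \<boxtimes> LUnit V \<one>) = (Ide V x \<boxtimes> (Ide V y \<boxtimes> LUnit V \<one>)) \<cdot> Assoc V x y (\<one> \<otimes> \<one>)"
    using assoc_nat[of "Ide V x" "Ide V y" "LUnit V \<one>" x y \<one>] x y by simp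
  have "?\<alpha> \<cdot> ((((Ide V x \<boxtimes> RUnit V y) \<cdot> ?\<alpha>)) \<boxtimes> Ide V \<one>)
      = (?\<alpha> \<cdot> ((Ide V x \<boxtimes> RUnit V y) \<boxtimes> Ide V \<one>)) \<cdot> (?\<alpha> \<boxtimes> Ide V \<one>)"
    using x y by simp
  also have "\<dots> = (Ide V x \<boxtimes> (RUnit V y \<boxtimes> Ide V \<one>)) \<cdot> Assoc V x (y \<otimes> \<one>) \<one> \<cdot> (?\<alpha> \<boxtimes> Ide V \<one>)"
    using x y by (simp add: assoc_nat del: interchange)
  also have "\<dots> = (Ide V x \<boxtimes> (Ide V y \<boxtimes> LUnit V \<one>))
      \<cdot> ((Ide V x \<boxtimes> Assoc V y \<one> \<one>) \<cdot> Assoc V x (y \<otimes> \<one>) \<one> \<cdot> (?\<alpha> \<boxtimes> Ide V \<one>))"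
    using x y by (simp add: triangle)
  also have "\<dots> = ((Ide V x \<boxtimes> (Ide V y \<boxtimes> LUnit V \<one>)) \<cdot> Assoc V x y (\<one> \<otimes> \<one>)) \<cdot> Assoc V (x \<otimes> y) \<one> \<one>"
    unfolding pentagon[OF x y unit_obj unit_obj] using x y by simp
  also have "\<dots> = ?\<alpha> \<cdot> (Ide V (x \<otimes> y) \<boxtimes> LUnit V \<one>) \<cdot> Assoc V (x \<otimes> y) \<one> \<one>"
    using pull[OF nat] x y by simp
  also have "\<dots> = ?\<alpha> \<cdot> (RUnit V (x \<otimes> y) \<boxtimes> Ide V \<one>)"
    using x y by (simp add: triangle)
  finally have "?\<alpha> \<cdot> (((Ide V x \<boxtimes> RUnit V y) \<cdot> ?\<alpha>) \<boxtimes> Ide V \<one>) = ?\<alpha> \<cdot> (RUnit V (x \<otimes> y) \<boxtimes> Ide V \<one>)" .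
  then show "((Ide V x \<boxtimes> RUnit V y) \<cdot> ?\<alpha>) \<boxtimes> Ide V \<one> = RUnit V (x \<otimes> y) \<boxtimes> Ide V \<one>"
    by (rule iso_cancel_left[rotated]) (use x y in simp_all)
qed (use x y in simp_all)

lemma lunit_unit: "LUnit V \<one> = RUnit V \<one>"
proof (rule unit_tens_faithful)
  have "RUnit V \<one> \<cdot> (RUnit V \<one> \<boxtimes> Ide V \<one>) = RUnit V \<one> \<cdot> RUnit V (\<one> \<otimes> \<one>)"
    using runit_nat[of "RUnit V \<one>" \<one>] by simp
  then have "RUnit V \<one> \<boxtimes> Ide V \<one> = RUnit V (\<one> \<otimes> \<one>)"
    by (rule iso_cancel_left[rotated]) simp_all
  then have "(Ide V \<one> \<boxtimes> LUnit V \<one>) \<cdot> Assoc V \<one> \<one> \<one> = (Ide V \<one> \<boxtimes> RUnit V \<one>) \<cdot> Assoc V \<one> \<one> \<one>"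
    by (simp add: triangle runit_tens)
  then show "Ide V \<one> \<boxtimes> LUnit V \<one> = Ide V \<one> \<boxtimes> RUnit V \<one>"
    by (rule iso_cancel_right[rotated]) simp_all
qed simp_all

lemma curry_props:
  assumes "f \<in> Hom V (a \<otimes> x) y" "a \<in> Obj V" "x \<in> Obj V"
  shows "curry_arr V a x y f \<in> Hom V a (IHom V x y)" "Eval V x y \<cdot> (curry_arr V a x y f \<boxtimes> Ide V x) = f"
proof -
  have y: "y \<in> Obj V" using assms(1) by (auto simp: in_Hom)
  from theI'[OF closed[OF assms(2,3) y assms(1)]]
  show "curry_arr V a x y f \<in> Hom V a (IHom V x y)" "Eval V x y \<cdot> (curry_arr V a x y f \<boxtimes> Ide V x) = f"
    by (simp_all add: curry_arr_def)
qed

lemma ihom_ext: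
  assumes "g \<in> Hom V a (IHom V x y)" "g' \<in> Hom V a (IHom V x y)" "x \<in> Obj V" "y \<in> Obj V"
    and "Eval V x y \<cdot> (g \<boxtimes> Ide V x) = Eval V x y \<cdot> (g' \<boxtimes> Ide V x)"
  shows "g = g'"
proof -
  have a: "a \<in> Obj V" using assms by (auto simp: in_Hom)
  have "Eval V x y \<cdot> (g \<boxtimes> Ide V x) \<in> Hom V (a \<otimes> x) y"
    using assms(1,3,4) by (simp add: in_Hom)
  from closed[OF a assms(3,4) this] show ?thesis using assms(1,2,5) by metis
qed

lemma curry_unique:
  assumes "f \<in> Hom V (a \<otimes> x) y" "a \<in> Obj V" "x \<in> Obj V"
    and "g \<in> Hom V a (IHom V x y)" "Eval V x y \<cdot> (g \<boxtimes> Ide V x) = f"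
  shows "curry_arr V a x y f = g"
proof (rule ihom_ext[where a = a and x = x and y = y])
  show "y \<in> Obj V" using assms(1) by (auto simp: in_Hom)
  show "Eval V x y \<cdot> (curry_arr V a x y f \<boxtimes> Ide V x) = Eval V x y \<cdot> (g \<boxtimes> Ide V x)"
    unfolding assms(5) by (rule curry_props(2)[OF assms(1-3)])
qed (use curry_props[OF assms(1-3)] assms in simp_all)

lemma ihom_arr_props:
  assumes "k \<in> Arr V" "h \<in> Arr V"
  shows "ihom_arr V k h \<in> Hom V (IHom V (Cod V k) (Dom V h)) (IHom V (Dom V k) (Cod V h))"
    and "Eval V (Dom V k) (Cod V h) \<cdot> (ihom_arr V k h \<boxtimes> Ide V (Dom V k))
      = h \<cdot> Eval V (Cod V k) (Dom V h) \<cdot> (Ide V (IHom V (Cod V k) (Dom V h)) \<boxtimes> k)"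
proof -
  let ?f = "h \<cdot> Eval V (Cod V k) (Dom V h) \<cdot> (Ide V (IHom V (Cod V k) (Dom V h)) \<boxtimes> k)"
  have "?f \<in> Hom V (IHom V (Cod V k) (Dom V h) \<otimes> Dom V k) (Cod V h)"
    using assms by (simp add: in_Hom)
  from curry_props[OF this] assms
  show "ihom_arr V k h \<in> Hom V (IHom V (Cod V k) (Dom V h)) (IHom V (Dom V k) (Cod V h))"
    "Eval V (Dom V k) (Cod V h) \<cdot> (ihom_arr V k h \<boxtimes> Ide V (Dom V k)) = ?f"
    by (simp_all add: ihom_arr_def Let_def)
qed

lemma ihom_arr_simps [simp]:
  assumes "k \<in> Arr V" "h \<in> Arr V"
  shows "ihom_arr V k h \<in> Arr V" "Dom V (ihom_arr V k h) = IHom V (Cod V k) (Dom V h)"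
    "Cod V (ihom_arr V k h) = IHom V (Dom V k) (Cod V h)"
  using ihom_arr_props(1)[OF assms] by (auto simp: in_Hom)

lemma eval_ihom_arr:
  "k \<in> Arr V \<Longrightarrow> h \<in> Arr V \<Longrightarrow> Dom V k = x \<Longrightarrow> Cod V h = y \<Longrightarrow>
   Eval V x y \<cdot> (ihom_arr V k h \<boxtimes> Ide V x)
    = h \<cdot> Eval V (Cod V k) (Dom V h) \<cdot> (Ide V (IHom V (Cod V k) (Dom V h)) \<boxtimes> k)"
  using ihom_arr_props(2) by auto

end

definition tensor_func :: "('o, 'm) mon_cat \<Rightarrow> 'o \<Rightarrow> ('o, 'm, 'o, 'm) func" where
  "tensor_func V w = \<lparr>FObj = (\<lambda>a. a \<otimes>\<^bsub>V\<^esub> w), FArr = (\<lambda>f. f \<boxtimes>\<^bsub>V\<^esub> Ide V w)\<rparr>"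

definition ihom_func :: "('o, 'm) mon_cat \<Rightarrow> 'o \<Rightarrow> ('o, 'm, 'o, 'm) func" where
  "ihom_func V w = \<lparr>FObj = IHom V w, FArr = ihom_arr V (Ide V w)\<rparr>"

lemma tensor_func_simps [simp]:
  "FObj (tensor_func V w) a = a \<otimes>\<^bsub>V\<^esub> w" "FArr (tensor_func V w) f = f \<boxtimes>\<^bsub>V\<^esub> Ide V w"
  "FObj (ihom_func V w) a = IHom V w a" "FArr (ihom_func V w) f = ihom_arr V (Ide V w) f"
  by (simp_all add: tensor_func_def ihom_func_def)

definition tensor_unit :: "('o, 'm) mon_cat \<Rightarrow> 'o \<Rightarrow> 'o \<Rightarrow> 'm" where
  "tensor_unit V w a = curry_arr V a w (a \<otimes>\<^bsub>V\<^esub> w) (Ide V (a \<otimes>\<^bsub>V\<^esub> w))"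

lemma (in category) initial_iso:
  assumes "initial_obj C x" "is_iso C f" "Dom C f = x"
  shows "initial_obj C (Cod C f)"
  unfolding initial_obj_def
proof (intro conjI ballI)
  show "Cod C f \<in> Obj C" using assms by simp
  fix y assume "y \<in> Obj C"
  then have ex1: "\<exists>!g. g \<in> Hom C x y" using assms(1) by (simp add: initial_obj_def)
  then obtain g where g: "g \<in> Hom C x y" by blast
  show "\<exists>!g. g \<in> Hom C (Cod C f) y"
  proof (rule ex1I[of _ "g \<cdot> inv_arr C f"])
    show "g \<cdot> inv_arr C f \<in> Hom C (Cod C f) y" using g assms by (simp add: in_Hom)
    fix h assume h: "h \<in> Hom C (Cod C f) y"
    then have "h \<cdot> f \<in> Hom C x y" using assms by (simp add: in_Hom)
    then have "h \<cdot> f = g" using ex1 g by blast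
    then show "h = g \<cdot> inv_arr C f" using h assms by (auto simp: in_Hom)
  qed
qed

context closed_symmetric_monoidal_category
begin

lemma tensor_adjunction:
  assumes w: "w \<in> Obj V"
  shows "adjunction V V (tensor_func V w) (ihom_func V w) (tensor_unit V w) (Eval V w)"
proof -
  interpret F: is_functor V V "tensor_func V w"
    by (rule is_functorI) (simp_all add: category_axioms w in_Hom)
  have unit: "tensor_unit V w a \<in> Hom V a (IHom V w (a \<otimes> w))"
    "Eval V w (a \<otimes> w) \<cdot> (tensor_unit V w a \<boxtimes> Ide V w) = Ide V (a \<otimes> w)" if "a \<in> Obj V" for a
    using curry_props[of "Ide V (a \<otimes> w)" a w "a \<otimes> w"] that w by (simp_all add: tensor_unit_def in_Hom)
  have unit' [simp]: "tensor_unit V w a \<in> Arr V" "Dom V (tensor_unit V w a) = a"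
    "Cod V (tensor_unit V w a) = IHom V w (a \<otimes> w)" if "a \<in> Obj V" for a
    using unit(1)[OF that] by (auto simp: in_Hom)
  have ev: "Eval V w (Cod V h) \<cdot> (ihom_arr V (Ide V w) h \<boxtimes> Ide V w) = h \<cdot> Eval V w (Dom V h)" if "h \<in> Arr V" for h
    using that w by (simp add: eval_ihom_arr)
  interpret G: is_functor V V "ihom_func V w"
  proof (rule is_functorI)
    fix x assume x: "x \<in> Obj V"
    show "FArr (ihom_func V w) (Ide V x) = Ide V (FObj (ihom_func V w) x)"
      by (rule ihom_ext[where a = "IHom V w x" and x = w and y = x])
        (use x w ev[of "Ide V x"] in \<open>simp_all add: in_Hom\<close>)
  next
    fix f g assume fg: "f \<in> Arr V" "g \<in> Arr V" "Dom V g = Cod V f"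
    show "FArr (ihom_func V w) (g \<cdot> f) = FArr (ihom_func V w) g \<cdot> FArr (ihom_func V w) f"
    proof (rule ihom_ext[where a = "IHom V w (Dom V f)" and x = w and y = "Cod V g"])
      have "Eval V w (Cod V g) \<cdot> ((ihom_arr V (Ide V w) g \<cdot> ihom_arr V (Ide V w) f) \<boxtimes> Ide V w)
        = (Eval V w (Cod V g) \<cdot> (ihom_arr V (Ide V w) g \<boxtimes> Ide V w)) \<cdot> (ihom_arr V (Ide V w) f \<boxtimes> Ide V w)"
        using fg w by simp
      also have "\<dots> = g \<cdot> (Eval V w (Cod V f) \<cdot> (ihom_arr V (Ide V w) f \<boxtimes> Ide V w))"
        unfolding ev[OF fg(2)] using fg w by simp
      also have "\<dots> = (g \<cdot> f) \<cdot> Eval V w (Dom V f)"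
        unfolding ev[OF fg(1)] using fg w by simp
      finally show "Eval V w (Cod V g) \<cdot> (FArr (ihom_func V w) (g \<cdot> f) \<boxtimes> Ide V w)
          = Eval V w (Cod V g) \<cdot> ((FArr (ihom_func V w) g \<cdot> FArr (ihom_func V w) f) \<boxtimes> Ide V w)"
        using ev[of "g \<cdot> f"] fg w by simp
    qed (use fg w in \<open>simp_all add: in_Hom\<close>)
  qed (use w in \<open>simp_all add: category_axioms in_Hom\<close>)
  show ?thesis
  proof
    fix f x y assume "f \<in> Hom V x y"
    note f = HomD[OF this]
    have x: "x \<in> Obj V" "y \<in> Obj V" using f by auto
    show "tensor_unit V w y \<cdot> f = FArr (ihom_func V w) (FArr (tensor_func V w) f) \<cdot> tensor_unit V w x"
    proof (rule ihom_ext[where a = x and x = w and y = "y \<otimes> w"])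
      have 1: "Eval V w (y \<otimes> w) \<cdot> ((tensor_unit V w y \<cdot> f) \<boxtimes> Ide V w) = f \<boxtimes> Ide V w"
      proof -
        have "Eval V w (y \<otimes> w) \<cdot> ((tensor_unit V w y \<cdot> f) \<boxtimes> Ide V w)
          = (Eval V w (y \<otimes> w) \<cdot> (tensor_unit V w y \<boxtimes> Ide V w)) \<cdot> (f \<boxtimes> Ide V w)"
          using f x w by simp
        then show ?thesis unfolding unit(2)[OF x(2)] using f x w by simp
      qed
      have "Eval V w (y \<otimes> w) \<cdot> ((ihom_arr V (Ide V w) (f \<boxtimes> Ide V w) \<cdot> tensor_unit V w x) \<boxtimes> Ide V w)
        = (Eval V w (y \<otimes> w) \<cdot> (ihom_arr V (Ide V w) (f \<boxtimes> Ide V w) \<boxtimes> Ide V w)) \<cdot> (tensor_unit V w x \<boxtimes> Ide V w)"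
        using f x w by simp
      also have "\<dots> = (f \<boxtimes> Ide V w) \<cdot> (Eval V w (x \<otimes> w) \<cdot> (tensor_unit V w x \<boxtimes> Ide V w))"
        using ev[of "f \<boxtimes> Ide V w"] f x w by (simp del: assoc) simp
      finally show "Eval V w (y \<otimes> w) \<cdot> ((tensor_unit V w y \<cdot> f) \<boxtimes> Ide V w) =
          Eval V w (y \<otimes> w) \<cdot> ((FArr (ihom_func V w) (FArr (tensor_func V w) f) \<cdot> tensor_unit V w x) \<boxtimes> Ide V w)"
        unfolding 1 unit(2)[OF x(1)] using f x w by simp
    qed (use f x w in \<open>simp_all add: in_Hom\<close>)
  next
    fix v assume v: "v \<in> Obj V"
    show "FArr (ihom_func V w) (Eval V w v) \<cdot> tensor_unit V w (FObj (ihom_func V w) v) = Ide V (FObj (ihom_func V w) v)"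
    proof (rule ihom_ext[where a = "IHom V w v" and x = w and y = v])
      let ?i = "IHom V w v"
      have "Eval V w v \<cdot> ((ihom_arr V (Ide V w) (Eval V w v) \<cdot> tensor_unit V w ?i) \<boxtimes> Ide V w)
        = (Eval V w v \<cdot> (ihom_arr V (Ide V w) (Eval V w v) \<boxtimes> Ide V w)) \<cdot> (tensor_unit V w ?i \<boxtimes> Ide V w)"
        using v w by simp
      also have "\<dots> = Eval V w v \<cdot> (Eval V w (?i \<otimes> w) \<cdot> (tensor_unit V w ?i \<boxtimes> Ide V w))"
        using ev[of "Eval V w v"] v w by (simp del: assoc) simp
      also have "\<dots> = Eval V w v"
        using unit(2)[of ?i] v w by simp
      finally show "Eval V w v \<cdot> ((FArr (ihom_func V w) (Eval V w v) \<cdot> tensor_unit V w (FObj (ihom_func V w) v)) \<boxtimes> Ide V w) =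
          Eval V w v \<cdot> (Ide V (FObj (ihom_func V w) v) \<boxtimes> Ide V w)"
        using v w by simp
    qed (use v w in \<open>simp_all add: in_Hom\<close>)
  next
    fix u v h assume "h \<in> Hom V u v"
    note h = HomD[OF this]
    show "Eval V w v \<cdot> FArr (tensor_func V w) (FArr (ihom_func V w) h) = h \<cdot> Eval V w u"
      using ev[OF h(1)] h by simp
  qed (use unit w in \<open>simp_all add: in_Hom\<close>)
qed

end

text \<open>
  In the pushout-product axiom for \<open>i : a \<rightarrow> b\<close> and \<open>\<emptyset> \<rightarrow> w\<close> the pushout is \<open>a \<otimes> w\<close>, because tensoring
  with a fixed object preserves initial objects on either side.
\<close>

lemma (in symmetric_monoidal_model_category) tensor_quillen_adjunction:
  assumes "cofibrant V M w"
  shows "quillen_adjunction s V M V M (tensor_func V w) (ihom_func V w) (tensor_unit V w) (Eval V w)"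
proof -
  obtain n f where n: "initial_obj V n" and f: "f \<in> Hom V n w" "f \<in> Cof M"
    using assms by (auto simp: cofibrant_def)
  note f' = HomD[OF f(1)]
  have o: "n \<in> Obj V" "w \<in> Obj V" using f' by auto
  interpret adjunction V V "tensor_func V w" "ihom_func V w" "tensor_unit V w" "Eval V w"
    using o(2) by (rule tensor_adjunction)
  have initial: "initial_obj V (a \<otimes>\<^bsub>V\<^esub> n)" if a: "a \<in> Obj V" for a
  proof -
    interpret a: adjunction V V "tensor_func V a" "ihom_func V a" "tensor_unit V a" "Eval V a"
      using a by (rule tensor_adjunction)
    have "is_iso V (Symm V n a)"
      by (rule is_isoI(1)[of _ "n \<otimes>\<^bsub>V\<^esub> a" "a \<otimes>\<^bsub>V\<^esub> n" "Symm V a n"])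
        (use a o symm_inverse in \<open>simp_all add: in_Hom\<close>)
    then show ?thesis using initial_iso[of "n \<otimes>\<^bsub>V\<^esub> a" "Symm V n a"] a.left_initial[OF n] a o by simp
  qed
  have main: "i \<boxtimes>\<^bsub>V\<^esub> Ide V w \<in> Cof M \<and> (i \<in> Weq M \<longrightarrow> i \<boxtimes>\<^bsub>V\<^esub> Ide V w \<in> Weq M)" if i: "i \<in> Cof M" for i
  proof -
    let ?a = "Dom V i" and ?b = "Cod V i"
    have ia: "i \<in> Arr V" using i by simp
    have ini: "initial_obj V (?a \<otimes>\<^bsub>V\<^esub> n)" "initial_obj V (?b \<otimes>\<^bsub>V\<^esub> n)" using ia initial by auto
    have uniq: "g = h" if "g \<in> Hom V x y" "h \<in> Hom V x y" "initial_obj V x" for g h x y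
    proof -
      have "y \<in> Obj V" using that by (auto simp: in_Hom)
      then show ?thesis using that by (auto simp: initial_obj_def)
    qed
    have "?a \<otimes>\<^bsub>V\<^esub> w \<in> Obj V" using ia o by simp
    then obtain q where q: "q \<in> Hom V (?b \<otimes>\<^bsub>V\<^esub> n) (?a \<otimes>\<^bsub>V\<^esub> w)"
      using ini(2) unfolding initial_obj_def by blast
    note q' = HomD[OF q]
    let ?f = "Ide V ?a \<boxtimes>\<^bsub>V\<^esub> f" and ?g = "i \<boxtimes>\<^bsub>V\<^esub> Ide V n"
    have "?f = q \<cdot>\<^bsub>V\<^esub> ?g"
      by (rule uniq[OF _ _ ini(1)]) (use ia f' o q' in \<open>simp_all add: in_Hom\<close>)
    have po: "is_pushout V ?f ?g (?a \<otimes>\<^bsub>V\<^esub> w) (Ide V (?a \<otimes>\<^bsub>V\<^esub> w)) q"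
      unfolding is_pushout_def
    proof (intro conjI allI impI)
      show "Ide V (?a \<otimes>\<^bsub>V\<^esub> w) \<cdot>\<^bsub>V\<^esub> ?f = q \<cdot>\<^bsub>V\<^esub> ?g"
        using \<open>?f = q \<cdot>\<^bsub>V\<^esub> ?g\<close> ia f' o q' by simp
      fix X r t assume r: "r \<in> Hom V (Cod V ?f) X" and t: "t \<in> Hom V (Cod V ?g) X"
      have "r \<cdot>\<^bsub>V\<^esub> q = t"
        by (rule uniq[OF _ _ ini(2)]) (use ia f' o q' HomD[OF r] HomD[OF t] in \<open>simp_all add: in_Hom\<close>)
      moreover have "h \<cdot>\<^bsub>V\<^esub> Ide V (?a \<otimes>\<^bsub>V\<^esub> w) = h" if "h \<in> Hom V (?a \<otimes>\<^bsub>V\<^esub> w) X" for h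
        using that by (simp add: in_Hom)
      moreover have "r \<in> Hom V (?a \<otimes>\<^bsub>V\<^esub> w) X"
        using r ia f' o by simp
      ultimately show "\<exists>!h. h \<in> Hom V (?a \<otimes>\<^bsub>V\<^esub> w) X \<and> h \<cdot>\<^bsub>V\<^esub> Ide V (?a \<otimes>\<^bsub>V\<^esub> w) = r \<and> h \<cdot>\<^bsub>V\<^esub> q = t"
        by (intro ex1I[of _ r]) (simp, metis)
    qed (use ia f' o q in \<open>simp_all add: in_Hom\<close>)
    have "(i \<boxtimes>\<^bsub>V\<^esub> Ide V w) \<cdot>\<^bsub>V\<^esub> q = Ide V ?b \<boxtimes>\<^bsub>V\<^esub> f"
      by (rule uniq[OF _ _ ini(2)]) (use ia f' o q' in \<open>simp_all add: in_Hom\<close>)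
    then show ?thesis
      using pushout_product[unfolded pushout_product_axiom_def, rule_format, of i ?a ?b f n w "?a \<otimes>\<^bsub>V\<^esub> w"
          "Ide V (?a \<otimes>\<^bsub>V\<^esub> w)" q "i \<boxtimes>\<^bsub>V\<^esub> Ide V w"] po i f f' ia o by (simp add: in_Hom)
  qed
  show ?thesis
    by unfold_locales (use main in simp_all)
qed


section \<open>Lax monoidal right adjoints and the comparison of internal homs\<close>

text \<open>
  A map out of the unit object is an element, and the elements of an internal hom are the maps.
\<close>

lemma (in closed_symmetric_monoidal_category) bij_element_map:
  assumes x: "x \<in> Obj V" and y: "y \<in> Obj V"
  shows "bij_betw (\<lambda>f. Eval V x y \<cdot> (f \<boxtimes> Ide V x) \<cdot> inv_arr V (LUnit V x)) (Hom V \<one> (IHom V x y)) (Hom V x y)"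
proof (rule bij_betw_byWitness[where f' = "\<lambda>g. curry_arr V \<one> x y (g \<cdot> LUnit V x)"])
  show "\<forall>f\<in>Hom V \<one> (IHom V x y). curry_arr V \<one> x y ((Eval V x y \<cdot> (f \<boxtimes> Ide V x) \<cdot> inv_arr V (LUnit V x)) \<cdot> LUnit V x) = f"
  proof
    fix f assume f: "f \<in> Hom V \<one> (IHom V x y)"
    show "curry_arr V \<one> x y ((Eval V x y \<cdot> (f \<boxtimes> Ide V x) \<cdot> inv_arr V (LUnit V x)) \<cdot> LUnit V x) = f"
      by (rule curry_unique) (use HomD[OF f] x y in \<open>simp_all add: in_Hom\<close>)
  qed
  have *: "curry_arr V \<one> x y (g \<cdot> LUnit V x) \<in> Hom V \<one> (IHom V x y)"
    "Eval V x y \<cdot> (curry_arr V \<one> x y (g \<cdot> LUnit V x) \<boxtimes> Ide V x) = g \<cdot> LUnit V x" if g: "g \<in> Hom V x y" for g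
    using curry_props[of "g \<cdot> LUnit V x" \<one> x y] HomD[OF g] x y by (simp_all add: in_Hom)
  show "\<forall>g\<in>Hom V x y. Eval V x y \<cdot> (curry_arr V \<one> x y (g \<cdot> LUnit V x) \<boxtimes> Ide V x) \<cdot> inv_arr V (LUnit V x) = g"
  proof
    fix g assume g: "g \<in> Hom V x y"
    let ?c = "curry_arr V \<one> x y (g \<cdot> LUnit V x)"
    have "Eval V x y \<cdot> (?c \<boxtimes> Ide V x) \<cdot> inv_arr V (LUnit V x) = (Eval V x y \<cdot> (?c \<boxtimes> Ide V x)) \<cdot> inv_arr V (LUnit V x)"
      using HomD[OF *(1)[OF g]] x y by simp
    also have "\<dots> = g" unfolding *(2)[OF g] using HomD[OF g] x by simp
    finally show "Eval V x y \<cdot> (?c \<boxtimes> Ide V x) \<cdot> inv_arr V (LUnit V x) = g" .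
  qed
  show "(\<lambda>g. curry_arr V \<one> x y (g \<cdot> LUnit V x)) ` Hom V x y \<subseteq> Hom V \<one> (IHom V x y)"
    using * by auto
  show "(\<lambda>f. Eval V x y \<cdot> (f \<boxtimes> Ide V x) \<cdot> inv_arr V (LUnit V x)) ` Hom V \<one> (IHom V x y) \<subseteq> Hom V x y"
    using x y by (auto simp: in_Hom)
qed

lemma (in adjunction) bij_transpose:
  assumes a: "a \<in> Obj W" and v: "v \<in> Obj V"
  shows "bij_betw (\<lambda>t. FArr G t \<cdot>\<^bsub>W\<^esub> eta a) (Hom V (FObj F a) v) (Hom W a (FObj G v))"
  by (rule bij_betw_byWitness[where f' = "\<lambda>g. kappa v \<cdot>\<^bsub>V\<^esub> FArr F g"])
    (use transpose_left transpose_right a v in \<open>auto simp: in_Hom simp del: F.F_cmp' G.F_cmp'\<close>)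

locale lax_adjunction =
  W: closed_symmetric_monoidal_category W + V: closed_symmetric_monoidal_category V +
  adjunction W V "LeftF A" "RightF A" "AUnit A" "ACounit A" +
  lax_monoidal_functor V W "RightF A" "LaxMult A" "LaxUnit A"
  for W :: "('w, 'n) mon_cat" and V :: "('v, 'm) mon_cat" and A :: "('w, 'n, 'v, 'm) lax_adj"
begin

abbreviation "Fo \<equiv> FObj (LeftF A)"
abbreviation "Fa \<equiv> FArr (LeftF A)"
abbreviation "Go \<equiv> FObj (RightF A)"
abbreviation "Ga \<equiv> FArr (RightF A)"
abbreviation "\<mu> \<equiv> LaxMult A"
abbreviation "\<iota> \<equiv> LaxUnit A"
abbreviation "\<eta> \<equiv> AUnit A"
abbreviation "\<kappa> \<equiv> ACounit A"
abbreviation "\<delta> \<equiv> oplax_mult W V A"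
abbreviation "\<epsilon> \<equiv> oplax_unit V A"
abbreviation "\<theta> \<equiv> theta W V A"

lemma lax_simps [simp]:
  "x \<in> Obj V \<Longrightarrow> y \<in> Obj V \<Longrightarrow> \<mu> x y \<in> Arr W" "x \<in> Obj V \<Longrightarrow> y \<in> Obj V \<Longrightarrow> Dom W (\<mu> x y) = Go x \<otimes>\<^bsub>W\<^esub> Go y"
  "x \<in> Obj V \<Longrightarrow> y \<in> Obj V \<Longrightarrow> Cod W (\<mu> x y) = Go (x \<otimes>\<^bsub>V\<^esub> y)"
  "\<iota> \<in> Arr W" "Dom W \<iota> = Unit W" "Cod W \<iota> = Go (Unit V)"
  using mu_hom[of x y] iota_hom by (auto simp: in_Hom)

lemma mu_nat:
  "f \<in> Arr V \<Longrightarrow> g \<in> Arr V \<Longrightarrow> Cod V f = x \<Longrightarrow> Cod V g = y \<Longrightarrow>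
   \<mu> x y \<cdot>\<^bsub>W\<^esub> (Ga f \<boxtimes>\<^bsub>W\<^esub> Ga g) = Ga (f \<boxtimes>\<^bsub>V\<^esub> g) \<cdot>\<^bsub>W\<^esub> \<mu> (Dom V f) (Dom V g)"
  using mu_natural[of f "Dom V f" x g "Dom V g" y] by (simp add: in_Hom)

lemma oplax_mult_simps [simp]:
  assumes "x \<in> Obj W" "y \<in> Obj W"
  shows "\<delta> x y \<in> Arr V" "Dom V (\<delta> x y) = Fo (x \<otimes>\<^bsub>W\<^esub> y)" "Cod V (\<delta> x y) = Fo x \<otimes>\<^bsub>V\<^esub> Fo y"
  using assms by (simp_all add: oplax_mult_def)

lemma oplax_unit_simps [simp]:
  "\<epsilon> \<in> Arr V" "Dom V \<epsilon> = Fo (Unit W)" "Cod V \<epsilon> = Unit V"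
  by (simp_all add: oplax_unit_def)

lemma transpose_oplax_mult:
  assumes "x \<in> Obj W" "y \<in> Obj W"
  shows "Ga (\<delta> x y) \<cdot>\<^bsub>W\<^esub> \<eta> (x \<otimes>\<^bsub>W\<^esub> y) = \<mu> (Fo x) (Fo y) \<cdot>\<^bsub>W\<^esub> (\<eta> x \<boxtimes>\<^bsub>W\<^esub> \<eta> y)"
  unfolding oplax_mult_def by (rule transpose_right) (use assms in \<open>simp_all add: in_Hom\<close>)

lemma transpose_oplax_unit: "Ga \<epsilon> \<cdot>\<^bsub>W\<^esub> \<eta> (Unit W) = \<iota>"
  unfolding oplax_unit_def by (rule transpose_right) (simp_all add: in_Hom)

lemma oplax_mult_nat:
  assumes f: "f \<in> Hom W x y" and w: "w \<in> Obj W"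
  shows "\<delta> y w \<cdot>\<^bsub>V\<^esub> Fa (f \<boxtimes>\<^bsub>W\<^esub> Ide W w) = (Fa f \<boxtimes>\<^bsub>V\<^esub> Ide V (Fo w)) \<cdot>\<^bsub>V\<^esub> \<delta> x w"
proof (rule transpose_inj)
  note f' = HomD[OF f]
  have x: "x \<in> Obj W" "y \<in> Obj W" using f' by auto
  have "Ga (\<delta> y w \<cdot>\<^bsub>V\<^esub> Fa (f \<boxtimes>\<^bsub>W\<^esub> Ide W w)) \<cdot>\<^bsub>W\<^esub> \<eta> (x \<otimes>\<^bsub>W\<^esub> w)
    = Ga (\<delta> y w) \<cdot>\<^bsub>W\<^esub> \<eta> (y \<otimes>\<^bsub>W\<^esub> w) \<cdot>\<^bsub>W\<^esub> (f \<boxtimes>\<^bsub>W\<^esub> Ide W w)"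
    using f' x w by (simp add: unit_nat)
  also have "\<dots> = \<mu> (Fo y) (Fo w) \<cdot>\<^bsub>W\<^esub> ((\<eta> y \<cdot>\<^bsub>W\<^esub> f) \<boxtimes>\<^bsub>W\<^esub> \<eta> w)"
    using f' x w by (simp add: W.pull[OF transpose_oplax_mult[OF x(2) w]])
  also have "\<dots> = (\<mu> (Fo y) (Fo w) \<cdot>\<^bsub>W\<^esub> (Ga (Fa f) \<boxtimes>\<^bsub>W\<^esub> Ga (Ide V (Fo w)))) \<cdot>\<^bsub>W\<^esub> (\<eta> x \<boxtimes>\<^bsub>W\<^esub> \<eta> w)"
    using f' x w by (simp add: unit_nat)
  also have "\<dots> = Ga (Fa f \<boxtimes>\<^bsub>V\<^esub> Ide V (Fo w)) \<cdot>\<^bsub>W\<^esub> \<mu> (Fo x) (Fo w) \<cdot>\<^bsub>W\<^esub> (\<eta> x \<boxtimes>\<^bsub>W\<^esub> \<eta> w)"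
    using f' x w by (subst mu_nat) simp_all
  also have "\<dots> = Ga ((Fa f \<boxtimes>\<^bsub>V\<^esub> Ide V (Fo w)) \<cdot>\<^bsub>V\<^esub> \<delta> x w) \<cdot>\<^bsub>W\<^esub> \<eta> (x \<otimes>\<^bsub>W\<^esub> w)"
    unfolding transpose_oplax_mult[OF x(1) w, symmetric] using f' x w by simp
  finally show "Ga (\<delta> y w \<cdot>\<^bsub>V\<^esub> Fa (f \<boxtimes>\<^bsub>W\<^esub> Ide W w)) \<cdot>\<^bsub>W\<^esub> \<eta> (x \<otimes>\<^bsub>W\<^esub> w)
    = Ga ((Fa f \<boxtimes>\<^bsub>V\<^esub> Ide V (Fo w)) \<cdot>\<^bsub>V\<^esub> \<delta> x w) \<cdot>\<^bsub>W\<^esub> \<eta> (x \<otimes>\<^bsub>W\<^esub> w)" .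
qed (use HomD[OF f] w in \<open>auto simp: in_Hom\<close>)

text \<open>\<open>\<theta> w v\<close> is the curried adjunct of this map.\<close>

definition theta_adjunct :: "'w \<Rightarrow> 'v \<Rightarrow> 'm" where
  "theta_adjunct w v = Eval V (Fo w) v \<cdot>\<^bsub>V\<^esub> (\<kappa> (IHom V (Fo w) v) \<boxtimes>\<^bsub>V\<^esub> Ide V (Fo w))
     \<cdot>\<^bsub>V\<^esub> \<delta> (Go (IHom V (Fo w) v)) w"

lemma theta_adjunct_simps [simp]:
  assumes "w \<in> Obj W" "v \<in> Obj V"
  shows "theta_adjunct w v \<in> Arr V" "Dom V (theta_adjunct w v) = Fo (Go (IHom V (Fo w) v) \<otimes>\<^bsub>W\<^esub> w)"
    "Cod V (theta_adjunct w v) = v"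
  using assms by (simp_all add: theta_adjunct_def)

lemma theta_curry:
  assumes "w \<in> Obj W" "v \<in> Obj V"
  shows "\<theta> w v \<in> Hom W (Go (IHom V (Fo w) v)) (IHom W w (Go v))"
    and "Eval W w (Go v) \<cdot>\<^bsub>W\<^esub> (\<theta> w v \<boxtimes>\<^bsub>W\<^esub> Ide W w)
      = Ga (theta_adjunct w v) \<cdot>\<^bsub>W\<^esub> \<eta> (Go (IHom V (Fo w) v) \<otimes>\<^bsub>W\<^esub> w)"
  using W.curry_props[of "Ga (theta_adjunct w v) \<cdot>\<^bsub>W\<^esub> \<eta> (Go (IHom V (Fo w) v) \<otimes>\<^bsub>W\<^esub> w)"
      "Go (IHom V (Fo w) v)" w "Go v"] assms
  by (simp_all add: theta_def Let_def adjunct_def theta_adjunct_def[symmetric] in_Hom)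

lemma theta_simps [simp]:
  assumes "w \<in> Obj W" "v \<in> Obj V"
  shows "\<theta> w v \<in> Arr W" "Dom W (\<theta> w v) = Go (IHom V (Fo w) v)" "Cod W (\<theta> w v) = IHom W w (Go v)"
  using theta_curry(1)[OF assms] by (auto simp: in_Hom)

text \<open>
  In terms of the lax structure of the right adjoint, \<open>\<theta>\<close> evaluates through \<open>\<mu>\<close>. The counit in its
  definition cancels against the unit in the oplax structure; naturality, the
  compatibility with units and the effect on elements are derived from this formula.
\<close>

lemma eval_theta:
  assumes w: "w \<in> Obj W" and v: "v \<in> Obj V"
  shows "Eval W w (Go v) \<cdot>\<^bsub>W\<^esub> (\<theta> w v \<boxtimes>\<^bsub>W\<^esub> Ide W w)
    = Ga (Eval V (Fo w) v) \<cdot>\<^bsub>W\<^esub> \<mu> (IHom V (Fo w) v) (Fo w) \<cdot>\<^bsub>W\<^esub> (Ide W (Go (IHom V (Fo w) v)) \<boxtimes>\<^bsub>W\<^esub> \<eta> w)"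
proof -
  let ?i = "IHom V (Fo w) v"
  have "Ga (theta_adjunct w v) \<cdot>\<^bsub>W\<^esub> \<eta> (Go ?i \<otimes>\<^bsub>W\<^esub> w)
    = Ga (Eval V (Fo w) v) \<cdot>\<^bsub>W\<^esub> Ga (\<kappa> ?i \<boxtimes>\<^bsub>V\<^esub> Ide V (Fo w)) \<cdot>\<^bsub>W\<^esub> (Ga (\<delta> (Go ?i) w) \<cdot>\<^bsub>W\<^esub> \<eta> (Go ?i \<otimes>\<^bsub>W\<^esub> w))"
    using w v by (simp add: theta_adjunct_def)
  also have "\<dots> = Ga (Eval V (Fo w) v) \<cdot>\<^bsub>W\<^esub> (Ga (\<kappa> ?i \<boxtimes>\<^bsub>V\<^esub> Ide V (Fo w)) \<cdot>\<^bsub>W\<^esub> \<mu> (Fo (Go ?i)) (Fo w))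
      \<cdot>\<^bsub>W\<^esub> (\<eta> (Go ?i) \<boxtimes>\<^bsub>W\<^esub> \<eta> w)"
    using w v by (simp add: transpose_oplax_mult)
  also have "Ga (\<kappa> ?i \<boxtimes>\<^bsub>V\<^esub> Ide V (Fo w)) \<cdot>\<^bsub>W\<^esub> \<mu> (Fo (Go ?i)) (Fo w)
      = \<mu> ?i (Fo w) \<cdot>\<^bsub>W\<^esub> (Ga (\<kappa> ?i) \<boxtimes>\<^bsub>W\<^esub> Ga (Ide V (Fo w)))"
    using w v by (subst mu_nat) simp_all
  also have "Ga (Eval V (Fo w) v) \<cdot>\<^bsub>W\<^esub> (\<mu> ?i (Fo w) \<cdot>\<^bsub>W\<^esub> (Ga (\<kappa> ?i) \<boxtimes>\<^bsub>W\<^esub> Ga (Ide V (Fo w)))) \<cdot>\<^bsub>W\<^esub> (\<eta> (Go ?i) \<boxtimes>\<^bsub>W\<^esub> \<eta> w)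
    = Ga (Eval V (Fo w) v) \<cdot>\<^bsub>W\<^esub> \<mu> ?i (Fo w) \<cdot>\<^bsub>W\<^esub> (Ide W (Go ?i) \<boxtimes>\<^bsub>W\<^esub> \<eta> w)"
    using w v by (simp add: triangle_right)
  finally show ?thesis unfolding theta_curry(2)[OF w v] .
qed

lemma eval_theta_pre:
  assumes w: "w \<in> Obj W" and v: "v \<in> Obj V" and g: "g \<in> Arr V" "Cod V g = IHom V (Fo w) v"
  shows "Eval W w (Go v) \<cdot>\<^bsub>W\<^esub> ((\<theta> w v \<cdot>\<^bsub>W\<^esub> Ga g) \<boxtimes>\<^bsub>W\<^esub> Ide W w)
    = Ga (Eval V (Fo w) v \<cdot>\<^bsub>V\<^esub> (g \<boxtimes>\<^bsub>V\<^esub> Ide V (Fo w))) \<cdot>\<^bsub>W\<^esub> \<mu> (Dom V g) (Fo w) \<cdot>\<^bsub>W\<^esub> (Ide W (Go (Dom V g)) \<boxtimes>\<^bsub>W\<^esub> \<eta> w)"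
proof -
  have x: "Dom V g \<in> Obj V" using g by simp
  have "Eval W w (Go v) \<cdot>\<^bsub>W\<^esub> ((\<theta> w v \<cdot>\<^bsub>W\<^esub> Ga g) \<boxtimes>\<^bsub>W\<^esub> Ide W w)
    = (Eval W w (Go v) \<cdot>\<^bsub>W\<^esub> (\<theta> w v \<boxtimes>\<^bsub>W\<^esub> Ide W w)) \<cdot>\<^bsub>W\<^esub> (Ga g \<boxtimes>\<^bsub>W\<^esub> Ide W w)"
    using w v g x by simp
  also have "\<dots> = Ga (Eval V (Fo w) v) \<cdot>\<^bsub>W\<^esub> (\<mu> (IHom V (Fo w) v) (Fo w) \<cdot>\<^bsub>W\<^esub> (Ga g \<boxtimes>\<^bsub>W\<^esub> Ga (Ide V (Fo w))))
      \<cdot>\<^bsub>W\<^esub> (Ide W (Go (Dom V g)) \<boxtimes>\<^bsub>W\<^esub> \<eta> w)"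
    unfolding eval_theta[OF w v] using w v g x by simp
  also have "\<mu> (IHom V (Fo w) v) (Fo w) \<cdot>\<^bsub>W\<^esub> (Ga g \<boxtimes>\<^bsub>W\<^esub> Ga (Ide V (Fo w)))
      = Ga (g \<boxtimes>\<^bsub>V\<^esub> Ide V (Fo w)) \<cdot>\<^bsub>W\<^esub> \<mu> (Dom V g) (Fo w)"
    using w g by (subst mu_nat) simp_all
  finally show ?thesis using w v g x by simp
qed

lemma theta_nat:
  assumes k: "k \<in> Hom W w w'" and h: "h \<in> Hom V z z'"
  shows "\<theta> w z' \<cdot>\<^bsub>W\<^esub> Ga (ihom_arr V (Fa k) h) = ihom_arr W k (Ga h) \<cdot>\<^bsub>W\<^esub> \<theta> w' z"
proof (rule W.ihom_ext)
  note k' = HomD[OF k] and h' = HomD[OF h]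
  have o: "w \<in> Obj W" "w' \<in> Obj W" "z \<in> Obj V" "z' \<in> Obj V" using k' h' by auto
  let ?i = "IHom V (Fo w') z"
  have "Eval W w (Go z') \<cdot>\<^bsub>W\<^esub> ((\<theta> w z' \<cdot>\<^bsub>W\<^esub> Ga (ihom_arr V (Fa k) h)) \<boxtimes>\<^bsub>W\<^esub> Ide W w)
    = Ga (h \<cdot>\<^bsub>V\<^esub> Eval V (Fo w') z \<cdot>\<^bsub>V\<^esub> (Ide V ?i \<boxtimes>\<^bsub>V\<^esub> Fa k)) \<cdot>\<^bsub>W\<^esub> \<mu> ?i (Fo w) \<cdot>\<^bsub>W\<^esub> (Ide W (Go ?i) \<boxtimes>\<^bsub>W\<^esub> \<eta> w)"
    using eval_theta_pre[OF o(1,4), of "ihom_arr V (Fa k) h"] V.eval_ihom_arr[of "Fa k" h "Fo w" z'] k' h' by simp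
  also have "\<dots> = Ga h \<cdot>\<^bsub>W\<^esub> Ga (Eval V (Fo w') z) \<cdot>\<^bsub>W\<^esub>
      (Ga (Ide V ?i \<boxtimes>\<^bsub>V\<^esub> Fa k) \<cdot>\<^bsub>W\<^esub> \<mu> ?i (Fo w)) \<cdot>\<^bsub>W\<^esub> (Ide W (Go ?i) \<boxtimes>\<^bsub>W\<^esub> \<eta> w)"
    using k' h' o by simp
  also have "Ga (Ide V ?i \<boxtimes>\<^bsub>V\<^esub> Fa k) \<cdot>\<^bsub>W\<^esub> \<mu> ?i (Fo w) = \<mu> ?i (Fo w') \<cdot>\<^bsub>W\<^esub> (Ga (Ide V ?i) \<boxtimes>\<^bsub>W\<^esub> Ga (Fa k))"
    using k' o by (subst mu_nat) simp_all
  also have "Ga h \<cdot>\<^bsub>W\<^esub> Ga (Eval V (Fo w') z) \<cdot>\<^bsub>W\<^esub>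
      (\<mu> ?i (Fo w') \<cdot>\<^bsub>W\<^esub> (Ga (Ide V ?i) \<boxtimes>\<^bsub>W\<^esub> Ga (Fa k))) \<cdot>\<^bsub>W\<^esub> (Ide W (Go ?i) \<boxtimes>\<^bsub>W\<^esub> \<eta> w)
    = Ga h \<cdot>\<^bsub>W\<^esub> (Ga (Eval V (Fo w') z) \<cdot>\<^bsub>W\<^esub> \<mu> ?i (Fo w') \<cdot>\<^bsub>W\<^esub> (Ide W (Go ?i) \<boxtimes>\<^bsub>W\<^esub> \<eta> w'))
      \<cdot>\<^bsub>W\<^esub> (Ide W (Go ?i) \<boxtimes>\<^bsub>W\<^esub> k)"
    using k' h' o by (simp add: unit_nat)
  also have "\<dots> = Ga h \<cdot>\<^bsub>W\<^esub> Eval W w' (Go z) \<cdot>\<^bsub>W\<^esub> (\<theta> w' z \<boxtimes>\<^bsub>W\<^esub> k)"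
    unfolding eval_theta[OF o(2,3), symmetric] using k' h' o by simp
  also have "\<dots> = (Ga h \<cdot>\<^bsub>W\<^esub> Eval W w' (Go z) \<cdot>\<^bsub>W\<^esub> (Ide W (IHom W w' (Go z)) \<boxtimes>\<^bsub>W\<^esub> k)) \<cdot>\<^bsub>W\<^esub> (\<theta> w' z \<boxtimes>\<^bsub>W\<^esub> Ide W w)"
    using k' h' o by simp
  also have "\<dots> = (Eval W w (Go z') \<cdot>\<^bsub>W\<^esub> (ihom_arr W k (Ga h) \<boxtimes>\<^bsub>W\<^esub> Ide W w)) \<cdot>\<^bsub>W\<^esub> (\<theta> w' z \<boxtimes>\<^bsub>W\<^esub> Ide W w)"
    using W.eval_ihom_arr[of k "Ga h" w "Go z'"] k' h' o by (simp del: W.assoc)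
  also have "\<dots> = Eval W w (Go z') \<cdot>\<^bsub>W\<^esub> ((ihom_arr W k (Ga h) \<cdot>\<^bsub>W\<^esub> \<theta> w' z) \<boxtimes>\<^bsub>W\<^esub> Ide W w)"
    using k' h' o by simp
  finally show "Eval W w (Go z') \<cdot>\<^bsub>W\<^esub> ((\<theta> w z' \<cdot>\<^bsub>W\<^esub> Ga (ihom_arr V (Fa k) h)) \<boxtimes>\<^bsub>W\<^esub> Ide W w)
    = Eval W w (Go z') \<cdot>\<^bsub>W\<^esub> ((ihom_arr W k (Ga h) \<cdot>\<^bsub>W\<^esub> \<theta> w' z) \<boxtimes>\<^bsub>W\<^esub> Ide W w)" .
qed (use HomD[OF k] HomD[OF h] in \<open>auto simp: in_Hom\<close>)

text \<open>
  By \<open>eval_theta\<close> and \<open>transpose_oplax_unit\<close> this reduces to the right unit law of the lax functor \<open>G\<close>.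
\<close>

lemma theta_unit:
  assumes d: "d \<in> Obj V"
  shows "\<theta> (Unit W) d \<cdot>\<^bsub>W\<^esub> Ga (ihom_arr V \<epsilon> (Ide V d) \<cdot>\<^bsub>V\<^esub> curry_arr V d (Unit V) d (RUnit V d))
    = curry_arr W (Go d) (Unit W) (Go d) (RUnit W (Go d))"
proof (rule W.curry_unique[symmetric])
  let ?c = "curry_arr V d (Unit V) d (RUnit V d)" and ?F1 = "Fo (Unit W)"
  have c: "?c \<in> Hom V d (IHom V (Unit V) d)" "Eval V (Unit V) d \<cdot>\<^bsub>V\<^esub> (?c \<boxtimes>\<^bsub>V\<^esub> Ide V (Unit V)) = RUnit V d"
    using V.curry_props[of "RUnit V d" d "Unit V" d] d by (simp_all add: in_Hom)
  note c' = HomD[OF c(1)]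
  let ?g = "ihom_arr V \<epsilon> (Ide V d) \<cdot>\<^bsub>V\<^esub> ?c"
  have g: "?g \<in> Arr V" "Dom V ?g = d" "Cod V ?g = IHom V ?F1 d"
    using c' d by simp_all
  have "Eval V ?F1 d \<cdot>\<^bsub>V\<^esub> (?g \<boxtimes>\<^bsub>V\<^esub> Ide V ?F1)
    = (Eval V ?F1 d \<cdot>\<^bsub>V\<^esub> (ihom_arr V \<epsilon> (Ide V d) \<boxtimes>\<^bsub>V\<^esub> Ide V ?F1)) \<cdot>\<^bsub>V\<^esub> (?c \<boxtimes>\<^bsub>V\<^esub> Ide V ?F1)"
    using c' d by simp
  also have "\<dots> = (Eval V (Unit V) d \<cdot>\<^bsub>V\<^esub> (?c \<boxtimes>\<^bsub>V\<^esub> Ide V (Unit V))) \<cdot>\<^bsub>V\<^esub> (Ide V d \<boxtimes>\<^bsub>V\<^esub> \<epsilon>)"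
    using V.eval_ihom_arr[of \<epsilon> "Ide V d" ?F1 d] c' d by simp
  finally have ev: "Eval V ?F1 d \<cdot>\<^bsub>V\<^esub> (?g \<boxtimes>\<^bsub>V\<^esub> Ide V ?F1) = RUnit V d \<cdot>\<^bsub>V\<^esub> (Ide V d \<boxtimes>\<^bsub>V\<^esub> \<epsilon>)"
    unfolding c(2) .
  have "Eval W (Unit W) (Go d) \<cdot>\<^bsub>W\<^esub> ((\<theta> (Unit W) d \<cdot>\<^bsub>W\<^esub> Ga ?g) \<boxtimes>\<^bsub>W\<^esub> Ide W (Unit W))
    = Ga (RUnit V d \<cdot>\<^bsub>V\<^esub> (Ide V d \<boxtimes>\<^bsub>V\<^esub> \<epsilon>)) \<cdot>\<^bsub>W\<^esub> \<mu> d ?F1 \<cdot>\<^bsub>W\<^esub> (Ide W (Go d) \<boxtimes>\<^bsub>W\<^esub> \<eta> (Unit W))"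
    using eval_theta_pre[OF W.unit_obj d g(1,3)] unfolding g(2) ev .
  also have "\<dots> = Ga (RUnit V d) \<cdot>\<^bsub>W\<^esub> (Ga (Ide V d \<boxtimes>\<^bsub>V\<^esub> \<epsilon>) \<cdot>\<^bsub>W\<^esub> \<mu> d ?F1) \<cdot>\<^bsub>W\<^esub> (Ide W (Go d) \<boxtimes>\<^bsub>W\<^esub> \<eta> (Unit W))"
    using d by simp
  also have "Ga (Ide V d \<boxtimes>\<^bsub>V\<^esub> \<epsilon>) \<cdot>\<^bsub>W\<^esub> \<mu> d ?F1 = \<mu> d (Unit V) \<cdot>\<^bsub>W\<^esub> (Ga (Ide V d) \<boxtimes>\<^bsub>W\<^esub> Ga \<epsilon>)"
    using d by (subst mu_nat) simp_all
  also have "Ga (RUnit V d) \<cdot>\<^bsub>W\<^esub> (\<mu> d (Unit V) \<cdot>\<^bsub>W\<^esub> (Ga (Ide V d) \<boxtimes>\<^bsub>W\<^esub> Ga \<epsilon>)) \<cdot>\<^bsub>W\<^esub> (Ide W (Go d) \<boxtimes>\<^bsub>W\<^esub> \<eta> (Unit W))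
    = RUnit W (Go d)"
    using d lax_runit[OF d] by (simp add: transpose_oplax_unit)
  finally show "Eval W (Unit W) (Go d) \<cdot>\<^bsub>W\<^esub> ((\<theta> (Unit W) d \<cdot>\<^bsub>W\<^esub> Ga ?g) \<boxtimes>\<^bsub>W\<^esub> Ide W (Unit W)) = RUnit W (Go d)" .
  show "\<theta> (Unit W) d \<cdot>\<^bsub>W\<^esub> Ga ?g \<in> Hom W (Go d) (IHom W (Unit W) (Go d))"
    using g d by (simp add: in_Hom del: G.F_cmp')
qed (use d in \<open>simp_all add: in_Hom\<close>)

text \<open>
  On elements, \<open>\<theta>\<close> is the adjunction bijection from maps \<open>F w \<rightarrow> d\<close> to maps \<open>w \<rightarrow> G d\<close>.
\<close>

lemma theta_elements:
  assumes w: "w \<in> Obj W" and d: "d \<in> Obj V"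
  shows "bij_betw (\<lambda>f. \<theta> w d \<cdot>\<^bsub>W\<^esub> Ga f \<cdot>\<^bsub>W\<^esub> \<iota>) (Hom V (Unit V) (IHom V (Fo w) d)) (Hom W (Unit W) (IHom W w (Go d)))"
proof -
  let ?u = "\<lambda>f. Eval V (Fo w) d \<cdot>\<^bsub>V\<^esub> (f \<boxtimes>\<^bsub>V\<^esub> Ide V (Fo w)) \<cdot>\<^bsub>V\<^esub> inv_arr V (LUnit V (Fo w))"
  let ?u' = "\<lambda>f. Eval W w (Go d) \<cdot>\<^bsub>W\<^esub> (f \<boxtimes>\<^bsub>W\<^esub> Ide W w) \<cdot>\<^bsub>W\<^esub> inv_arr W (LUnit W w)"
  let ?t = "\<lambda>t. Ga t \<cdot>\<^bsub>W\<^esub> \<eta> w" and ?b = "\<lambda>f. \<theta> w d \<cdot>\<^bsub>W\<^esub> Ga f \<cdot>\<^bsub>W\<^esub> \<iota>"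
  have u: "bij_betw ?u (Hom V (Unit V) (IHom V (Fo w) d)) (Hom V (Fo w) d)"
    using w d by (intro V.bij_element_map) simp_all
  have t: "bij_betw ?t (Hom V (Fo w) d) (Hom W w (Go d))"
    using w d by (rule bij_transpose)
  have u': "bij_betw ?u' (Hom W (Unit W) (IHom W w (Go d))) (Hom W w (Go d))"
    using w d by (intro W.bij_element_map) simp_all
  have eq: "?u' (?b f) = ?t (?u f)" if f: "f \<in> Hom V (Unit V) (IHom V (Fo w) d)" for f
  proof -
    note f' = HomD[OF f]
    have l: "Ga (inv_arr V (LUnit V (Fo w))) \<cdot>\<^bsub>W\<^esub> LUnit W (Go (Fo w)) = \<mu> (Unit V) (Fo w) \<cdot>\<^bsub>W\<^esub> (\<iota> \<boxtimes>\<^bsub>W\<^esub> Ide W (Go (Fo w)))"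
    proof -
      have "Ga (inv_arr V (LUnit V (Fo w))) \<cdot>\<^bsub>W\<^esub> Ga (LUnit V (Fo w)) = Ide W (Go (Unit V \<otimes>\<^bsub>V\<^esub> Fo w))"
        using w by (simp flip: G.F_cmp')
      from W.pull[OF this, of "\<mu> (Unit V) (Fo w) \<cdot>\<^bsub>W\<^esub> (\<iota> \<boxtimes>\<^bsub>W\<^esub> Ide W (Go (Fo w)))"] show ?thesis
        using w lax_lunit[of "Fo w"] by simp
    qed
    let ?e = "Ga (Eval V (Fo w) d \<cdot>\<^bsub>V\<^esub> (f \<boxtimes>\<^bsub>V\<^esub> Ide V (Fo w)))"
    have e: "?e \<in> Arr W" "Dom W ?e = Go (Unit V \<otimes>\<^bsub>V\<^esub> Fo w)" "Cod W ?e = Go d"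
      using f' w d by (simp_all del: G.F_cmp')
    have "?u' (?b f) = (Eval W w (Go d) \<cdot>\<^bsub>W\<^esub> ((\<theta> w d \<cdot>\<^bsub>W\<^esub> Ga f) \<boxtimes>\<^bsub>W\<^esub> Ide W w)) \<cdot>\<^bsub>W\<^esub> (\<iota> \<boxtimes>\<^bsub>W\<^esub> Ide W w) \<cdot>\<^bsub>W\<^esub> inv_arr W (LUnit W w)"
      using f' w d by simp
    also have "\<dots> = ?e \<cdot>\<^bsub>W\<^esub> (\<mu> (Unit V) (Fo w) \<cdot>\<^bsub>W\<^esub> (\<iota> \<boxtimes>\<^bsub>W\<^esub> Ide W (Go (Fo w)))) \<cdot>\<^bsub>W\<^esub> (Ide W (Unit W) \<boxtimes>\<^bsub>W\<^esub> \<eta> w)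
        \<cdot>\<^bsub>W\<^esub> inv_arr W (LUnit W w)"
      unfolding eval_theta_pre[OF w d f'(1,3)] f'(2) using w e by (simp del: G.F_cmp')
    also have "\<dots> = ?e \<cdot>\<^bsub>W\<^esub> Ga (inv_arr V (LUnit V (Fo w))) \<cdot>\<^bsub>W\<^esub>
        (LUnit W (Go (Fo w)) \<cdot>\<^bsub>W\<^esub> (Ide W (Unit W) \<boxtimes>\<^bsub>W\<^esub> \<eta> w)) \<cdot>\<^bsub>W\<^esub> inv_arr W (LUnit W w)"
      unfolding l[symmetric] using w e by (simp del: G.F_cmp')
    also have "\<dots> = ?t (?u f)"
      using f' w d by (simp add: W.lunit_nat)
    finally show ?thesis .
  qed
  have sub: "?b ` Hom V (Unit V) (IHom V (Fo w) d) \<subseteq> Hom W (Unit W) (IHom W w (Go d))"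
    using w d by (auto simp: in_Hom)
  have "bij_betw (?t \<circ> ?u) (Hom V (Unit V) (IHom V (Fo w) d)) (Hom W w (Go d))"
    using u t by (rule bij_betw_trans)
  then have "bij_betw (?u' \<circ> ?b) (Hom V (Unit V) (IHom V (Fo w) d)) (Hom W w (Go d))"
    by (rule bij_betw_cong[THEN iffD1, rotated]) (simp add: eq)
  then show ?thesis
    using bij_betw_comp_iff2[OF u' sub] by simp
qed

end

locale weak_quillen_setting =
  W: symmetric_monoidal_model_category s W MW + V: symmetric_monoidal_model_category s V MV +
  weak_monoidal_Quillen_adjunction W MW V MV A
  for s :: "'s itself" and W :: "('w, 'n) mon_cat" and MW :: "'n model_str"
    and V :: "('v, 'm) mon_cat" and MV :: "'m model_str" and A :: "('w, 'n, 'v, 'm) lax_adj" +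
  assumes inf: "infinite (UNIV :: 's set)"
begin

sublocale lax_adjunction W V A ..

sublocale Q: quillen_adjunction s W MW V MV "LeftF A" "RightF A" "AUnit A" "ACounit A"
  by unfold_locales (use preserves_cof preserves_acyclic_cof in auto)

text \<open>
  The functors \<open>F (- \<otimes> w)\<close> and \<open>F - \<otimes> F w\<close> are left Quillen for cofibrant \<open>w\<close>, and \<open>\<theta> w\<close> is the
  mate of the comparison \<open>\<delta> - w\<close> between them.
\<close>

lemma theta_weq:
  assumes w: "cofibrant W MW w" and v: "fibrant V MV v"
  shows "\<theta> w v \<in> Weq MW"
proof -
  have wo: "w \<in> Obj W" using w by (auto simp: cofibrant_def in_Hom)
  interpret TW: quillen_adjunction s W MW W MW "tensor_func W w" "ihom_func W w" "tensor_unit W w" "Eval W w"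
    using w by (rule W.tensor_quillen_adjunction)
  interpret TV: quillen_adjunction s V MV V MV "tensor_func V (Fo w)" "ihom_func V (Fo w)"
    "tensor_unit V (Fo w)" "Eval V (Fo w)"
    using Q.left_cofibrant[OF w] by (rule V.tensor_quillen_adjunction)
  interpret mates: quillen_mates s W MW V MV
    "comp_func (LeftF A) (tensor_func W w)" "comp_func (ihom_func W w) (RightF A)"
    "\<lambda>x. FArr (ihom_func W w) (\<eta> (FObj (tensor_func W w) x)) \<cdot>\<^bsub>W\<^esub> tensor_unit W w x"
    "\<lambda>u. \<kappa> u \<cdot>\<^bsub>V\<^esub> Fa (Eval W w (Go u))"
    "comp_func (tensor_func V (Fo w)) (LeftF A)" "comp_func (RightF A) (ihom_func V (Fo w))"
    "\<lambda>x. Ga (tensor_unit V (Fo w) (Fo x)) \<cdot>\<^bsub>W\<^esub> \<eta> x"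
    "\<lambda>u. Eval V (Fo w) u \<cdot>\<^bsub>V\<^esub> FArr (tensor_func V (Fo w)) (\<kappa> (FObj (ihom_func V (Fo w)) u))"
    "\<lambda>x. \<delta> x w" "\<theta> w"
  proof (intro quillen_mates.intro quillen_mates_axioms.intro)
    show "quillen_adjunction s W MW V MV (comp_func (LeftF A) (tensor_func W w)) (comp_func (ihom_func W w) (RightF A))
      (\<lambda>x. FArr (ihom_func W w) (\<eta> (FObj (tensor_func W w) x)) \<cdot>\<^bsub>W\<^esub> tensor_unit W w x) (\<lambda>u. \<kappa> u \<cdot>\<^bsub>V\<^esub> Fa (Eval W w (Go u)))"
      using TW.quillen_adjunction_axioms Q.quillen_adjunction_axioms by (rule comp_quillen_adjunction)
    show "quillen_adjunction s W MW V MV (comp_func (tensor_func V (Fo w)) (LeftF A)) (comp_func (RightF A) (ihom_func V (Fo w)))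
      (\<lambda>x. Ga (tensor_unit V (Fo w) (Fo x)) \<cdot>\<^bsub>W\<^esub> \<eta> x)
      (\<lambda>u. Eval V (Fo w) u \<cdot>\<^bsub>V\<^esub> FArr (tensor_func V (Fo w)) (\<kappa> (FObj (ihom_func V (Fo w)) u)))"
      using Q.quillen_adjunction_axioms TV.quillen_adjunction_axioms by (rule comp_quillen_adjunction)
    show "\<delta> x w \<in> Weq MV" if "cofibrant W MW x" for x
      using that w by (rule oplax_mult_weq)
    fix u assume u: "u \<in> Obj V"
    let ?i = "IHom V (Fo w) u"
    have "\<kappa> u \<cdot>\<^bsub>V\<^esub> Fa (Eval W w (Go u)) \<cdot>\<^bsub>V\<^esub> Fa (\<theta> w u \<boxtimes>\<^bsub>W\<^esub> Ide W w)
      = \<kappa> u \<cdot>\<^bsub>V\<^esub> Fa (Eval W w (Go u) \<cdot>\<^bsub>W\<^esub> (\<theta> w u \<boxtimes>\<^bsub>W\<^esub> Ide W w))"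
      using wo u by simp
    also have "\<dots> = theta_adjunct w u"
      unfolding theta_curry(2)[OF wo u]
      by (rule transpose_left) (use wo u in \<open>simp_all add: in_Hom\<close>)
    finally show "(\<kappa> u \<cdot>\<^bsub>V\<^esub> Fa (Eval W w (Go u))) \<cdot>\<^bsub>V\<^esub> FArr (comp_func (LeftF A) (tensor_func W w)) (\<theta> w u)
      = (Eval V (Fo w) u \<cdot>\<^bsub>V\<^esub> FArr (tensor_func V (Fo w)) (\<kappa> (FObj (ihom_func V (Fo w)) u))) \<cdot>\<^bsub>V\<^esub>
        \<delta> (FObj (comp_func (RightF A) (ihom_func V (Fo w))) u) w"
      using wo u by (simp add: theta_adjunct_def)
  qed (use wo inf oplax_mult_nat theta_curry(1) in \<open>simp_all add: in_Hom\<close>)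
  show ?thesis using v by (rule mates.theta_weq)
qed

lemma ihom_fibrant:
  assumes "cofibrant V MV u" "fibrant V MV v"
  shows "fibrant V MV (IHom V u v)"
proof -
  interpret T: quillen_adjunction s V MV V MV "tensor_func V u" "ihom_func V u" "tensor_unit V u" "Eval V u"
    using assms(1) by (rule V.tensor_quillen_adjunction)
  show ?thesis using T.right_fibrant[OF assms(2)] by simp
qed

text \<open>
  The comparison maps of a weak (co)tensoring stay weak equivalences after the change of enrichment:
  \<open>G\<close> preserves the weak equivalence \<open>\<phi>\<close>, which is a map between fibrant objects.
\<close>

lemma theta_cmp_weq:
  assumes w: "cofibrant W MW w" and d: "fibrant V MV d"
    and \<phi>: "\<phi> \<in> Hom V c (IHom V (Fo w) d)" "\<phi> \<in> Weq MV" and c: "fibrant V MV c"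
  shows "\<theta> w d \<cdot>\<^bsub>W\<^esub> Ga \<phi> \<in> Weq MW"
proof -
  have o: "w \<in> Obj W" "d \<in> Obj V" using w d V.fibrant_obj by (auto simp: cofibrant_def in_Hom)
  note \<phi>' = HomD[OF \<phi>(1)]
  have "Ga \<phi> \<in> Weq MW"
    by (rule Q.right_weq[OF inf]) (use \<phi> \<phi>' c ihom_fibrant[OF Q.left_cofibrant[OF w] d] in simp_all)
  then show ?thesis
    using W.weq_cmp(1)[of "Ga \<phi>" "\<theta> w d"] theta_weq[OF w d] \<phi>' o by simp
qed

end


section \<open>Composition in an enriched category\<close>

text \<open>
  Composition with a map of the underlying category is defined with inverse unit constraints. The
  triangle and Kelly's axiom are therefore needed in this inverted form.
\<close>

context closed_symmetric_monoidal_category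
begin

lemma assoc_inv_runit:
  assumes x: "x \<in> Obj V" and y: "y \<in> Obj V"
  shows "Assoc V x \<one> y \<cdot> (inv_arr V (RUnit V x) \<boxtimes> Ide V y) = Ide V x \<boxtimes> inv_arr V (LUnit V y)"
proof (rule iso_cancel_left[of "Ide V x \<boxtimes> LUnit V y"])
  have "(Ide V x \<boxtimes> LUnit V y) \<cdot> Assoc V x \<one> y \<cdot> (inv_arr V (RUnit V x) \<boxtimes> Ide V y) = Ide V (x \<otimes> y)"
    using x y by (simp add: pull[OF triangle[OF x y]])
  then show "(Ide V x \<boxtimes> LUnit V y) \<cdot> Assoc V x \<one> y \<cdot> (inv_arr V (RUnit V x) \<boxtimes> Ide V y)
    = (Ide V x \<boxtimes> LUnit V y) \<cdot> (Ide V x \<boxtimes> inv_arr V (LUnit V y))"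
    using x y by simp
  show "is_iso V (Ide V x \<boxtimes> LUnit V y)"
    by (rule tens_iso(1)) (use x y in \<open>auto intro: is_isoI(1)[of _ x x "Ide V x"] simp: in_Hom\<close>)
qed (use x y in simp_all)

lemma assoc_inv_lunit:
  assumes x: "x \<in> Obj V"
  shows "Assoc V \<one> x \<one> \<cdot> (inv_arr V (LUnit V x) \<boxtimes> Ide V \<one>) \<cdot> inv_arr V (RUnit V x)
    = (Ide V \<one> \<boxtimes> inv_arr V (RUnit V x)) \<cdot> inv_arr V (LUnit V x)"
proof (rule iso_cancel_left[of "Ide V \<one> \<boxtimes> RUnit V x"])
  have "(Ide V \<one> \<boxtimes> RUnit V x) \<cdot> Assoc V \<one> x \<one> \<cdot> (inv_arr V (LUnit V x) \<boxtimes> Ide V \<one>) \<cdot> inv_arr V (RUnit V x)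
    = (RUnit V (\<one> \<otimes> x) \<cdot> (inv_arr V (LUnit V x) \<boxtimes> Ide V \<one>)) \<cdot> inv_arr V (RUnit V x)"
    using x by (simp add: pull[OF runit_tens[OF unit_obj x]])
  also have "\<dots> = inv_arr V (LUnit V x)"
    using x by (simp add: runit_nat)
  finally show "(Ide V \<one> \<boxtimes> RUnit V x) \<cdot> Assoc V \<one> x \<one> \<cdot> (inv_arr V (LUnit V x) \<boxtimes> Ide V \<one>) \<cdot> inv_arr V (RUnit V x)
    = (Ide V \<one> \<boxtimes> RUnit V x) \<cdot> (Ide V \<one> \<boxtimes> inv_arr V (RUnit V x)) \<cdot> inv_arr V (LUnit V x)"
    using x by simp
  show "is_iso V (Ide V \<one> \<boxtimes> RUnit V x)"
    by (rule tens_iso(1)) (use x in \<open>auto intro: is_isoI(1)[of _ \<one> \<one> "Ide V \<one>"] simp: in_Hom\<close>)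
qed (use x in simp_all)

end

lemma underlying_simps [simp]:
  "Obj (underlying V C) = EObj C"
  "Dom (underlying V C) (x, f, y) = x" "Cod (underlying V C) (x, f, y) = y"
  by (simp_all add: underlying_def)

lemma underlying_ide: "Ide (underlying V C) x = (x, EIde C x, x)"
  by (simp add: underlying_def)

lemma underlying_cmp:
  "(y', g, z) \<cdot>\<^bsub>underlying V C\<^esub> (x, f, y)
    = (x, ECmp C x y z \<cdot>\<^bsub>V\<^esub> (g \<boxtimes>\<^bsub>V\<^esub> f) \<cdot>\<^bsub>V\<^esub> inv_arr V (LUnit V (Unit V)), z)"
  by (simp add: underlying_def)

lemma underlying_arr:
  "(x, f, y) \<in> Arr (underlying V C) \<longleftrightarrow> x \<in> EObj C \<and> y \<in> EObj C \<and> f \<in> Hom V (Unit V) (EHom C x y)"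
  by (simp add: underlying_def)

lemma underlying_cases:
  assumes "F \<in> Arr (underlying V C)"
  obtains x f y where "F = (x, f, y)" "x \<in> EObj C" "y \<in> EObj C" "f \<in> Arr V" "Dom V f = Unit V" "Cod V f = EHom C x y"
  using assms by (cases F) (auto simp: underlying_arr in_Hom)

context enriched_category
begin

lemma enriched_simps [simp]:
  "x \<in> EObj C \<Longrightarrow> y \<in> EObj C \<Longrightarrow> EHom C x y \<in> Obj V"
  "x \<in> EObj C \<Longrightarrow> EIde C x \<in> Arr V" "x \<in> EObj C \<Longrightarrow> Dom V (EIde C x) = \<one>"
  "x \<in> EObj C \<Longrightarrow> Cod V (EIde C x) = EHom C x x"
  using ehom_obj eide_hom by (auto simp: in_Hom)

lemma ecmp_simps [simp]:
  assumes "x \<in> EObj C" "y \<in> EObj C" "z \<in> EObj C"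
  shows "ECmp C x y z \<in> Arr V" "Dom V (ECmp C x y z) = EHom C y z \<otimes> EHom C x y"
    "Cod V (ECmp C x y z) = EHom C x z"
  using ecmp_hom[OF assms] by (auto simp: in_Hom)

abbreviation "U \<equiv> underlying V C"

lemma precomp_simps [simp]:
  assumes "F \<in> Arr U" "y \<in> EObj C"
  shows "precomp V C F y \<in> Arr V" "Dom V (precomp V C F y) = EHom C (Cod U F) y"
    "Cod V (precomp V C F y) = EHom C (Dom U F) y"
  using assms by (auto simp: precomp_def elim!: underlying_cases)

lemma postcomp_simps [simp]:
  assumes "F \<in> Arr U" "x \<in> EObj C"
  shows "postcomp V C x F \<in> Arr V" "Dom V (postcomp V C x F) = EHom C x (Dom U F)"
    "Cod V (postcomp V C x F) = EHom C x (Cod U F)"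
  using assms by (auto simp: postcomp_def elim!: underlying_cases)

lemma precomp_ide:
  "x \<in> EObj C \<Longrightarrow> y \<in> EObj C \<Longrightarrow> precomp V C (Ide U x) y = Ide V (EHom C x y)"
  using pull[OF eide_right] by (simp add: precomp_def underlying_ide)

lemma postcomp_ide:
  "x \<in> EObj C \<Longrightarrow> y \<in> EObj C \<Longrightarrow> postcomp V C x (Ide U y) = Ide V (EHom C x y)"
  using pull[OF eide_left] by (simp add: postcomp_def underlying_ide)

text \<open>Associativity on generalized elements.\<close>

lemma ecmp_assoc_maps:
  assumes o: "w \<in> EObj C" "x \<in> EObj C" "y \<in> EObj C" "z \<in> EObj C"
    and f: "f \<in> Hom V a (EHom C w x)" and g: "g \<in> Hom V b (EHom C x y)" and h: "h \<in> Hom V c (EHom C y z)"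
  shows "ECmp C w x z \<cdot> ((ECmp C x y z \<cdot> (h \<boxtimes> g)) \<boxtimes> f)
    = ECmp C w y z \<cdot> (h \<boxtimes> (ECmp C w x y \<cdot> (g \<boxtimes> f))) \<cdot> Assoc V c b a"
proof -
  note hom = HomD[OF f] HomD[OF g] HomD[OF h]
  have abc: "a \<in> Obj V" "b \<in> Obj V" "c \<in> Obj V" using hom by auto
  have "ECmp C w x z \<cdot> ((ECmp C x y z \<cdot> (h \<boxtimes> g)) \<boxtimes> f)
    = (ECmp C w x z \<cdot> (ECmp C x y z \<boxtimes> Ide V (EHom C w x))) \<cdot> ((h \<boxtimes> g) \<boxtimes> f)"
    using o hom by simp
  also have "\<dots> = (ECmp C w y z \<cdot> (Ide V (EHom C y z) \<boxtimes> ECmp C w x y))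
      \<cdot> (Assoc V (EHom C y z) (EHom C x y) (EHom C w x) \<cdot> ((h \<boxtimes> g) \<boxtimes> f))"
    unfolding ecmp_assoc[OF o] using o hom by simp
  also have "Assoc V (EHom C y z) (EHom C x y) (EHom C w x) \<cdot> ((h \<boxtimes> g) \<boxtimes> f) = (h \<boxtimes> (g \<boxtimes> f)) \<cdot> Assoc V c b a"
    using hom by (simp add: assoc_nat)
  finally show ?thesis using o hom abc by simp
qed

lemma precomp_cmp:
  assumes F: "F \<in> Arr U" and G: "G \<in> Arr U" and FG: "Dom U G = Cod U F" and y: "y \<in> EObj C"
  shows "precomp V C (G \<cdot>\<^bsub>U\<^esub> F) y = precomp V C F y \<cdot> precomp V C G y"
  using F
proof (rule underlying_cases)
  fix x f x' assume F': "F = (x, f, x')" "x \<in> EObj C" "x' \<in> EObj C" "f \<in> Arr V" "Dom V f = \<one>" "Cod V f = EHom C x x'"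
  obtain g x'' where G': "G = (x', g, x'')" "x'' \<in> EObj C" "g \<in> Arr V" "Dom V g = \<one>" "Cod V g = EHom C x' x''"
    using G FG F' by (auto elim!: underlying_cases)
  note [simp] = F'(2-) G'(2-) y
  let ?H = "EHom C x'' y"
  let ?g = "(ECmp C x' x'' y \<cdot> (Ide V ?H \<boxtimes> g)) \<cdot> inv_arr V (RUnit V ?H)"
  have "precomp V C F y \<cdot> precomp V C G y
    = ECmp C x x' y \<cdot> (Ide V (EHom C x' y) \<boxtimes> f) \<cdot> (inv_arr V (RUnit V (EHom C x' y)) \<cdot> ?g)"
    by (simp add: precomp_def F'(1) G'(1))
  also have "\<dots> = (ECmp C x x' y \<cdot> ((ECmp C x' x'' y \<cdot> (Ide V ?H \<boxtimes> g)) \<boxtimes> f))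
      \<cdot> (inv_arr V (RUnit V ?H) \<boxtimes> Ide V \<one>) \<cdot> inv_arr V (RUnit V ?H)"
    by (simp add: inv_runit_nat)
  also have "\<dots> = ECmp C x x'' y \<cdot> (Ide V ?H \<boxtimes> (ECmp C x x' x'' \<cdot> (g \<boxtimes> f)))
      \<cdot> (Assoc V ?H \<one> \<one> \<cdot> (inv_arr V (RUnit V ?H) \<boxtimes> Ide V \<one>)) \<cdot> inv_arr V (RUnit V ?H)"
    by (subst ecmp_assoc_maps[where a = \<one> and b = \<one> and c = ?H]) (simp_all add: in_Hom)
  also have "\<dots> = precomp V C (G \<cdot>\<^bsub>U\<^esub> F) y"
    by (simp add: assoc_inv_runit precomp_def F'(1) G'(1) underlying_cmp)
  finally show ?thesis by simp
qed

lemma postcomp_cmp: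
  assumes F: "F \<in> Arr U" and G: "G \<in> Arr U" and FG: "Dom U G = Cod U F" and x: "x \<in> EObj C"
  shows "postcomp V C x (G \<cdot>\<^bsub>U\<^esub> F) = postcomp V C x G \<cdot> postcomp V C x F"
  using F
proof (rule underlying_cases)
  fix y f y' assume F': "F = (y, f, y')" "y \<in> EObj C" "y' \<in> EObj C" "f \<in> Arr V" "Dom V f = \<one>" "Cod V f = EHom C y y'"
  obtain g y'' where G': "G = (y', g, y'')" "y'' \<in> EObj C" "g \<in> Arr V" "Dom V g = \<one>" "Cod V g = EHom C y' y''"
    using G FG F' by (auto elim!: underlying_cases)
  note [simp] = F'(2-) G'(2-) x
  let ?H = "EHom C x y"
  have "postcomp V C x (G \<cdot>\<^bsub>U\<^esub> F)
    = (ECmp C x y y'' \<cdot> ((ECmp C y y' y'' \<cdot> (g \<boxtimes> f)) \<boxtimes> Ide V ?H))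
      \<cdot> (inv_arr V (LUnit V \<one>) \<boxtimes> Ide V ?H) \<cdot> inv_arr V (LUnit V ?H)"
    by (simp add: postcomp_def F'(1) G'(1) underlying_cmp)
  also have "\<dots> = ECmp C x y' y'' \<cdot> (g \<boxtimes> (ECmp C x y y' \<cdot> (f \<boxtimes> Ide V ?H)))
      \<cdot> (Assoc V \<one> \<one> ?H \<cdot> (inv_arr V (LUnit V \<one>) \<boxtimes> Ide V ?H)) \<cdot> inv_arr V (LUnit V ?H)"
    by (subst ecmp_assoc_maps[where a = ?H and b = \<one> and c = \<one>]) (simp_all add: in_Hom)
  also have "\<dots> = ECmp C x y' y'' \<cdot> (g \<boxtimes> Ide V (EHom C x y')) \<cdot>
      (Ide V \<one> \<boxtimes> ((ECmp C x y y' \<cdot> (f \<boxtimes> Ide V ?H)) \<cdot> inv_arr V (LUnit V ?H))) \<cdot> inv_arr V (LUnit V ?H)"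
    by (simp add: assoc_inv_runit lunit_unit)
  also have "\<dots> = postcomp V C x G \<cdot> postcomp V C x F"
    by (simp add: postcomp_def F'(1) G'(1) inv_lunit_nat)
  finally show ?thesis .
qed

text \<open>Bifunctoriality of the hom-objects. It makes the square in SM7 commute.\<close>

lemma postcomp_precomp:
  assumes F: "F \<in> Arr U" and G: "G \<in> Arr U"
  shows "postcomp V C (Dom U F) G \<cdot> precomp V C F (Dom U G) = precomp V C F (Cod U G) \<cdot> postcomp V C (Cod U F) G"
  using F
proof (rule underlying_cases)
  fix a i b assume F': "F = (a, i, b)" "a \<in> EObj C" "b \<in> EObj C" "i \<in> Arr V" "Dom V i = \<one>" "Cod V i = EHom C a b"
  obtain x f y where G': "G = (x, f, y)" "x \<in> EObj C" "y \<in> EObj C" "f \<in> Arr V" "Dom V f = \<one>" "Cod V f = EHom C x y"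
    using G by (auto elim!: underlying_cases)
  note [simp] = F'(2-) G'(2-)
  let ?H = "EHom C b x"
  have "precomp V C F y \<cdot> postcomp V C b G
    = ECmp C a b y \<cdot> (Ide V (EHom C b y) \<boxtimes> i) \<cdot>
        (inv_arr V (RUnit V (EHom C b y)) \<cdot> ((ECmp C b x y \<cdot> (f \<boxtimes> Ide V ?H)) \<cdot> inv_arr V (LUnit V ?H)))"
    by (simp add: precomp_def postcomp_def F'(1) G'(1))
  also have "\<dots> = (ECmp C a b y \<cdot> ((ECmp C b x y \<cdot> (f \<boxtimes> Ide V ?H)) \<boxtimes> i))
      \<cdot> (inv_arr V (LUnit V ?H) \<boxtimes> Ide V \<one>) \<cdot> inv_arr V (RUnit V ?H)"
    by (simp add: inv_runit_nat)
  also have "\<dots> = ECmp C a x y \<cdot> (f \<boxtimes> (ECmp C a b x \<cdot> (Ide V ?H \<boxtimes> i)))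
      \<cdot> (Assoc V \<one> ?H \<one> \<cdot> (inv_arr V (LUnit V ?H) \<boxtimes> Ide V \<one>) \<cdot> inv_arr V (RUnit V ?H))"
    by (subst ecmp_assoc_maps[where a = \<one> and b = ?H and c = \<one>]) (simp_all add: in_Hom)
  also have "\<dots> = ECmp C a x y \<cdot> (f \<boxtimes> Ide V (EHom C a x)) \<cdot>
      (Ide V \<one> \<boxtimes> ((ECmp C a b x \<cdot> (Ide V ?H \<boxtimes> i)) \<cdot> inv_arr V (RUnit V ?H))) \<cdot> inv_arr V (LUnit V ?H)"
    by (simp add: assoc_inv_lunit)
  also have "\<dots> = postcomp V C a G \<cdot> precomp V C F x"
    by (simp add: postcomp_def precomp_def F'(1) G'(1) inv_lunit_nat)
  finally show ?thesis by (simp add: F'(1) G'(1))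
qed

lemma arr_obj:
  assumes "F \<in> Arr U" shows "Dom U F \<in> EObj C" "Cod U F \<in> EObj C"
  using assms by (auto elim!: underlying_cases)

lemma ehom_arr_simps [simp]:
  assumes "F \<in> Arr U" "G \<in> Arr U"
  shows "ehom_arr V C F G \<in> Arr V" "Dom V (ehom_arr V C F G) = EHom C (Cod U F) (Dom U G)"
    "Cod V (ehom_arr V C F G) = EHom C (Dom U F) (Cod U G)"
  using assms arr_obj by (simp_all add: ehom_arr_def)

lemma ehom_arr_ide:
  assumes "F \<in> Arr U" "x \<in> EObj C"
  shows "ehom_arr V C (Ide U x) F = postcomp V C x F"
    and "ehom_arr V C F (Ide U x) = precomp V C F x"
  using assms arr_obj[OF assms(1)] precomp_ide postcomp_ide
  by (simp_all add: ehom_arr_def underlying_ide)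

end


section \<open>Change of enrichment\<close>

locale lax_adjunction_enriched = lax_adjunction W V A + C: enriched_category V C
  for W :: "('w, 'n) mon_cat" and V :: "('v, 'm) mon_cat" and A :: "('w, 'n, 'v, 'm) lax_adj"
    and C :: "('c, 'v, 'm) ecat" +
  assumes eps_iso: "is_iso V (oplax_unit V A)"
begin

abbreviation "D \<equiv> base_change W A C"
abbreviation "U \<equiv> underlying V C"
abbreviation "U' \<equiv> underlying W D"
abbreviation "\<phi> \<equiv> base_arr W A"
abbreviation "\<psi> \<equiv> unbase_arr W V A C"

lemma base_change_simps [simp]:
  "EObj D = EObj C" "EHom D x y = Go (EHom C x y)"
  "EIde D x = Ga (EIde C x) \<cdot>\<^bsub>W\<^esub> \<iota>" "ECmp D x y z = Ga (ECmp C x y z) \<cdot>\<^bsub>W\<^esub> \<mu> (EHom C y z) (EHom C x y)"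
  by (simp_all add: base_change_def)

lemma base_arr_simp [simp]: "\<phi> (x, f, y) = (x, Ga f \<cdot>\<^bsub>W\<^esub> \<iota>, y)"
  by (simp add: base_arr_def)

text \<open>By naturality of \<open>\<mu>\<close>, composites in the changed enrichment are computed in \<open>V\<close> first.\<close>

lemma Ga_mu:
  assumes "h \<in> Arr V" "f \<in> Arr V" "g \<in> Arr V" "Dom V h = Cod V f \<otimes>\<^bsub>V\<^esub> Cod V g"
    and "f' \<in> Arr W" "Cod W f' = Go (Dom V f)" "g' \<in> Arr W" "Cod W g' = Go (Dom V g)"
  shows "Ga h \<cdot>\<^bsub>W\<^esub> \<mu> (Cod V f) (Cod V g) \<cdot>\<^bsub>W\<^esub> ((Ga f \<cdot>\<^bsub>W\<^esub> f') \<boxtimes>\<^bsub>W\<^esub> (Ga g \<cdot>\<^bsub>W\<^esub> g'))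
    = Ga (h \<cdot>\<^bsub>V\<^esub> (f \<boxtimes>\<^bsub>V\<^esub> g)) \<cdot>\<^bsub>W\<^esub> \<mu> (Dom V f) (Dom V g) \<cdot>\<^bsub>W\<^esub> (f' \<boxtimes>\<^bsub>W\<^esub> g')"
proof -
  have "Ga h \<cdot>\<^bsub>W\<^esub> \<mu> (Cod V f) (Cod V g) \<cdot>\<^bsub>W\<^esub> ((Ga f \<cdot>\<^bsub>W\<^esub> f') \<boxtimes>\<^bsub>W\<^esub> (Ga g \<cdot>\<^bsub>W\<^esub> g'))
    = Ga h \<cdot>\<^bsub>W\<^esub> (\<mu> (Cod V f) (Cod V g) \<cdot>\<^bsub>W\<^esub> (Ga f \<boxtimes>\<^bsub>W\<^esub> Ga g)) \<cdot>\<^bsub>W\<^esub> (f' \<boxtimes>\<^bsub>W\<^esub> g')"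
    using assms by simp
  also have "\<mu> (Cod V f) (Cod V g) \<cdot>\<^bsub>W\<^esub> (Ga f \<boxtimes>\<^bsub>W\<^esub> Ga g) = Ga (f \<boxtimes>\<^bsub>V\<^esub> g) \<cdot>\<^bsub>W\<^esub> \<mu> (Dom V f) (Dom V g)"
    using assms by (simp add: mu_nat)
  finally show ?thesis using assms by simp
qed

lemma mu_iota_left:
  assumes "x \<in> Obj V"
  shows "\<mu> (Unit V) x \<cdot>\<^bsub>W\<^esub> (\<iota> \<boxtimes>\<^bsub>W\<^esub> Ide W (Go x)) = Ga (inv_arr V (LUnit V x)) \<cdot>\<^bsub>W\<^esub> LUnit W (Go x)"
proof (rule W.iso_cancel_left[OF G.F_iso(1)])
  show "Ga (LUnit V x) \<cdot>\<^bsub>W\<^esub> \<mu> (Unit V) x \<cdot>\<^bsub>W\<^esub> (\<iota> \<boxtimes>\<^bsub>W\<^esub> Ide W (Go x))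
    = Ga (LUnit V x) \<cdot>\<^bsub>W\<^esub> Ga (inv_arr V (LUnit V x)) \<cdot>\<^bsub>W\<^esub> LUnit W (Go x)"
    using assms lax_lunit[OF assms] by (simp add: W.pull[OF G.F_cmp'[symmetric]] del: G.F_cmp')
qed (use assms in simp_all)

lemma mu_iota_right:
  assumes "x \<in> Obj V"
  shows "\<mu> x (Unit V) \<cdot>\<^bsub>W\<^esub> (Ide W (Go x) \<boxtimes>\<^bsub>W\<^esub> \<iota>) = Ga (inv_arr V (RUnit V x)) \<cdot>\<^bsub>W\<^esub> RUnit W (Go x)"
proof (rule W.iso_cancel_left[OF G.F_iso(1)])
  show "Ga (RUnit V x) \<cdot>\<^bsub>W\<^esub> \<mu> x (Unit V) \<cdot>\<^bsub>W\<^esub> (Ide W (Go x) \<boxtimes>\<^bsub>W\<^esub> \<iota>)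
    = Ga (RUnit V x) \<cdot>\<^bsub>W\<^esub> Ga (inv_arr V (RUnit V x)) \<cdot>\<^bsub>W\<^esub> RUnit W (Go x)"
    using assms lax_runit[OF assms] by (simp add: W.pull[OF G.F_cmp'[symmetric]] del: G.F_cmp')
qed (use assms in simp_all)

lemma base_change_enriched: "enriched_category W D"
proof
  fix w x y z assume "w \<in> EObj D" "x \<in> EObj D" "y \<in> EObj D" "z \<in> EObj D"
  then have o [simp]: "w \<in> EObj C" "x \<in> EObj C" "y \<in> EObj C" "z \<in> EObj C" by simp_all
  let ?h = "EHom C y z" and ?g = "EHom C x y" and ?f = "EHom C w x"
  have "ECmp D w x z \<cdot>\<^bsub>W\<^esub> (ECmp D x y z \<boxtimes>\<^bsub>W\<^esub> Ide W (EHom D w x))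
    = Ga (ECmp C w x z \<cdot>\<^bsub>V\<^esub> (ECmp C x y z \<boxtimes>\<^bsub>V\<^esub> Ide V ?f)) \<cdot>\<^bsub>W\<^esub>
        \<mu> (?h \<otimes>\<^bsub>V\<^esub> ?g) ?f \<cdot>\<^bsub>W\<^esub> (\<mu> ?h ?g \<boxtimes>\<^bsub>W\<^esub> Ide W (Go ?f))"
    using Ga_mu[of "ECmp C w x z" "ECmp C x y z" "Ide V ?f" "\<mu> ?h ?g" "Ide W (Go ?f)"]
    by (simp del: G.F_cmp')
  also have "\<dots> = Ga (ECmp C w y z \<cdot>\<^bsub>V\<^esub> (Ide V ?h \<boxtimes>\<^bsub>V\<^esub> ECmp C w x y)) \<cdot>\<^bsub>W\<^esub>
      (Ga (Assoc V ?h ?g ?f) \<cdot>\<^bsub>W\<^esub> \<mu> (?h \<otimes>\<^bsub>V\<^esub> ?g) ?f \<cdot>\<^bsub>W\<^esub> (\<mu> ?h ?g \<boxtimes>\<^bsub>W\<^esub> Ide W (Go ?f)))"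
    unfolding C.ecmp_assoc[OF o] by simp
  also have "\<dots> = (Ga (ECmp C w y z \<cdot>\<^bsub>V\<^esub> (Ide V ?h \<boxtimes>\<^bsub>V\<^esub> ECmp C w x y)) \<cdot>\<^bsub>W\<^esub>
      \<mu> ?h (?g \<otimes>\<^bsub>V\<^esub> ?f) \<cdot>\<^bsub>W\<^esub> (Ide W (Go ?h) \<boxtimes>\<^bsub>W\<^esub> \<mu> ?g ?f)) \<cdot>\<^bsub>W\<^esub> Assoc W (Go ?h) (Go ?g) (Go ?f)"
    by (subst lax_assoc) (simp_all del: G.F_cmp')
  also have "Ga (ECmp C w y z \<cdot>\<^bsub>V\<^esub> (Ide V ?h \<boxtimes>\<^bsub>V\<^esub> ECmp C w x y)) \<cdot>\<^bsub>W\<^esub>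
      \<mu> ?h (?g \<otimes>\<^bsub>V\<^esub> ?f) \<cdot>\<^bsub>W\<^esub> (Ide W (Go ?h) \<boxtimes>\<^bsub>W\<^esub> \<mu> ?g ?f)
    = ECmp D w y z \<cdot>\<^bsub>W\<^esub> (Ide W (EHom D y z) \<boxtimes>\<^bsub>W\<^esub> ECmp D w x y)"
    using Ga_mu[of "ECmp C w y z" "Ide V ?h" "ECmp C w x y" "Ide W (Go ?h)" "\<mu> ?g ?f"]
    by (simp del: G.F_cmp')
  also have "(ECmp D w y z \<cdot>\<^bsub>W\<^esub> (Ide W (EHom D y z) \<boxtimes>\<^bsub>W\<^esub> ECmp D w x y)) \<cdot>\<^bsub>W\<^esub> Assoc W (Go ?h) (Go ?g) (Go ?f)
    = ECmp D w y z \<cdot>\<^bsub>W\<^esub> (Ide W (EHom D y z) \<boxtimes>\<^bsub>W\<^esub> ECmp D w x y)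
      \<cdot>\<^bsub>W\<^esub> Assoc W (EHom D y z) (EHom D x y) (EHom D w x)"
    by simp
  finally show "ECmp D w x z \<cdot>\<^bsub>W\<^esub> (ECmp D x y z \<boxtimes>\<^bsub>W\<^esub> Ide W (EHom D w x))
    = ECmp D w y z \<cdot>\<^bsub>W\<^esub> (Ide W (EHom D y z) \<boxtimes>\<^bsub>W\<^esub> ECmp D w x y)
      \<cdot>\<^bsub>W\<^esub> Assoc W (EHom D y z) (EHom D x y) (EHom D w x)" .
next
  fix x y assume "x \<in> EObj D" "y \<in> EObj D"
  then have o [simp]: "x \<in> EObj C" "y \<in> EObj C" by simp_all
  let ?h = "EHom C x y"
  have "ECmp D x y y \<cdot>\<^bsub>W\<^esub> (EIde D y \<boxtimes>\<^bsub>W\<^esub> Ide W (EHom D x y))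
    = Ga (ECmp C x y y \<cdot>\<^bsub>V\<^esub> (EIde C y \<boxtimes>\<^bsub>V\<^esub> Ide V ?h)) \<cdot>\<^bsub>W\<^esub> \<mu> (Unit V) ?h \<cdot>\<^bsub>W\<^esub> (\<iota> \<boxtimes>\<^bsub>W\<^esub> Ide W (Go ?h))"
    using Ga_mu[of "ECmp C x y y" "EIde C y" "Ide V ?h" \<iota> "Ide W (Go ?h)"] by (simp del: G.F_cmp')
  then show "ECmp D x y y \<cdot>\<^bsub>W\<^esub> (EIde D y \<boxtimes>\<^bsub>W\<^esub> Ide W (EHom D x y)) = LUnit W (EHom D x y)"
    unfolding C.eide_left[OF o] by (simp add: lax_lunit)
  have "ECmp D x x y \<cdot>\<^bsub>W\<^esub> (Ide W (EHom D x y) \<boxtimes>\<^bsub>W\<^esub> EIde D x)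
    = Ga (ECmp C x x y \<cdot>\<^bsub>V\<^esub> (Ide V ?h \<boxtimes>\<^bsub>V\<^esub> EIde C x)) \<cdot>\<^bsub>W\<^esub> \<mu> ?h (Unit V) \<cdot>\<^bsub>W\<^esub> (Ide W (Go ?h) \<boxtimes>\<^bsub>W\<^esub> \<iota>)"
    using Ga_mu[of "ECmp C x x y" "Ide V ?h" "EIde C x" "Ide W (Go ?h)" \<iota>] by (simp del: G.F_cmp')
  then show "ECmp D x x y \<cdot>\<^bsub>W\<^esub> (Ide W (EHom D x y) \<boxtimes>\<^bsub>W\<^esub> EIde D x) = RUnit W (EHom D x y)"
    unfolding C.eide_right[OF o] by (simp add: lax_runit)
qed (simp_all add: in_Hom)

lemma precomp_base:
  assumes F: "F \<in> Arr U" and y: "y \<in> EObj C"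
  shows "precomp W D (\<phi> F) y = Ga (precomp V C F y)"
  using F
proof (rule underlying_cases)
  fix x f x' assume F': "F = (x, f, x')" "x \<in> EObj C" "x' \<in> EObj C" "f \<in> Arr V" "Dom V f = Unit V" "Cod V f = EHom C x x'"
  note [simp] = F'(2-) y
  let ?h = "EHom C x' y"
  have "precomp W D (\<phi> F) y
    = (Ga (ECmp C x x' y) \<cdot>\<^bsub>W\<^esub> \<mu> ?h (EHom C x x') \<cdot>\<^bsub>W\<^esub> (Ide W (Go ?h) \<boxtimes>\<^bsub>W\<^esub> (Ga f \<cdot>\<^bsub>W\<^esub> \<iota>)))
      \<cdot>\<^bsub>W\<^esub> inv_arr W (RUnit W (Go ?h))"
    by (simp add: precomp_def F'(1))
  also have "\<dots> = Ga (ECmp C x x' y \<cdot>\<^bsub>V\<^esub> (Ide V ?h \<boxtimes>\<^bsub>V\<^esub> f)) \<cdot>\<^bsub>W\<^esub> (\<mu> ?h (Unit V) \<cdot>\<^bsub>W\<^esub> (Ide W (Go ?h) \<boxtimes>\<^bsub>W\<^esub> \<iota>))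
      \<cdot>\<^bsub>W\<^esub> inv_arr W (RUnit W (Go ?h))"
    using Ga_mu[of "ECmp C x x' y" "Ide V ?h" f "Ide W (Go ?h)" \<iota>] by simp
  also have "\<dots> = Ga (precomp V C F y)"
    unfolding mu_iota_right[OF C.ehom_obj[OF F'(3) y]] by (simp add: precomp_def F'(1))
  finally show ?thesis .
qed

lemma postcomp_base:
  assumes F: "F \<in> Arr U" and x: "x \<in> EObj C"
  shows "postcomp W D x (\<phi> F) = Ga (postcomp V C x F)"
  using F
proof (rule underlying_cases)
  fix y f y' assume F': "F = (y, f, y')" "y \<in> EObj C" "y' \<in> EObj C" "f \<in> Arr V" "Dom V f = Unit V" "Cod V f = EHom C y y'"
  note [simp] = F'(2-) x
  let ?h = "EHom C x y"
  have "postcomp W D x (\<phi> F)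
    = (Ga (ECmp C x y y') \<cdot>\<^bsub>W\<^esub> \<mu> (EHom C y y') ?h \<cdot>\<^bsub>W\<^esub> ((Ga f \<cdot>\<^bsub>W\<^esub> \<iota>) \<boxtimes>\<^bsub>W\<^esub> Ide W (Go ?h)))
      \<cdot>\<^bsub>W\<^esub> inv_arr W (LUnit W (Go ?h))"
    by (simp add: postcomp_def F'(1))
  also have "\<dots> = Ga (ECmp C x y y' \<cdot>\<^bsub>V\<^esub> (f \<boxtimes>\<^bsub>V\<^esub> Ide V ?h)) \<cdot>\<^bsub>W\<^esub> (\<mu> (Unit V) ?h \<cdot>\<^bsub>W\<^esub> (\<iota> \<boxtimes>\<^bsub>W\<^esub> Ide W (Go ?h)))
      \<cdot>\<^bsub>W\<^esub> inv_arr W (LUnit W (Go ?h))"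
    using Ga_mu[of "ECmp C x y y'" f "Ide V ?h" \<iota> "Ide W (Go ?h)"] by simp
  also have "\<dots> = Ga (postcomp V C x F)"
    unfolding mu_iota_left[OF C.ehom_obj[OF x F'(2)]] by (simp add: postcomp_def F'(1))
  finally show ?thesis .
qed

lemma base_arr_elements:
  assumes d: "d \<in> Obj V"
  shows "bij_betw (\<lambda>f. Ga f \<cdot>\<^bsub>W\<^esub> \<iota>) (Hom V (Unit V) d) (Hom W (Unit W) (Go d))"
proof -
  have "bij_betw (\<lambda>f. f \<cdot>\<^bsub>V\<^esub> \<epsilon>) (Hom V (Unit V) d) (Hom V (Fo (Unit W)) d)"
    by (rule bij_betw_byWitness[where f' = "\<lambda>g. g \<cdot>\<^bsub>V\<^esub> inv_arr V \<epsilon>"])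
      (use eps_iso in \<open>auto simp: in_Hom\<close>)
  from bij_betw_trans[OF this bij_transpose[OF W.unit_obj d]]
  show ?thesis
    by (rule bij_betw_cong[THEN iffD1, rotated]) (simp add: in_Hom transpose_oplax_unit)
qed

text \<open>
  The underlying category of \<open>C\<close> is unchanged. Composition is preserved because \<open>\<mu>\<close> and \<open>\<iota>\<close>
  intertwine the unit constraints of \<open>V\<close> and \<open>W\<close>.
\<close>

lemma base_iso:
  assumes "category U"
  shows "cat_iso U U' \<phi>"
proof -
  interpret U: category U by fact
  have arr': "(x, f', y) \<in> Arr U' \<longleftrightarrow> x \<in> EObj C \<and> y \<in> EObj C \<and> f' \<in> Hom W (Unit W) (Go (EHom C x y))" for x f' y
    by (simp add: underlying_arr)
  show ?thesis
  proof
    show "bij_betw \<phi> (Arr U) (Arr U')"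
      unfolding bij_betw_def inj_on_def
    proof (intro conjI ballI impI set_eqI iffI)
      fix F G assume FG: "F \<in> Arr U" "G \<in> Arr U" "\<phi> F = \<phi> G"
      obtain x f y where F: "F = (x, f, y)" "x \<in> EObj C" "y \<in> EObj C" "f \<in> Hom V (Unit V) (EHom C x y)"
        using FG(1) unfolding underlying_def by auto
      obtain x' g y' where G': "G = (x', g, y')" "g \<in> Hom V (Unit V) (EHom C x' y')"
        using FG(2) unfolding underlying_def by auto
      have "x' = x" "y' = y" and eq: "Ga f \<cdot>\<^bsub>W\<^esub> \<iota> = Ga g \<cdot>\<^bsub>W\<^esub> \<iota>"
        using FG(3) by (simp_all add: F(1) G'(1))
      then have G: "G = (x, g, y)" "g \<in> Hom V (Unit V) (EHom C x y)"
        using G' by simp_all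
      have "f = g"
        using base_arr_elements[OF C.ehom_obj[OF F(2,3)]] F(4) G(2) eq
        unfolding bij_betw_def inj_on_def by blast
      then show "F = G" by (simp add: F(1) G(1))
    next
      fix F' assume "F' \<in> \<phi> ` Arr U"
      then show "F' \<in> Arr U'"
        by (auto simp: underlying_arr in_Hom elim!: underlying_cases)
    next
      fix F' assume "F' \<in> Arr U'"
      then obtain x f' y where F': "F' = (x, f', y)" "x \<in> EObj C" "y \<in> EObj C"
        "f' \<in> Hom W (Unit W) (Go (EHom C x y))"
        by (cases F') (simp add: underlying_arr)
      then obtain f where "f \<in> Hom V (Unit V) (EHom C x y)" "f' = Ga f \<cdot>\<^bsub>W\<^esub> \<iota>"
        using base_arr_elements[OF C.ehom_obj[OF F'(2,3)]] unfolding bij_betw_def by blast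
      then show "F' \<in> \<phi> ` Arr U"
        using F' by (auto simp: underlying_arr intro!: image_eqI[of _ _ "(x, f, y)"])
    qed
  next
    fix F G assume F: "F \<in> Arr U" and G: "G \<in> Arr U" and FG: "Dom U G = Cod U F"
    obtain x f y where F': "F = (x, f, y)" "x \<in> EObj C" "y \<in> EObj C" "f \<in> Arr V" "Dom V f = Unit V" "Cod V f = EHom C x y"
      using F by (rule underlying_cases)
    obtain g z where G': "G = (y, g, z)" "z \<in> EObj C" "g \<in> Arr V" "Dom V g = Unit V" "Cod V g = EHom C y z"
      using G FG F' by (auto elim!: underlying_cases)
    note [simp] = F'(2-) G'(2-)
    let ?c = "ECmp C x y z \<cdot>\<^bsub>V\<^esub> (g \<boxtimes>\<^bsub>V\<^esub> f)"
    have "(Ga (ECmp C x y z) \<cdot>\<^bsub>W\<^esub> \<mu> (EHom C y z) (EHom C x y) \<cdot>\<^bsub>W\<^esub> ((Ga g \<cdot>\<^bsub>W\<^esub> \<iota>) \<boxtimes>\<^bsub>W\<^esub> (Ga f \<cdot>\<^bsub>W\<^esub> \<iota>)))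
        \<cdot>\<^bsub>W\<^esub> inv_arr W (LUnit W (Unit W))
      = Ga ?c \<cdot>\<^bsub>W\<^esub> (\<mu> (Unit V) (Unit V) \<cdot>\<^bsub>W\<^esub> (\<iota> \<boxtimes>\<^bsub>W\<^esub> Ide W (Go (Unit V)))) \<cdot>\<^bsub>W\<^esub> (Ide W (Unit W) \<boxtimes>\<^bsub>W\<^esub> \<iota>)
        \<cdot>\<^bsub>W\<^esub> inv_arr W (LUnit W (Unit W))"
      using Ga_mu[of "ECmp C x y z" g f \<iota> \<iota>] by simp
    also have "\<dots> = Ga (?c \<cdot>\<^bsub>V\<^esub> inv_arr V (LUnit V (Unit V))) \<cdot>\<^bsub>W\<^esub>
        (LUnit W (Go (Unit V)) \<cdot>\<^bsub>W\<^esub> (Ide W (Unit W) \<boxtimes>\<^bsub>W\<^esub> \<iota>)) \<cdot>\<^bsub>W\<^esub> inv_arr W (LUnit W (Unit W))"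
      unfolding mu_iota_left[OF V.unit_obj] by simp
    also have "\<dots> = Ga (?c \<cdot>\<^bsub>V\<^esub> inv_arr V (LUnit V (Unit V))) \<cdot>\<^bsub>W\<^esub> \<iota>"
      by (simp add: W.lunit_nat)
    finally show "\<phi> G \<cdot>\<^bsub>U'\<^esub> \<phi> F = \<phi> (G \<cdot>\<^bsub>U\<^esub> F)"
      by (simp add: F'(1) G'(1) underlying_cmp)
  next
    fix F
    show "Dom U' (\<phi> F) = Dom U F" "Cod U' (\<phi> F) = Cod U F" by (cases F; simp)+
  qed (simp_all add: underlying_ide)
qed

lemma ehom_arr_base:
  assumes "F \<in> Arr U" "G \<in> Arr U" "category U"
  shows "ehom_arr W D (\<phi> F) (\<phi> G) = Ga (ehom_arr V C F G)"
proof -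
  interpret I: cat_iso U U' \<phi> using assms(3) by (rule base_iso)
  show ?thesis
    using assms C.arr_obj by (simp add: ehom_arr_def precomp_base postcomp_base)
qed

end


section \<open>Transport of structure along an isomorphism of categories\<close>

definition transport_model :: "('k \<Rightarrow> 'l) \<Rightarrow> 'k model_str \<Rightarrow> 'l model_str" where
  "transport_model \<phi> M = \<lparr>Weq = \<phi> ` Weq M, Cof = \<phi> ` Cof M, Fib = \<phi> ` Fib M\<rparr>"

lemma transport_model_simps [simp]:
  "Weq (transport_model \<phi> M) = \<phi> ` Weq M" "Cof (transport_model \<phi> M) = \<phi> ` Cof M"
  "Fib (transport_model \<phi> M) = \<phi> ` Fib M"
  by (simp_all add: transport_model_def)

lemma pushout_productD:
  assumes "pushout_product_axiom A MA B MB D MD T"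
    and "i \<in> Hom A a b" "i \<in> Cof MA" "k \<in> Hom B x y" "k \<in> Cof MB"
    and "is_pushout D (FArr T (Ide A a, k)) (FArr T (i, Ide B x)) P p q"
    and "u \<in> Hom D P (FObj T (b, y))"
    and "u \<cdot>\<^bsub>D\<^esub> p = FArr T (i, Ide B y)" "u \<cdot>\<^bsub>D\<^esub> q = FArr T (Ide A b, k)"
  shows "u \<in> Cof MD \<and> (i \<in> Weq MA \<or> k \<in> Weq MB \<longrightarrow> u \<in> Weq MD)"
  using assms(1)[unfolded pushout_product_axiom_def, rule_format, OF assms(2-9)] by blast

lemma pullback_powerD:
  assumes "pullback_power_axiom A MA B MB D MD H"
    and "i \<in> Hom B a b" "i \<in> Cof MB" "f \<in> Hom A x y" "f \<in> Fib MA"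
    and "is_pullback D (FArr H (f, Ide B a)) (FArr H (Ide A y, i)) P p q"
    and "u \<in> Hom D (FObj H (x, b)) P"
    and "p \<cdot>\<^bsub>D\<^esub> u = FArr H (Ide A x, i)" "q \<cdot>\<^bsub>D\<^esub> u = FArr H (f, Ide B b)"
  shows "u \<in> Fib MD \<and> (i \<in> Weq MB \<or> f \<in> Weq MA \<longrightarrow> u \<in> Weq MD)"
  using assms(1)[unfolded pullback_power_axiom_def, rule_format, OF assms(2-9)] by blast

context cat_iso
begin

lemma phi_image_iff: "S \<subseteq> Arr C \<Longrightarrow> f \<in> Arr C \<Longrightarrow> \<phi> f \<in> \<phi> ` S \<longleftrightarrow> f \<in> S"
  using phi_eq_iff by blast

lemma is_pushout_phi: "is_pushout C f g P p q \<Longrightarrow> is_pushout D (\<phi> f) (\<phi> g) P (\<phi> p) (\<phi> q)"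
  using cat_iso.is_pullback_phi[OF op, of f g P p q] by simp

lemma is_pullback_psi: "is_pullback D f g P p q \<Longrightarrow> is_pullback C (\<psi> f) (\<psi> g) P (\<psi> p) (\<psi> q)"
  by (rule cat_iso.is_pullback_phi[OF inverse])

lemma is_pushout_psi: "is_pushout D f g P p q \<Longrightarrow> is_pushout C (\<psi> f) (\<psi> g) P (\<psi> p) (\<psi> q)"
  by (rule cat_iso.is_pushout_phi[OF inverse])

lemma retract_of_phi:
  assumes "retract_of C f g" shows "retract_of D (\<phi> f) (\<phi> g)"
proof -
  obtain s r s' r' where *: "f \<in> Arr C" "g \<in> Arr C" "s \<in> Hom C (Dom C f) (Dom C g)" "r \<in> Hom C (Dom C g) (Dom C f)"
    "r \<cdot>\<^bsub>C\<^esub> s = Ide C (Dom C f)" "s' \<in> Hom C (Cod C f) (Cod C g)" "r' \<in> Hom C (Cod C g) (Cod C f)"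
    "r' \<cdot>\<^bsub>C\<^esub> s' = Ide C (Cod C f)" "g \<cdot>\<^bsub>C\<^esub> s = s' \<cdot>\<^bsub>C\<^esub> f" "f \<cdot>\<^bsub>C\<^esub> r = r' \<cdot>\<^bsub>C\<^esub> g"
    using assms unfolding retract_of_def by blast
  note h = HomD[OF *(3)] HomD[OF *(4)] HomD[OF *(6)] HomD[OF *(7)]
  show ?thesis
    by (rule retract_ofI[where s = "\<phi> s" and r = "\<phi> r" and s' = "\<phi> s'" and r' = "\<phi> r'"])
      (use * h in \<open>simp_all add: in_Hom flip: phi_cmp\<close>)
qed

lemma has_lifting_phi:
  assumes "has_lifting C i p" "i \<in> Arr C" "p \<in> Arr C"
  shows "has_lifting D (\<phi> i) (\<phi> p)"
  unfolding has_lifting_def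
proof (intro allI impI)
  fix u v assume u: "u \<in> Hom D (Dom D (\<phi> i)) (Dom D (\<phi> p))" and v: "v \<in> Hom D (Cod D (\<phi> i)) (Cod D (\<phi> p))"
    and eq: "\<phi> p \<cdot>\<^bsub>D\<^esub> u = v \<cdot>\<^bsub>D\<^esub> \<phi> i"
  obtain u' where u': "u' \<in> Hom C (Dom C i) (Dom C p)" "u = \<phi> u'" using u assms by (auto elim: hom_cases)
  obtain v' where v': "v' \<in> Hom C (Cod C i) (Cod C p)" "v = \<phi> v'" using v assms by (auto elim: hom_cases)
  note h = HomD[OF u'(1)] HomD[OF v'(1)]
  have "\<phi> (p \<cdot>\<^bsub>C\<^esub> u') = \<phi> (v' \<cdot>\<^bsub>C\<^esub> i)" using eq u'(2) v'(2) h assms by (simp add: phi_cmp)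
  then have "p \<cdot>\<^bsub>C\<^esub> u' = v' \<cdot>\<^bsub>C\<^esub> i" using h assms by (simp add: phi_eq_iff)
  then obtain k where k: "k \<in> Arr C" "Dom C k = Cod C i" "Cod C k = Dom C p" "k \<cdot>\<^bsub>C\<^esub> i = u'" "p \<cdot>\<^bsub>C\<^esub> k = v'"
    by (rule has_liftingD[OF assms(1) u'(1) v'(1)])
  then show "\<exists>h. h \<in> Hom D (Cod D (\<phi> i)) (Dom D (\<phi> p)) \<and> h \<cdot>\<^bsub>D\<^esub> \<phi> i = u \<and> \<phi> p \<cdot>\<^bsub>D\<^esub> h = v"
    using assms by (intro exI[of _ "\<phi> k"]) (simp add: in_Hom u'(2) v'(2) flip: phi_cmp)
qed

lemma small_cocomplete_phi:
  fixes s :: "'s itself"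
  assumes "small_complete s (op_cat C)"
  shows "small_cocomplete s D"
  unfolding small_cocomplete_def
proof (intro allI impI)
  fix J :: "('s, 's) cat" and K assume J: "category J" and K: "is_functor J D K"
  interpret K: is_functor J D K by fact
  have op_J: "category (op_cat J)" "category (op_cat D)"
    using category.category_op J D.category_axioms by auto
  have "is_functor (op_cat J) (op_cat D) K"
    by (rule is_functorI) (simp_all add: op_J in_Hom)
  then obtain L p where "is_limit (op_cat J) (op_cat D) K L p"
    using cat_iso.small_complete_phi[OF op assms] op_J(1) unfolding small_complete_def by meson
  then show "\<exists>L p. is_colimit J D K L p"
    by (auto simp: is_limit_op)
qed

lemma model_category_phi:
  assumes "model_category s C M"
  shows "model_category s D (transport_model \<phi> M)"
proof -
  interpret M: model_category s C M by fact
  interpret op: model_category s "op_cat C" "op_model M" by (rule M.op_model_category)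
  have cases: thesis if fh: "f \<in> Hom D x y" and th: "\<And>f'. f' \<in> Hom C x y \<Longrightarrow> f' \<in> Arr C \<Longrightarrow> Dom C f' = x \<Longrightarrow> Cod C f' = y \<Longrightarrow> f = \<phi> f' \<Longrightarrow> thesis"
    for f x y thesis
  proof -
    obtain f' where "f' \<in> Hom C x y" "f = \<phi> f'" using fh by (rule hom_cases)
    then show thesis using th[of f'] by (simp add: in_Hom)
  qed
  have sub: "Weq M \<subseteq> Arr C" "Cof M \<subseteq> Arr C" "Fib M \<subseteq> Arr C" by auto
  note iff = phi_image_iff[OF sub(1)] phi_image_iff[OF sub(2)] phi_image_iff[OF sub(3)]
  have retract: "f \<in> \<phi> ` S" if "retract_of D f g" "g \<in> \<phi> ` S" "S \<subseteq> Arr C"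
    "\<And>f g. retract_of C f g \<Longrightarrow> g \<in> S \<Longrightarrow> f \<in> S" for f g S
  proof -
    have "retract_of C (\<psi> f) (\<psi> g)" using cat_iso.retract_of_phi[OF inverse that(1)] .
    moreover have "\<psi> g \<in> S" using that(2,3) by auto
    ultimately have "\<psi> f \<in> S" using that(4) by blast
    moreover have "f \<in> Arr D" using that(1) by (simp add: retract_of_def)
    ultimately show ?thesis by (metis imageI psi_simps(2))
  qed
  show ?thesis
  proof
    show "small_complete s D" using M.complete by (rule small_complete_phi)
    show "small_cocomplete s D" using op.complete by (rule small_cocomplete_phi)
    show "Weq (transport_model \<phi> M) \<subseteq> Arr D" "Cof (transport_model \<phi> M) \<subseteq> Arr D"
      "Fib (transport_model \<phi> M) \<subseteq> Arr D" by auto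
  next
    fix f x y g z assume fg: "f \<in> Hom D x y" "g \<in> Hom D y z"
    obtain f' where f': "f' \<in> Arr C" "Dom C f' = x" "Cod C f' = y" "f = \<phi> f'" using cases[OF fg(1)] by blast
    obtain g' where g': "g' \<in> Arr C" "Dom C g' = y" "Cod C g' = z" "g = \<phi> g'" using cases[OF fg(2)] by blast
    have gf: "g \<cdot>\<^bsub>D\<^esub> f = \<phi> (g' \<cdot>\<^bsub>C\<^esub> f')" using f' g' by (simp add: phi_cmp)
    have iffs: "f \<in> \<phi> ` Weq M \<longleftrightarrow> f' \<in> Weq M" "g \<in> \<phi> ` Weq M \<longleftrightarrow> g' \<in> Weq M"
      "g \<cdot>\<^bsub>D\<^esub> f \<in> \<phi> ` Weq M \<longleftrightarrow> g' \<cdot>\<^bsub>C\<^esub> f' \<in> Weq M"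
      unfolding gf unfolding f'(4) g'(4) using f'(1-3) g'(1-3) by (simp_all add: iff)
    show "f \<in> Weq (transport_model \<phi> M) \<Longrightarrow> g \<in> Weq (transport_model \<phi> M) \<Longrightarrow> g \<cdot>\<^bsub>D\<^esub> f \<in> Weq (transport_model \<phi> M)"
      "f \<in> Weq (transport_model \<phi> M) \<Longrightarrow> g \<cdot>\<^bsub>D\<^esub> f \<in> Weq (transport_model \<phi> M) \<Longrightarrow> g \<in> Weq (transport_model \<phi> M)"
      "g \<in> Weq (transport_model \<phi> M) \<Longrightarrow> g \<cdot>\<^bsub>D\<^esub> f \<in> Weq (transport_model \<phi> M) \<Longrightarrow> f \<in> Weq (transport_model \<phi> M)"
      unfolding transport_model_simps iffs using M.weq_cmp[of f' g'] f'(1-3) g'(1-3) by simp_all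
  next
    fix f g assume r: "retract_of D f g"
    show "g \<in> Weq (transport_model \<phi> M) \<Longrightarrow> f \<in> Weq (transport_model \<phi> M)"
      unfolding transport_model_simps by (erule retract[OF r _ sub(1)], erule (1) M.retracts(1))
    show "g \<in> Cof (transport_model \<phi> M) \<Longrightarrow> f \<in> Cof (transport_model \<phi> M)"
      unfolding transport_model_simps by (erule retract[OF r _ sub(2)], erule (1) M.retracts(2))
    show "g \<in> Fib (transport_model \<phi> M) \<Longrightarrow> f \<in> Fib (transport_model \<phi> M)"
      unfolding transport_model_simps by (erule retract[OF r _ sub(3)], erule (1) M.retracts(3))
  next
    fix i p assume "i \<in> Cof (transport_model \<phi> M)" "p \<in> Fib (transport_model \<phi> M)"
      and w: "i \<in> Weq (transport_model \<phi> M) \<or> p \<in> Weq (transport_model \<phi> M)"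
    then obtain i' p' where ip: "i' \<in> Cof M" "i = \<phi> i'" "p' \<in> Fib M" "p = \<phi> p'" by auto
    then have "i' \<in> Weq M \<or> p' \<in> Weq M" using w by (simp add: iff)
    then have "has_lifting C i' p'" using ip by (simp add: M.lifting)
    then show "has_lifting D i p" using ip by (simp add: has_lifting_phi)
  next
    fix f x y assume "f \<in> Hom D x y"
    then obtain f' where f': "f' \<in> Hom C x y" "f = \<phi> f'" by (rule hom_cases)
    obtain z i p where 1: "i \<in> Hom C x z" "p \<in> Hom C z y" "p \<cdot>\<^bsub>C\<^esub> i = f'" "i \<in> Cof M" "p \<in> Fib M \<inter> Weq M"
      using M.factorization(1)[OF f'(1)] by blast
    obtain z' i' p' where 2: "i' \<in> Hom C x z'" "p' \<in> Hom C z' y" "p' \<cdot>\<^bsub>C\<^esub> i' = f'" "i' \<in> Cof M \<inter> Weq M" "p' \<in> Fib M"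
      using M.factorization(2)[OF f'(1)] by blast
    note h = HomD[OF 1(1)] HomD[OF 1(2)] HomD[OF 2(1)] HomD[OF 2(2)]
    show "\<exists>z i p. i \<in> Hom D x z \<and> p \<in> Hom D z y \<and> p \<cdot>\<^bsub>D\<^esub> i = f \<and> i \<in> Cof (transport_model \<phi> M)
        \<and> p \<in> Fib (transport_model \<phi> M) \<inter> Weq (transport_model \<phi> M)"
      by (rule exI[of _ z], rule exI[of _ "\<phi> i"], rule exI[of _ "\<phi> p"])
        (use 1 h f'(2) in \<open>simp add: in_Hom flip: phi_cmp\<close>)
    show "\<exists>z i p. i \<in> Hom D x z \<and> p \<in> Hom D z y \<and> p \<cdot>\<^bsub>D\<^esub> i = f
        \<and> i \<in> Cof (transport_model \<phi> M) \<inter> Weq (transport_model \<phi> M) \<and> p \<in> Fib (transport_model \<phi> M)"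
      by (rule exI[of _ z'], rule exI[of _ "\<phi> i'"], rule exI[of _ "\<phi> p'"])
        (use 2 h f'(2) in \<open>simp add: in_Hom flip: phi_cmp\<close>)
  qed
qed

lemma cofibrant_phi:
  assumes "Cof M \<subseteq> Arr C"
  shows "cofibrant D (transport_model \<phi> M) x \<longleftrightarrow> cofibrant C M x"
proof -
  have "(\<exists>f. f \<in> Hom D i x \<and> f \<in> \<phi> ` Cof M) \<longleftrightarrow> (\<exists>f. f \<in> Hom C i x \<and> f \<in> Cof M)" for i
    using assms by (force simp: in_Hom)
  then show ?thesis by (simp add: cofibrant_def initial_obj_phi)
qed

lemma fibrant_phi:
  assumes "Fib M \<subseteq> Arr C"
  shows "fibrant D (transport_model \<phi> M) x \<longleftrightarrow> fibrant C M x"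
proof -
  have "(\<exists>f. f \<in> Hom D x i \<and> f \<in> \<phi> ` Fib M) \<longleftrightarrow> (\<exists>f. f \<in> Hom C x i \<and> f \<in> Fib M)" for i
    using assms by (force simp: in_Hom)
  then show ?thesis by (simp add: fibrant_def terminal_obj_phi)
qed

text \<open>
  The restriction of a bifunctor along \<open>L\<close> in the second variable. A contravariant second variable
  is covered by taking \<open>L\<close> between opposite categories, which leaves its data unchanged.
\<close>

definition transport_func :: "('b, 'r, 'p, 't) func \<Rightarrow> ('o \<times> 'p, 'k \<times> 't, 'o, 'k) func \<Rightarrow> ('o \<times> 'b, 'l \<times> 'r, 'o, 'l) func" where
  "transport_func L T = \<lparr>FObj = (\<lambda>(x, w). FObj T (x, FObj L w)),
     FArr = (\<lambda>(f, k). \<phi> (FArr T (\<psi> f, FArr L k)))\<rparr>"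

lemma transport_func_simps [simp]:
  "FObj (transport_func L T) (x, w) = FObj T (x, FObj L w)"
  "FArr (transport_func L T) (f, k) = \<phi> (FArr T (\<psi> f, FArr L k))"
  by (simp_all add: transport_func_def)

lemma is_functor_transport:
  assumes L: "is_functor B' B L" and T: "is_functor (prod_cat C B) C T"
  shows "is_functor (prod_cat D B') D (transport_func L T)"
proof -
  interpret L: is_functor B' B L by fact
  interpret T: is_functor "prod_cat C B" C T by fact
  show ?thesis
  proof (rule is_functorI)
    show "category (prod_cat D B')" using D.category_axioms L.A.category_axioms by (rule category_prod)
    show "category D" by (rule D.category_axioms)
  next
    fix X assume "X \<in> Obj (prod_cat D B')"
    then obtain x b where X: "X = (x, b)" "x \<in> Obj C" "b \<in> Obj B'" by (auto simp: obj_eq)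
    show "FObj (transport_func L T) X \<in> Obj D"
      using X T.F_simps(1)[of "(x, FObj L b)"] by (simp add: obj_eq)
    show "FArr (transport_func L T) (Ide (prod_cat D B') X) = Ide D (FObj (transport_func L T) X)"
      using X T.F_simps(1,5)[of "(x, FObj L b)"] by simp
  next
    fix F assume "F \<in> Arr (prod_cat D B')"
    then obtain f b where F: "F = (f, b)" "f \<in> Arr D" "b \<in> Arr B'" by auto
    show "FArr (transport_func L T) F \<in> Hom D (FObj (transport_func L T) (Dom (prod_cat D B') F))
        (FObj (transport_func L T) (Cod (prod_cat D B') F))"
      using F T.F_simps(2-4)[of "(\<psi> f, FArr L b)"] by (simp add: in_Hom)
  next
    fix F G assume "F \<in> Arr (prod_cat D B')" "G \<in> Arr (prod_cat D B')"
      "Dom (prod_cat D B') G = Cod (prod_cat D B') F"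
    then obtain f b g c where F: "F = (f, b)" "f \<in> Arr D" "b \<in> Arr B'"
      and G: "G = (g, c)" "g \<in> Arr D" "c \<in> Arr B'" "Dom D g = Cod D f" "Dom B' c = Cod B' b" by auto
    show "FArr (transport_func L T) (G \<cdot>\<^bsub>prod_cat D B'\<^esub> F)
        = FArr (transport_func L T) G \<cdot>\<^bsub>D\<^esub> FArr (transport_func L T) F"
      using F G T.F_cmp'[of "(\<psi> f, FArr L b)" "(\<psi> g, FArr L c)"] T.F_simps(2-4)[of "(\<psi> f, FArr L b)"]
        T.F_simps(2-4)[of "(\<psi> g, FArr L c)"] by (simp add: psi_cmp phi_cmp)
  qed
qed

text \<open>
  The pushout-product and pullback-power axioms are inherited by restriction along a functor \<open>L\<close>
  that preserves cofibrations and acyclic cofibrations.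
\<close>

lemma pushout_product_transport:
  assumes M: "model_category s C M" and L: "is_functor W V L" and T: "is_functor (prod_cat C V) C T"
    and cof: "\<And>k. k \<in> Cof MW \<Longrightarrow> k \<in> Arr W \<and> FArr L k \<in> Cof MV"
    and acof: "\<And>k. k \<in> Cof MW \<Longrightarrow> k \<in> Weq MW \<Longrightarrow> FArr L k \<in> Weq MV"
    and ppa: "pushout_product_axiom C M V MV C M T"
  shows "pushout_product_axiom D (transport_model \<phi> M) W MW D (transport_model \<phi> M) (transport_func L T)"
  unfolding pushout_product_axiom_def
proof (intro allI impI)
  interpret M: model_category s C M by fact
  interpret L: is_functor W V L by fact
  interpret T: is_functor "prod_cat C V" C T by fact
  fix a b i x y k P p q u
  let ?M = "transport_model \<phi> M" and ?T = "transport_func L T"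
  assume i: "i \<in> Hom D a b" "i \<in> Cof ?M" and k: "k \<in> Hom W x y" "k \<in> Cof MW"
    and po: "is_pushout D (FArr ?T (Ide D a, k)) (FArr ?T (i, Ide W x)) P p q"
    and u: "u \<in> Hom D P (FObj ?T (b, y))" "u \<cdot>\<^bsub>D\<^esub> p = FArr ?T (i, Ide W y)" "u \<cdot>\<^bsub>D\<^esub> q = FArr ?T (Ide D b, k)"
  obtain i' where i': "i' \<in> Cof M" "i = \<phi> i'" using i(2) by auto
  have i'': "i' \<in> Arr C" "Dom C i' = a" "Cod C i' = b" using i(1) i' by (simp_all add: in_Hom)
  note k' = HomD[OF k(1)] and u' = HomD[OF u(1)]
  have o: "x \<in> Obj W" "y \<in> Obj W" "a \<in> Obj C" "b \<in> Obj C" using k' i'' by auto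
  have arrs: "FArr T (i', Ide V (FObj L y)) \<in> Arr C" "FArr T (Ide C b, FArr L k) \<in> Arr C"
    "FArr T (Ide C a, FArr L k) \<in> Arr C" "FArr T (i', Ide V (FObj L x)) \<in> Arr C"
    using T.F_simps(2)[of "(i', Ide V (FObj L y))"] T.F_simps(2)[of "(Ide C b, FArr L k)"]
      T.F_simps(2)[of "(Ide C a, FArr L k)"] T.F_simps(2)[of "(i', Ide V (FObj L x))"] i'' k' o by simp_all
  have po': "is_pushout C (FArr T (Ide C a, FArr L k)) (FArr T (i', Ide V (FObj L x))) P (\<psi> p) (\<psi> q)"
    using is_pushout_psi[OF po] i'' o arrs by (simp add: i'(2))
  have pq: "p \<in> Arr D" "q \<in> Arr D" "Cod D p = P" "Cod D q = P"
    using po unfolding is_pushout_def in_Hom by auto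
  have "\<psi> u \<cdot>\<^bsub>C\<^esub> \<psi> p = FArr T (i', Ide V (FObj L y))" "\<psi> u \<cdot>\<^bsub>C\<^esub> \<psi> q = FArr T (Ide C b, FArr L k)"
    using u(2,3) pq u' i'' o arrs by (simp_all add: i'(2) flip: psi_cmp)
  note u_eq = this
  have "i' \<in> Hom C a b" "FArr L k \<in> Hom V (FObj L x) (FObj L y)" "FArr L k \<in> Cof MV"
    "\<psi> u \<in> Hom C P (FObj T (b, FObj L y))"
    using i'' k' cof[OF k(2)] psi_hom[OF u(1)] by (simp_all add: in_Hom)
  then have "\<psi> u \<in> Cof M \<and> (i' \<in> Weq M \<or> FArr L k \<in> Weq MV \<longrightarrow> \<psi> u \<in> Weq M)"
    using pushout_productD[OF ppa _ i'(1) _ _ po' _ u_eq] by blast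
  moreover have "i \<in> \<phi> ` Weq M \<longleftrightarrow> i' \<in> Weq M"
    unfolding i'(2) using i'' by (intro phi_image_iff) auto
  moreover have "u = \<phi> (\<psi> u)" using u' by simp
  ultimately show "u \<in> Cof ?M \<and> (i \<in> Weq ?M \<or> k \<in> Weq MW \<longrightarrow> u \<in> Weq ?M)"
    using acof[OF k(2)] by auto
qed

lemma pullback_power_transport:
  assumes M: "model_category s C M" and L: "is_functor W V L" and T: "is_functor (prod_cat C (op_cat V)) C T"
    and cof: "\<And>k. k \<in> Cof MW \<Longrightarrow> k \<in> Arr W \<and> FArr L k \<in> Cof MV"
    and acof: "\<And>k. k \<in> Cof MW \<Longrightarrow> k \<in> Weq MW \<Longrightarrow> FArr L k \<in> Weq MV"
    and ppa: "pullback_power_axiom C M V MV C M T"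
  shows "pullback_power_axiom D (transport_model \<phi> M) W MW D (transport_model \<phi> M) (transport_func L T)"
  unfolding pullback_power_axiom_def
proof (intro allI impI)
  interpret M: model_category s C M by fact
  interpret L: is_functor W V L by fact
  interpret T: is_functor "prod_cat C (op_cat V)" C T by fact
  fix a b i x y f P p q u
  let ?M = "transport_model \<phi> M" and ?T = "transport_func L T"
  assume i: "i \<in> Hom W a b" "i \<in> Cof MW" and f: "f \<in> Hom D x y" "f \<in> Fib ?M"
    and pb: "is_pullback D (FArr ?T (f, Ide W a)) (FArr ?T (Ide D y, i)) P p q"
    and u: "u \<in> Hom D (FObj ?T (x, b)) P" "p \<cdot>\<^bsub>D\<^esub> u = FArr ?T (Ide D x, i)" "q \<cdot>\<^bsub>D\<^esub> u = FArr ?T (f, Ide W b)"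
  obtain f' where f': "f' \<in> Fib M" "f = \<phi> f'" using f(2) by auto
  have f'': "f' \<in> Arr C" "Dom C f' = x" "Cod C f' = y" using f(1) f' by (simp_all add: in_Hom)
  note i' = HomD[OF i(1)] and u' = HomD[OF u(1)]
  have o: "a \<in> Obj W" "b \<in> Obj W" "x \<in> Obj C" "y \<in> Obj C" using i' f'' by auto
  have arrs: "FArr T (f', Ide V (FObj L a)) \<in> Arr C" "FArr T (Ide C y, FArr L i) \<in> Arr C"
    "FArr T (Ide C x, FArr L i) \<in> Arr C" "FArr T (f', Ide V (FObj L b)) \<in> Arr C"
    using T.F_simps(2)[of "(f', Ide V (FObj L a))"] T.F_simps(2)[of "(Ide C y, FArr L i)"]
      T.F_simps(2)[of "(Ide C x, FArr L i)"] T.F_simps(2)[of "(f', Ide V (FObj L b))"] f'' i' o by simp_all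
  have pb': "is_pullback C (FArr T (f', Ide V (FObj L a))) (FArr T (Ide C y, FArr L i)) P (\<psi> p) (\<psi> q)"
    using is_pullback_psi[OF pb] f'' o arrs by (simp add: f'(2))
  have pq: "p \<in> Arr D" "q \<in> Arr D" "Dom D p = P" "Dom D q = P"
    using pb unfolding is_pullback_def in_Hom by auto
  have "\<psi> p \<cdot>\<^bsub>C\<^esub> \<psi> u = FArr T (Ide C x, FArr L i)" "\<psi> q \<cdot>\<^bsub>C\<^esub> \<psi> u = FArr T (f', Ide V (FObj L b))"
    using u(2,3) pq u' f'' o arrs by (simp_all add: f'(2) flip: psi_cmp)
  note u_eq = this
  have "f' \<in> Hom C x y" "FArr L i \<in> Hom (op_cat V) (FObj L b) (FObj L a)" "FArr L i \<in> Cof MV"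
    "\<psi> u \<in> Hom C (FObj T (x, FObj L b)) P"
    using f'' i' cof[OF i(2)] psi_hom[OF u(1)] by (simp_all add: in_Hom)
  then have "\<psi> u \<in> Fib M \<and> (FArr L i \<in> Weq MV \<or> f' \<in> Weq M \<longrightarrow> \<psi> u \<in> Weq M)"
    using pullback_powerD[OF ppa _ _ _ f'(1) pb' _ u_eq] by simp
  moreover have "f \<in> \<phi> ` Weq M \<longleftrightarrow> f' \<in> Weq M"
    unfolding f'(2) using f'' by (intro phi_image_iff) auto
  moreover have "u = \<phi> (\<psi> u)" using u' by simp
  ultimately show "u \<in> Fib ?M \<and> (i \<in> Weq MW \<or> f \<in> Weq ?M \<longrightarrow> u \<in> Weq ?M)"
    using acof[OF i(2)] by auto
qed

end

lemma (in category) pullback_comparison: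
  assumes P: "is_pullback C f g P p q" and P': "is_pullback C f g P' p' q'"
  obtains c where "is_iso C c" "Dom C c = P'" "Cod C c = P" "p \<cdot> c = p'" "q \<cdot> c = q'"
proof -
  note h = is_pullback_hom[OF P] and h' = is_pullback_hom[OF P']
  obtain c where c: "c \<in> Arr C" "Dom C c = P'" "Cod C c = P" "p \<cdot> c = p'" "q \<cdot> c = q'"
    using is_pullback_lift[OF P, of p' P' q'] h h' by (auto simp: in_Hom)
  obtain d where d: "d \<in> Arr C" "Dom C d = P" "Cod C d = P'" "p' \<cdot> d = p" "q' \<cdot> d = q"
    using is_pullback_lift[OF P', of p P q] h h' by (auto simp: in_Hom)
  have o: "P \<in> Obj C" "P' \<in> Obj C" using c by auto
  have "c \<cdot> d = Ide C P"
    by (rule is_pullback_unique[OF P]) (use c d o h in \<open>simp_all add: pull[OF c(4)] pull[OF c(5)]\<close>)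
  moreover have "d \<cdot> c = Ide C P'"
    by (rule is_pullback_unique[OF P']) (use c d o h' in \<open>simp_all add: pull[OF d(4)] pull[OF d(5)]\<close>)
  ultimately have "is_iso C c"
    using c d by (intro is_isoI(1)[of c P' P d]) (simp_all add: in_Hom)
  then show ?thesis using c that by blast
qed


section \<open>The induced weak tensoring and cotensoring\<close>

lemma ehom_functor_simps [simp]:
  "FObj (ehom_functor V C) (y, x) = EHom C x y" "FArr (ehom_functor V C) (g, f) = ehom_arr V C f g"
  by (simp_all add: ehom_functor_def)

locale base_change_setting = weak_quillen_setting s W MW V MV A + C: sm7_model_category s V MV C M
  for s :: "'s itself" and W :: "('w, 'n) mon_cat" and MW :: "'n model_str"
    and V :: "('v, 'm) mon_cat" and MV :: "'m model_str" and A :: "('w, 'n, 'v, 'm) lax_adj"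
    and C :: "('c, 'v, 'm) ecat" and M :: "('c \<times> 'm \<times> 'c) model_str" +
  assumes eps: "is_iso V (oplax_unit V A)"
begin

sublocale lax_adjunction_enriched W V A C
  by unfold_locales (rule eps)

sublocale I: cat_iso "underlying V C" "underlying W (base_change W A C)" "base_arr W A"
  by (rule base_iso) (rule C.underlying.category_axioms)

abbreviation "M' \<equiv> base_model W A M"

lemma base_model_eq: "M' = transport_model \<phi> M"
  by (simp add: base_model_def transport_model_def)

lemma unbase_eq: "\<psi> = inv_into (Arr U) \<phi>"
  by (simp add: unbase_arr_def fun_eq_iff)

sublocale E: enriched_category W "base_change W A C"
  by (rule base_change_enriched)

sublocale U': model_category s "underlying W (base_change W A C)" "base_model W A M"
  unfolding base_model_eq by (rule I.model_category_phi) (rule C.underlying.model_category_axioms)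

lemma cofibrant_base: "cofibrant U' M' x \<longleftrightarrow> cofibrant U M x"
  unfolding base_model_eq by (rule I.cofibrant_phi) (rule C.underlying.cof_arr)

lemma fibrant_base: "fibrant U' M' x \<longleftrightarrow> fibrant U M x"
  unfolding base_model_eq by (rule I.fibrant_phi) (rule C.underlying.fib_arr)

lemma ehom_base: "F \<in> Arr U \<Longrightarrow> G \<in> Arr U \<Longrightarrow> ehom_arr W D (\<phi> F) (\<phi> G) = Ga (ehom_arr V C F G)"
  by (rule ehom_arr_base[OF _ _ C.underlying.category_axioms])

text \<open>
  \<open>G\<close> preserves pullbacks and (acyclic) fibrations. The pullback in \<open>W\<close> is that of a pullback in \<open>V\<close>,
  up to isomorphism.
\<close>

lemma base_sm7_power: "pullback_power_axiom U' M' U' M' W MW (ehom_functor W D)"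
  unfolding pullback_power_axiom_def
proof (intro allI impI)
  fix a b i x y f P p q u
  assume i: "i \<in> Hom U' a b" "i \<in> Cof M'" and f: "f \<in> Hom U' x y" "f \<in> Fib M'"
    and pb: "is_pullback W (FArr (ehom_functor W D) (f, Ide U' a)) (FArr (ehom_functor W D) (Ide U' y, i)) P p q"
    and u: "u \<in> Hom W (FObj (ehom_functor W D) (x, b)) P"
      "p \<cdot>\<^bsub>W\<^esub> u = FArr (ehom_functor W D) (Ide U' x, i)" "q \<cdot>\<^bsub>W\<^esub> u = FArr (ehom_functor W D) (f, Ide U' b)"
  obtain i' where i': "i' \<in> Cof M" "i = \<phi> i'" using i(2) by (auto simp: base_model_eq)
  obtain f' where f': "f' \<in> Fib M" "f = \<phi> f'" using f(2) by (auto simp: base_model_eq)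
  have ih: "i' \<in> Arr U" "Dom U i' = a" "Cod U i' = b" using i(1) i' by (simp_all add: in_Hom)
  have fh: "f' \<in> Arr U" "Dom U f' = x" "Cod U f' = y" using f(1) f' by (simp_all add: in_Hom)
  have o: "a \<in> EObj C" "b \<in> EObj C" "x \<in> EObj C" "y \<in> EObj C"
    using C.arr_obj[OF ih(1)] C.arr_obj[OF fh(1)] ih fh by simp_all
  have ide: "Ide U z \<in> Arr U" "Ide U' z = \<phi> (Ide U z)" if "z \<in> EObj C" for z
    using that by simp_all
  let ?e = "ehom_arr V C"
  have eq: "ehom_arr W D (Ide U' a) f = Ga (?e (Ide U a) f')" "ehom_arr W D i (Ide U' y) = Ga (?e i' (Ide U y))"
    "ehom_arr W D i (Ide U' x) = Ga (?e i' (Ide U x))" "ehom_arr W D (Ide U' b) f = Ga (?e (Ide U b) f')"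
    unfolding ide(2)[OF o(1)] ide(2)[OF o(2)] ide(2)[OF o(3)] ide(2)[OF o(4)] i'(2) f'(2)
    using o ih fh by (simp_all only: ehom_base ide(1))
  have ops: "?e (Ide U a) f' = postcomp V C a f'" "?e i' (Ide U y) = precomp V C i' y"
    "?e i' (Ide U x) = precomp V C i' x" "?e (Ide U b) f' = postcomp V C b f'"
    using o ih fh by (simp_all add: C.ehom_arr_ide)
  have ty: "?e (Ide U a) f' \<in> Hom V (EHom C a x) (EHom C a y)" "?e i' (Ide U y) \<in> Hom V (EHom C b y) (EHom C a y)"
    "?e i' (Ide U x) \<in> Hom V (EHom C b x) (EHom C a x)" "?e (Ide U b) f' \<in> Hom V (EHom C b x) (EHom C b y)"
    unfolding ops using o ih fh by (simp_all add: in_Hom)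
  note tyh = HomD[OF ty(1)] HomD[OF ty(2)] HomD[OF ty(3)] HomD[OF ty(4)]
  obtain Q r t where Q: "is_pullback V (?e (Ide U a) f') (?e i' (Ide U y)) Q r t"
    using V.pullback_exists[OF inf tyh(1) tyh(4)] tyh by auto
  have sq: "?e (Ide U a) f' \<cdot>\<^bsub>V\<^esub> ?e i' (Ide U x) = ?e i' (Ide U y) \<cdot>\<^bsub>V\<^esub> ?e (Ide U b) f'"
    unfolding ops using C.postcomp_precomp[OF ih(1) fh(1)] ih fh by simp
  obtain v where v: "v \<in> Arr V" "Dom V v = EHom C b x" "Cod V v = Q"
    "r \<cdot>\<^bsub>V\<^esub> v = ?e i' (Ide U x)" "t \<cdot>\<^bsub>V\<^esub> v = ?e (Ide U b) f'"
    using is_pullback_lift[OF Q _ _ sq] ty tyh by metis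
  have v_fib: "v \<in> Fib MV \<and> (i' \<in> Weq M \<or> f' \<in> Weq M \<longrightarrow> v \<in> Weq MV)"
    by (rule pullback_powerD[OF C.sm7, where a = a and b = b and x = x and y = y and P = Q and p = r and q = t])
      (use ih fh i' f' Q v in \<open>simp_all add: in_Hom\<close>)
  have GQ: "is_pullback W (Ga (?e (Ide U a) f')) (Ga (?e i' (Ide U y))) (Go Q) (Ga r) (Ga t)"
    by (rule right_pullback[OF Q])
  have pb': "is_pullback W (Ga (?e (Ide U a) f')) (Ga (?e i' (Ide U y))) P p q"
    using pb by (simp add: eq)
  obtain c where c: "is_iso W c" "Dom W c = Go Q" "Cod W c = P" "p \<cdot>\<^bsub>W\<^esub> c = Ga r" "q \<cdot>\<^bsub>W\<^esub> c = Ga t"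
    by (rule W.pullback_comparison[OF pb' GQ])
  have ca: "c \<in> Arr W" using c(1) by simp
  note pbh = is_pullback_hom[OF pb'] and Qh = is_pullback_hom[OF Q] and uh = HomD[OF u(1)]
  have "p \<cdot>\<^bsub>W\<^esub> (c \<cdot>\<^bsub>W\<^esub> Ga v) = Ga (r \<cdot>\<^bsub>V\<^esub> v)" "q \<cdot>\<^bsub>W\<^esub> (c \<cdot>\<^bsub>W\<^esub> Ga v) = Ga (t \<cdot>\<^bsub>V\<^esub> v)"
    using v(1-3) Qh pbh c(2,3) ca by (simp_all add: W.pull[OF c(4)] W.pull[OF c(5)])
  then have "p \<cdot>\<^bsub>W\<^esub> u = p \<cdot>\<^bsub>W\<^esub> (c \<cdot>\<^bsub>W\<^esub> Ga v)" "q \<cdot>\<^bsub>W\<^esub> u = q \<cdot>\<^bsub>W\<^esub> (c \<cdot>\<^bsub>W\<^esub> Ga v)"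
    unfolding v(4,5) using u(2,3) by (simp_all add: eq)
  then have uc: "u = c \<cdot>\<^bsub>W\<^esub> Ga v"
    using W.is_pullback_unique[OF pb', of u "c \<cdot>\<^bsub>W\<^esub> Ga v"] uh v(1-3) c(2,3) ca by simp
  have fib: "u \<in> Fib MW"
    unfolding uc using v_fib v(1-3) c W.iso_model(3)[OF c(1)] Q.right_fib by (intro W.fib_cmp) simp_all
  have weq: "u \<in> Weq MW" if "i' \<in> Weq M \<or> f' \<in> Weq M"
    unfolding uc using that v_fib v(1-3) c ca W.iso_model(1)[OF c(1)] Q.right_acyclic_fib
    by (intro W.weq_cmp(1)) simp_all
  have "i \<in> Weq M' \<longleftrightarrow> i' \<in> Weq M" "f \<in> Weq M' \<longleftrightarrow> f' \<in> Weq M"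
    unfolding base_model_eq i'(2) f'(2) transport_model_simps
    using ih fh I.phi_image_iff[OF C.underlying.weq_arr] by auto
  then show "u \<in> Fib MW \<and> (i \<in> Weq M' \<or> f \<in> Weq M' \<longrightarrow> u \<in> Weq MW)"
    using fib weq by blast
qed

lemma base_sm7: "sm7_model_category s W MW D M'"
proof
  show "pullback_power_axiom U' M' U' M' W MW (ehom_functor W D)" by (rule base_sm7_power)
  show "fibrant W MW (EHom D x y)" if "cofibrant U' M' x" "fibrant U' M' y" for x y
    using that C.sm7_fibrant Q.right_fibrant by (simp add: cofibrant_base fibrant_base)
qed

lemma cofibrant_obj: "cofibrant U M x \<Longrightarrow> x \<in> EObj C" "cofibrant W MW w \<Longrightarrow> w \<in> Obj W"
proof -
  show "x \<in> EObj C" if "cofibrant U M x"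
  proof -
    obtain i f where "f \<in> Hom U i x" using \<open>cofibrant U M x\<close> unfolding cofibrant_def by blast
    from HomD[OF this] show ?thesis using C.arr_obj(2)[of f] by simp
  qed
qed (auto simp: cofibrant_def in_Hom)

lemma fibrant_eobj: "fibrant U M y \<Longrightarrow> y \<in> EObj C"
  using C.underlying.fibrant_obj by simp

text \<open>
  The elements of \<open>G d\<close> and of \<open>d\<close> agree, and \<open>\<theta>\<close> is bijective on elements; so a map into an internal
  hom that is bijective on elements stays so.
\<close>

lemma theta_cmp_elements:
  assumes w: "w \<in> Obj W" and d: "d \<in> Obj V" and f: "f \<in> Hom V c (IHom V (Fo w) d)"
    and bij: "bij_betw (\<lambda>g. f \<cdot>\<^bsub>V\<^esub> g) (Hom V (Unit V) c) (Hom V (Unit V) (IHom V (Fo w) d))"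
  shows "bij_betw (\<lambda>g. (\<theta> w d \<cdot>\<^bsub>W\<^esub> Ga f) \<cdot>\<^bsub>W\<^esub> g) (Hom W (Unit W) (Go c)) (Hom W (Unit W) (IHom W w (Go d)))"
proof -
  note f' = HomD[OF f]
  have c: "c \<in> Obj V" using f' by auto
  let ?b = "\<lambda>g. Ga g \<cdot>\<^bsub>W\<^esub> \<iota>" and ?h = "\<lambda>g. (\<theta> w d \<cdot>\<^bsub>W\<^esub> Ga f) \<cdot>\<^bsub>W\<^esub> g"
  have "bij_betw ((\<lambda>f. \<theta> w d \<cdot>\<^bsub>W\<^esub> Ga f \<cdot>\<^bsub>W\<^esub> \<iota>) \<circ> (\<lambda>g. f \<cdot>\<^bsub>V\<^esub> g)) (Hom V (Unit V) c) (Hom W (Unit W) (IHom W w (Go d)))"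
    using bij theta_elements[OF w d] by (rule bij_betw_trans)
  then have "bij_betw (?h \<circ> ?b) (Hom V (Unit V) c) (Hom W (Unit W) (IHom W w (Go d)))"
    by (rule bij_betw_cong[THEN iffD1, rotated]) (use f' w d in \<open>simp add: in_Hom\<close>)
  then show ?thesis
    using bij_betw_comp_iff[OF base_arr_elements[OF c]] by blast
qed

lemma cmp_base:
  "F \<in> Arr U \<Longrightarrow> G \<in> Arr U \<Longrightarrow> Dom U G = Cod U F \<Longrightarrow> \<phi> G \<cdot>\<^bsub>U'\<^esub> \<phi> F = \<phi> (G \<cdot>\<^bsub>U\<^esub> F)"
  by (rule I.cmp_eq)

context
  fixes T :: "('c, 'c \<times> 'm \<times> 'c, 'v, 'm) tensoring"
  assumes wt: "weak_tensoring s V MV C M T"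
begin

interpretation T: weak_tensoring s V MV C M T
  by (rule wt)

interpretation TF: is_functor "prod_cat (underlying V C) V" "underlying V C" "TFun T"
  by (rule T.tensor_functor)

abbreviation "T' \<equiv> induced_tensoring W V A C T"

lemma induced_tensoring_simps:
  "TFun T' = I.transport_func (LeftF A) (TFun T)"
  "TPhi T' w x y = \<theta> w (EHom C x y) \<cdot>\<^bsub>W\<^esub> Ga (TPhi T (Fo w) x y)"
  "TRho T' x = \<phi> (TRho T x \<cdot>\<^bsub>U\<^esub> FArr (TFun T) (Ide U x, \<epsilon>))"
  by (simp_all add: induced_tensoring_def I.transport_func_def unbase_eq)

lemma tensor_arr [simp]:
  assumes "F \<in> Arr U" "k \<in> Arr V"
  shows "FArr (TFun T) (F, k) \<in> Arr U" "Dom U (FArr (TFun T) (F, k)) = FObj (TFun T) (Dom U F, Dom V k)"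
    "Cod U (FArr (TFun T) (F, k)) = FObj (TFun T) (Cod U F, Cod V k)"
  using TF.F_simps(2-4)[of "(F, k)"] assms by simp_all

lemma tensor_cmp:
  "F \<in> Arr U \<Longrightarrow> k \<in> Arr V \<Longrightarrow> G \<in> Arr U \<Longrightarrow> l \<in> Arr V \<Longrightarrow> Dom U G = Cod U F \<Longrightarrow> Dom V l = Cod V k \<Longrightarrow>
   FArr (TFun T) (G, l) \<cdot>\<^bsub>U\<^esub> FArr (TFun T) (F, k) = FArr (TFun T) (G \<cdot>\<^bsub>U\<^esub> F, l \<cdot>\<^bsub>V\<^esub> k)"
  using TF.F_cmp'[of "(F, k)" "(G, l)"] by simp

lemma rho_simps [simp]:
  assumes "x \<in> EObj C"
  shows "TRho T x \<in> Arr U" "Dom U (TRho T x) = FObj (TFun T) (x, Unit V)" "Cod U (TRho T x) = x"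
  using T.rho_hom[OF assms] by (auto simp: in_Hom)

lemma phi_simps' [simp]:
  assumes "v \<in> Obj V" "x \<in> EObj C" "y \<in> EObj C"
  shows "TPhi T v x y \<in> Arr V" "Dom V (TPhi T v x y) = EHom C (FObj (TFun T) (x, v)) y"
    "Cod V (TPhi T v x y) = IHom V v (EHom C x y)"
  using T.phi_hom[OF assms] by (auto simp: in_Hom)

lemma induced_weak_tensoring: "weak_tensoring s W MW D M' T'"
proof (intro weak_tensoring.intro weak_tensoring_axioms.intro)
  show "sm7_model_category s W MW D M'" by (rule base_sm7)
  show "is_functor (prod_cat U' W) U' (TFun T')"
    unfolding induced_tensoring_simps using F.is_functor_axioms T.tensor_functor by (rule I.is_functor_transport)
  show "pushout_product_axiom U' M' W MW U' M' (TFun T')"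
    unfolding induced_tensoring_simps base_model_eq
    by (rule I.pushout_product_transport[OF C.underlying.model_category_axioms F.is_functor_axioms
          T.tensor_functor _ _ T.external_pushout_product]) (auto simp: Q.left_cof Q.left_acyclic_cof)
  fix x y w
  show "cofibrant U' M' (FObj (TFun T') (x, w))" if "cofibrant U' M' x" "cofibrant W MW w"
    using that T.tensor_cofibrant Q.left_cofibrant by (simp add: cofibrant_base induced_tensoring_simps)
  show "TPhi T' w x y \<in> Hom W (EHom D (FObj (TFun T') (x, w)) y) (IHom W w (EHom D x y))"
    if "w \<in> Obj W" "x \<in> EObj D" "y \<in> EObj D"
    using that by (simp add: induced_tensoring_simps in_Hom)
  show "TPhi T' w x y \<in> Weq MW" if "cofibrant W MW w" "cofibrant U' M' x" "fibrant U' M' y"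
  proof -
    have *: "cofibrant U M x" "fibrant U M y" "x \<in> EObj C" "y \<in> EObj C" "w \<in> Obj W" "cofibrant V MV (Fo w)"
      using that Q.left_cofibrant by (auto simp: cofibrant_base fibrant_base cofibrant_obj fibrant_eobj)
    show ?thesis
      unfolding induced_tensoring_simps
      by (rule theta_cmp_weq[OF that(1) C.sm7_fibrant[OF *(1,2)] T.phi_hom T.phi_weq
            C.sm7_fibrant[OF T.tensor_cofibrant]]) (use * in simp_all)
  qed
next
  fix k w w' f x x' g y y'
  assume k: "k \<in> Hom W w w'" and "f \<in> Hom U' x x'" "g \<in> Hom U' y y'"
  then obtain f' g' where f: "f' \<in> Hom U x x'" "f = \<phi> f'" and g: "g' \<in> Hom U y y'" "g = \<phi> g'"
    by (meson I.hom_cases)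
  note h = HomD[OF k] HomD[OF f(1)] HomD[OF g(1)]
  have o: "w \<in> Obj W" "w' \<in> Obj W" "x \<in> EObj C" "x' \<in> EObj C" "y \<in> EObj C" "y' \<in> EObj C"
    using h C.arr_obj[of f'] C.arr_obj[of g'] by auto
  have Fk: "Fa k \<in> Hom V (Fo w) (Fo w')" using h by (simp add: in_Hom)
  let ?t = "FArr (TFun T) (f', Fa k)"
  have e: "ehom_arr V C f' g' \<in> Hom V (EHom C x' y) (EHom C x y')" using h by (simp add: in_Hom)
  have "TPhi T' w x y' \<cdot>\<^bsub>W\<^esub> ehom_arr W D (FArr (TFun T') (f, k)) g
    = \<theta> w (EHom C x y') \<cdot>\<^bsub>W\<^esub> Ga (TPhi T (Fo w) x y' \<cdot>\<^bsub>V\<^esub> ehom_arr V C ?t g')"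
    using h o by (simp add: induced_tensoring_simps f(2) g(2) ehom_base)
  also have "\<dots> = (\<theta> w (EHom C x y') \<cdot>\<^bsub>W\<^esub> Ga (ihom_arr V (Fa k) (ehom_arr V C f' g'))) \<cdot>\<^bsub>W\<^esub> Ga (TPhi T (Fo w') x' y)"
    unfolding T.phi_natural[OF Fk f(1) g(1)] using h o by simp
  also have "\<dots> = ihom_arr W k (ehom_arr W D f g) \<cdot>\<^bsub>W\<^esub> TPhi T' w' x' y"
    unfolding theta_nat[OF k e] using h o by (simp add: induced_tensoring_simps f(2) g(2) ehom_base)
  finally show "TPhi T' w x y' \<cdot>\<^bsub>W\<^esub> ehom_arr W D (FArr (TFun T') (f, k)) g
    = ihom_arr W k (ehom_arr W D f g) \<cdot>\<^bsub>W\<^esub> TPhi T' w' x' y" .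
next
  fix x assume x: "x \<in> EObj D"
  then have o: "x \<in> EObj C" by simp
  show "TRho T' x \<in> Hom U' (FObj (TFun T') (x, Unit W)) x"
    using o by (simp add: induced_tensoring_simps in_Hom)
  fix y assume "y \<in> EObj D"
  then have y: "y \<in> EObj C" by simp
  let ?t = "FArr (TFun T) (Ide U x, \<epsilon>)" and ?d = "EHom C x y"
  have t: "?t \<in> Arr U" "Dom U ?t = FObj (TFun T) (x, Fo (Unit W))" "Cod U ?t = FObj (TFun T) (x, Unit V)"
    using o by simp_all
  have e: "\<epsilon> \<in> Hom V (Fo (Unit W)) (Unit V)" "Ide U x \<in> Hom U x x" "Ide U y \<in> Hom U y y"
    using o y by (simp_all add: in_Hom)
  have "ehom_arr V C (Ide U x) (Ide U y) = Ide V ?d"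
    using o y by (simp add: C.ehom_arr_ide C.precomp_ide C.postcomp_ide)
  then have nat: "TPhi T (Fo (Unit W)) x y \<cdot>\<^bsub>V\<^esub> precomp V C ?t y = ihom_arr V \<epsilon> (Ide V ?d) \<cdot>\<^bsub>V\<^esub> TPhi T (Unit V) x y"
    using T.phi_natural[OF e] t y by (simp add: C.ehom_arr_ide)
  have "TPhi T' (Unit W) x y \<cdot>\<^bsub>W\<^esub> precomp W D (TRho T' x) y
    = \<theta> (Unit W) ?d \<cdot>\<^bsub>W\<^esub> Ga ((TPhi T (Fo (Unit W)) x y \<cdot>\<^bsub>V\<^esub> precomp V C ?t y) \<cdot>\<^bsub>V\<^esub> precomp V C (TRho T x) y)"
    using t o y by (simp add: induced_tensoring_simps precomp_base C.precomp_cmp)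
  also have "\<dots> = \<theta> (Unit W) ?d \<cdot>\<^bsub>W\<^esub> Ga (ihom_arr V \<epsilon> (Ide V ?d) \<cdot>\<^bsub>V\<^esub> canonical_map V C x y)"
    unfolding nat T.phi_rho[OF o y, symmetric] using o y by simp
  also have "\<dots> = canonical_map W D x y"
    unfolding canonical_map_def using theta_unit[of ?d] o y by simp
  finally show "TPhi T' (Unit W) x y \<cdot>\<^bsub>W\<^esub> precomp W D (TRho T' x) y = canonical_map W D x y" .
next
  fix f x x' assume "f \<in> Hom U' x x'"
  then obtain f' where f: "f' \<in> Hom U x x'" "f = \<phi> f'" by (rule I.hom_cases)
  note h = HomD[OF f(1)]
  have o: "x \<in> EObj C" "x' \<in> EObj C" using h C.arr_obj[of f'] by auto
  let ?t = "\<lambda>x. FArr (TFun T) (Ide U x, \<epsilon>)" and ?f = "\<lambda>v. FArr (TFun T) (f', Ide V v)"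
  have "(TRho T x' \<cdot>\<^bsub>U\<^esub> ?t x') \<cdot>\<^bsub>U\<^esub> ?f (Fo (Unit W)) = (TRho T x' \<cdot>\<^bsub>U\<^esub> ?f (Unit V)) \<cdot>\<^bsub>U\<^esub> ?t x"
    using h o by (simp add: tensor_cmp)
  also have "\<dots> = f' \<cdot>\<^bsub>U\<^esub> (TRho T x \<cdot>\<^bsub>U\<^esub> ?t x)"
    unfolding T.rho_natural[OF f(1)] using h o by simp
  finally have "\<phi> ((TRho T x' \<cdot>\<^bsub>U\<^esub> ?t x') \<cdot>\<^bsub>U\<^esub> ?f (Fo (Unit W))) = \<phi> (f' \<cdot>\<^bsub>U\<^esub> (TRho T x \<cdot>\<^bsub>U\<^esub> ?t x))"
    by simp
  then show "TRho T' x' \<cdot>\<^bsub>U'\<^esub> FArr (TFun T') (f, Ide W (Unit W)) = f \<cdot>\<^bsub>U'\<^esub> TRho T' x"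
    using h o by (simp add: induced_tensoring_simps f(2) cmp_base)
qed

lemma induced_set_compatible_tensoring:
  assumes "set_compatible_tensoring V C T"
  shows "set_compatible_tensoring W D T'"
  unfolding set_compatible_tensoring_def
proof (intro ballI)
  fix w x y assume "w \<in> Obj W" "x \<in> EObj D" "y \<in> EObj D"
  then have o: "w \<in> Obj W" "x \<in> EObj C" "y \<in> EObj C" "Fo w \<in> Obj V" "EHom C x y \<in> Obj V" by simp_all
  have "bij_betw (\<lambda>f. TPhi T (Fo w) x y \<cdot>\<^bsub>V\<^esub> f) (Hom V (Unit V) (EHom C (FObj (TFun T) (x, Fo w)) y))
      (Hom V (Unit V) (IHom V (Fo w) (EHom C x y)))"
    using assms o unfolding set_compatible_tensoring_def by blast
  from theta_cmp_elements[OF o(1,5) T.phi_hom[OF o(4,2,3)] this]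
  show "bij_betw (\<lambda>f. TPhi T' w x y \<cdot>\<^bsub>W\<^esub> f) (Hom W (Unit W) (EHom D (FObj (TFun T') (x, w)) y))
      (Hom W (Unit W) (IHom W w (EHom D x y)))"
    by (simp add: induced_tensoring_simps)
qed

lemma induced_unital_tensoring:
  assumes "unital_tensoring V C T"
  shows "unital_tensoring W D T'"
  unfolding unital_tensoring_def
proof
  fix x assume "x \<in> EObj D"
  then have x: "x \<in> EObj C" by simp
  have "is_iso (prod_cat U V) (Ide U x, \<epsilon>)"
    by (rule category.is_isoI(1)[OF TF.A.category_axioms, of _ "(x, Fo (Unit W))" "(x, Unit V)" "(Ide U x, inv_arr V \<epsilon>)"])
      (use x eps in \<open>simp_all add: in_Hom\<close>)
  then have "is_iso U (FArr (TFun T) (Ide U x, \<epsilon>))" by (rule TF.F_iso)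
  moreover have "is_iso U (TRho T x)" using assms x by (simp add: unital_tensoring_def)
  ultimately show "is_iso U' (TRho T' x)"
    unfolding induced_tensoring_simps using x by (intro I.is_iso_phi C.underlying.is_iso_cmp) simp_all
qed

end

context
  fixes P :: "('c, 'c \<times> 'm \<times> 'c, 'v, 'm) cotensoring"
  assumes wc: "weak_cotensoring s V MV C M P"
begin

interpretation P: weak_cotensoring s V MV C M P
  by (rule wc)

interpretation PF: is_functor "prod_cat (underlying V C) (op_cat V)" "underlying V C" "PFun P"
  by (rule P.cotensor_functor)

abbreviation "P' \<equiv> induced_cotensoring W V A C P"

lemma induced_cotensoring_simps:
  "PFun P' = I.transport_func (LeftF A) (PFun P)"
  "PPsi P' w x y = \<theta> w (EHom C x y) \<cdot>\<^bsub>W\<^esub> Ga (PPsi P (Fo w) x y)"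
  "PEta P' y = \<phi> (FArr (PFun P) (Ide U y, \<epsilon>) \<cdot>\<^bsub>U\<^esub> PEta P y)"
  by (simp_all add: induced_cotensoring_def I.transport_func_def unbase_eq)

lemma cotensor_arr [simp]:
  assumes "F \<in> Arr U" "k \<in> Arr V"
  shows "FArr (PFun P) (F, k) \<in> Arr U" "Dom U (FArr (PFun P) (F, k)) = FObj (PFun P) (Dom U F, Cod V k)"
    "Cod U (FArr (PFun P) (F, k)) = FObj (PFun P) (Cod U F, Dom V k)"
  using PF.F_simps(2-4)[of "(F, k)"] assms by simp_all

lemma cotensor_cmp:
  "F \<in> Arr U \<Longrightarrow> k \<in> Arr V \<Longrightarrow> G \<in> Arr U \<Longrightarrow> l \<in> Arr V \<Longrightarrow> Dom U G = Cod U F \<Longrightarrow> Cod V l = Dom V k \<Longrightarrow>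
   FArr (PFun P) (G, l) \<cdot>\<^bsub>U\<^esub> FArr (PFun P) (F, k) = FArr (PFun P) (G \<cdot>\<^bsub>U\<^esub> F, k \<cdot>\<^bsub>V\<^esub> l)"
  using PF.F_cmp'[of "(F, k)" "(G, l)"] by simp

lemma eta_simps [simp]:
  assumes "y \<in> EObj C"
  shows "PEta P y \<in> Arr U" "Dom U (PEta P y) = y" "Cod U (PEta P y) = FObj (PFun P) (y, Unit V)"
  using P.eta_hom[OF assms] by (auto simp: in_Hom)

lemma psi_simps' [simp]:
  assumes "v \<in> Obj V" "x \<in> EObj C" "y \<in> EObj C"
  shows "PPsi P v x y \<in> Arr V" "Dom V (PPsi P v x y) = EHom C x (FObj (PFun P) (y, v))"
    "Cod V (PPsi P v x y) = IHom V v (EHom C x y)"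
  using P.psi_hom[OF assms] by (auto simp: in_Hom)

lemma left_op_functor: "is_functor (op_cat W) (op_cat V) (LeftF A)"
  by (rule is_functorI) (simp_all add: W.category_op V.category_op in_Hom)

lemma induced_weak_cotensoring: "weak_cotensoring s W MW D M' P'"
proof (intro weak_cotensoring.intro weak_cotensoring_axioms.intro)
  show "sm7_model_category s W MW D M'" by (rule base_sm7)
  show "is_functor (prod_cat U' (op_cat W)) U' (PFun P')"
    unfolding induced_cotensoring_simps using left_op_functor P.cotensor_functor by (rule I.is_functor_transport)
  show "pullback_power_axiom U' M' W MW U' M' (PFun P')"
    unfolding induced_cotensoring_simps base_model_eq
    by (rule I.pullback_power_transport[OF C.underlying.model_category_axioms F.is_functor_axioms
          P.cotensor_functor _ _ P.external_pullback_power]) (auto simp: Q.left_cof Q.left_acyclic_cof)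
  fix x y w
  show "fibrant U' M' (FObj (PFun P') (y, w))" if "fibrant U' M' y" "cofibrant W MW w"
    using that P.cotensor_fibrant Q.left_cofibrant by (simp add: fibrant_base induced_cotensoring_simps)
  show "PPsi P' w x y \<in> Hom W (EHom D x (FObj (PFun P') (y, w))) (IHom W w (EHom D x y))"
    if "w \<in> Obj W" "x \<in> EObj D" "y \<in> EObj D"
    using that by (simp add: induced_cotensoring_simps in_Hom)
  show "PPsi P' w x y \<in> Weq MW" if "cofibrant W MW w" "cofibrant U' M' x" "fibrant U' M' y"
  proof -
    have *: "cofibrant U M x" "fibrant U M y" "x \<in> EObj C" "y \<in> EObj C" "w \<in> Obj W" "cofibrant V MV (Fo w)"
      using that Q.left_cofibrant by (auto simp: cofibrant_base fibrant_base cofibrant_obj fibrant_eobj)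
    show ?thesis
      unfolding induced_cotensoring_simps
      by (rule theta_cmp_weq[OF that(1) C.sm7_fibrant[OF *(1,2)] P.psi_hom P.psi_weq
            C.sm7_fibrant[OF _ P.cotensor_fibrant]]) (use * in simp_all)
  qed
next
  fix k w w' f x x' g y y'
  assume k: "k \<in> Hom W w w'" and "f \<in> Hom U' x x'" "g \<in> Hom U' y y'"
  then obtain f' g' where f: "f' \<in> Hom U x x'" "f = \<phi> f'" and g: "g' \<in> Hom U y y'" "g = \<phi> g'"
    by (meson I.hom_cases)
  note h = HomD[OF k] HomD[OF f(1)] HomD[OF g(1)]
  have o: "w \<in> Obj W" "w' \<in> Obj W" "x \<in> EObj C" "x' \<in> EObj C" "y \<in> EObj C" "y' \<in> EObj C"
    using h C.arr_obj[of f'] C.arr_obj[of g'] by auto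
  have Fk: "Fa k \<in> Hom V (Fo w) (Fo w')" using h by (simp add: in_Hom)
  let ?t = "FArr (PFun P) (g', Fa k)"
  have e: "ehom_arr V C f' g' \<in> Hom V (EHom C x' y) (EHom C x y')" using h by (simp add: in_Hom)
  have "PPsi P' w x y' \<cdot>\<^bsub>W\<^esub> ehom_arr W D f (FArr (PFun P') (g, k))
    = \<theta> w (EHom C x y') \<cdot>\<^bsub>W\<^esub> Ga (PPsi P (Fo w) x y' \<cdot>\<^bsub>V\<^esub> ehom_arr V C f' ?t)"
    using h o by (simp add: induced_cotensoring_simps f(2) g(2) ehom_base)
  also have "\<dots> = (\<theta> w (EHom C x y') \<cdot>\<^bsub>W\<^esub> Ga (ihom_arr V (Fa k) (ehom_arr V C f' g'))) \<cdot>\<^bsub>W\<^esub> Ga (PPsi P (Fo w') x' y)"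
    unfolding P.psi_natural[OF Fk f(1) g(1)] using h o by simp
  also have "\<dots> = ihom_arr W k (ehom_arr W D f g) \<cdot>\<^bsub>W\<^esub> PPsi P' w' x' y"
    unfolding theta_nat[OF k e] using h o by (simp add: induced_cotensoring_simps f(2) g(2) ehom_base)
  finally show "PPsi P' w x y' \<cdot>\<^bsub>W\<^esub> ehom_arr W D f (FArr (PFun P') (g, k))
    = ihom_arr W k (ehom_arr W D f g) \<cdot>\<^bsub>W\<^esub> PPsi P' w' x' y" .
next
  fix y assume "y \<in> EObj D"
  then have o: "y \<in> EObj C" by simp
  show "PEta P' y \<in> Hom U' y (FObj (PFun P') (y, Unit W))"
    using o by (simp add: induced_cotensoring_simps in_Hom)
  fix x assume "x \<in> EObj D"
  then have x: "x \<in> EObj C" by simp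
  let ?t = "FArr (PFun P) (Ide U y, \<epsilon>)" and ?d = "EHom C x y"
  have t: "?t \<in> Arr U" "Dom U ?t = FObj (PFun P) (y, Unit V)" "Cod U ?t = FObj (PFun P) (y, Fo (Unit W))"
    using o by simp_all
  have e: "\<epsilon> \<in> Hom V (Fo (Unit W)) (Unit V)" "Ide U x \<in> Hom U x x" "Ide U y \<in> Hom U y y"
    using o x by (simp_all add: in_Hom)
  have "ehom_arr V C (Ide U x) (Ide U y) = Ide V ?d"
    using o x by (simp add: C.ehom_arr_ide C.precomp_ide C.postcomp_ide)
  then have nat: "PPsi P (Fo (Unit W)) x y \<cdot>\<^bsub>V\<^esub> postcomp V C x ?t = ihom_arr V \<epsilon> (Ide V ?d) \<cdot>\<^bsub>V\<^esub> PPsi P (Unit V) x y"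
    using P.psi_natural[OF e] t x by (simp add: C.ehom_arr_ide)
  have "PPsi P' (Unit W) x y \<cdot>\<^bsub>W\<^esub> postcomp W D x (PEta P' y)
    = \<theta> (Unit W) ?d \<cdot>\<^bsub>W\<^esub> Ga ((PPsi P (Fo (Unit W)) x y \<cdot>\<^bsub>V\<^esub> postcomp V C x ?t) \<cdot>\<^bsub>V\<^esub> postcomp V C x (PEta P y))"
    using t o x by (simp add: induced_cotensoring_simps postcomp_base C.postcomp_cmp)
  also have "\<dots> = \<theta> (Unit W) ?d \<cdot>\<^bsub>W\<^esub> Ga (ihom_arr V \<epsilon> (Ide V ?d) \<cdot>\<^bsub>V\<^esub> canonical_map V C x y)"
    unfolding nat P.psi_eta[OF x o, symmetric] using o x by simp
  also have "\<dots> = canonical_map W D x y"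
    unfolding canonical_map_def using theta_unit[of ?d] o x by simp
  finally show "PPsi P' (Unit W) x y \<cdot>\<^bsub>W\<^esub> postcomp W D x (PEta P' y) = canonical_map W D x y" .
next
  fix g y y' assume "g \<in> Hom U' y y'"
  then obtain g' where g: "g' \<in> Hom U y y'" "g = \<phi> g'" by (rule I.hom_cases)
  note h = HomD[OF g(1)]
  have o: "y \<in> EObj C" "y' \<in> EObj C" using h C.arr_obj[of g'] by auto
  let ?t = "\<lambda>y. FArr (PFun P) (Ide U y, \<epsilon>)" and ?g = "\<lambda>v. FArr (PFun P) (g', Ide V v)"
  have nat: "?g (Unit V) \<cdot>\<^bsub>U\<^esub> PEta P y = PEta P y' \<cdot>\<^bsub>U\<^esub> g'"
    using P.eta_natural[OF g(1)] by simp
  have "?g (Fo (Unit W)) \<cdot>\<^bsub>U\<^esub> (?t y \<cdot>\<^bsub>U\<^esub> PEta P y) = (?g (Fo (Unit W)) \<cdot>\<^bsub>U\<^esub> ?t y) \<cdot>\<^bsub>U\<^esub> PEta P y"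
    using h o by simp
  also have "\<dots> = (?t y' \<cdot>\<^bsub>U\<^esub> ?g (Unit V)) \<cdot>\<^bsub>U\<^esub> PEta P y"
    using h o by (simp add: cotensor_cmp)
  also have "\<dots> = (?t y' \<cdot>\<^bsub>U\<^esub> PEta P y') \<cdot>\<^bsub>U\<^esub> g'"
    using h o by (simp add: nat)
  finally have "\<phi> (?g (Fo (Unit W)) \<cdot>\<^bsub>U\<^esub> (?t y \<cdot>\<^bsub>U\<^esub> PEta P y)) = \<phi> ((?t y' \<cdot>\<^bsub>U\<^esub> PEta P y') \<cdot>\<^bsub>U\<^esub> g')"
    by simp
  then show "PEta P' y' \<cdot>\<^bsub>U'\<^esub> g = FArr (PFun P') (g, Ide W (Unit W)) \<cdot>\<^bsub>U'\<^esub> PEta P' y"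
    using h o by (simp add: induced_cotensoring_simps g(2) cmp_base)
qed

lemma induced_set_compatible_cotensoring:
  assumes "set_compatible_cotensoring V C P"
  shows "set_compatible_cotensoring W D P'"
  unfolding set_compatible_cotensoring_def
proof (intro ballI)
  fix w x y assume "w \<in> Obj W" "x \<in> EObj D" "y \<in> EObj D"
  then have o: "w \<in> Obj W" "x \<in> EObj C" "y \<in> EObj C" "Fo w \<in> Obj V" "EHom C x y \<in> Obj V" by simp_all
  have "bij_betw (\<lambda>f. PPsi P (Fo w) x y \<cdot>\<^bsub>V\<^esub> f) (Hom V (Unit V) (EHom C x (FObj (PFun P) (y, Fo w))))
      (Hom V (Unit V) (IHom V (Fo w) (EHom C x y)))"
    using assms o unfolding set_compatible_cotensoring_def by blast
  from theta_cmp_elements[OF o(1,5) P.psi_hom[OF o(4,2,3)] this]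
  show "bij_betw (\<lambda>f. PPsi P' w x y \<cdot>\<^bsub>W\<^esub> f) (Hom W (Unit W) (EHom D x (FObj (PFun P') (y, w))))
      (Hom W (Unit W) (IHom W w (EHom D x y)))"
    by (simp add: induced_cotensoring_simps)
qed

lemma induced_unital_cotensoring:
  assumes "unital_cotensoring V C P"
  shows "unital_cotensoring W D P'"
  unfolding unital_cotensoring_def
proof
  fix y assume "y \<in> EObj D"
  then have y: "y \<in> EObj C" by simp
  have "is_iso (prod_cat U (op_cat V)) (Ide U y, \<epsilon>)"
    by (rule category.is_isoI(1)[OF PF.A.category_axioms, of _ "(y, Unit V)" "(y, Fo (Unit W))" "(Ide U y, inv_arr V \<epsilon>)"])
      (use y eps in \<open>simp_all add: in_Hom\<close>)
  then have "is_iso U (FArr (PFun P) (Ide U y, \<epsilon>))" by (rule PF.F_iso)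
  moreover have "is_iso U (PEta P y)" using assms y by (simp add: unital_cotensoring_def)
  ultimately show "is_iso U' (PEta P' y)"
    unfolding induced_cotensoring_simps using y by (intro I.is_iso_phi C.underlying.is_iso_cmp) simp_all
qed

end

end

theorem proposition5p6:
  fixes V :: "('v, 'm) mon_cat" and MV :: "'m model_str"
    and W :: "('w, 'n) mon_cat" and MW :: "'n model_str"
    and A :: "('w, 'n, 'v, 'm) lax_adj"
    and C :: "('c, 'v, 'm) ecat" and M :: "('c \<times> 'm \<times> 'c) model_str"
  assumes "infinite (UNIV :: 's set)"
    and "symmetric_monoidal_model_category TYPE('s) V MV"
    and "symmetric_monoidal_model_category TYPE('s) W MW"
    and "weak_monoidal_Quillen_adjunction W MW V MV A"
    and "is_iso V (oplax_unit V A)"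
    and "sm7_model_category TYPE('s) V MV C M"
  shows "(\<forall>T. weak_tensoring TYPE('s) V MV C M T \<longrightarrow>
            weak_tensoring TYPE('s) W MW (base_change W A C) (base_model W A M)
              (induced_tensoring W V A C T)
          \<and> (set_compatible_tensoring V C T \<longrightarrow>
               set_compatible_tensoring W (base_change W A C) (induced_tensoring W V A C T))
          \<and> (unital_tensoring V C T \<longrightarrow>
               unital_tensoring W (base_change W A C) (induced_tensoring W V A C T)))
       \<and> (\<forall>P. weak_cotensoring TYPE('s) V MV C M P \<longrightarrow>
            weak_cotensoring TYPE('s) W MW (base_change W A C) (base_model W A M)
              (induced_cotensoring W V A C P)
          \<and> (set_compatible_cotensoring V C P \<longrightarrow>
               set_compatible_cotensoring W (base_change W A C) (induced_cotensoring W V A C P))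
          \<and> (unital_cotensoring V C P \<longrightarrow>
               unital_cotensoring W (base_change W A C) (induced_cotensoring W V A C P)))"
proof -
  interpret base_change_setting "TYPE('s)" W MW V MV A C M
    using assms
    by (intro base_change_setting.intro base_change_setting_axioms.intro
        weak_quillen_setting.intro weak_quillen_setting_axioms.intro)
  show ?thesis
    using induced_weak_tensoring induced_set_compatible_tensoring induced_unital_tensoring
      induced_weak_cotensoring induced_set_compatible_cotensoring induced_unital_cotensoring
    by blast
qed

end
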